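(* Let $V$ be a $K$-vector space of dimension $5$. For $\phi\in S^3V$ let $B_\phi\colon \Gamma^{2,2,1,1}V\to\Gamma^{2,1,1}V$ be the $SL(V)$-invariant contraction operator (a linear map between $45$-dimensional spaces, depending linearly on $\phi$). Then there is an irreducible homogeneous polynomial $P$ of degree $15$ on $S^3V$ such that $$2P(\phi)^3=\det B_\phi\qquad\text{for all }\phi\in S^3V.$$ Moreover, $P$ is the equation of $\sigma_7(\mathbf{P}(V),\mathcal{O}(3))\subset\mathbf{P}(S^3V)$, i.e. $\sigma_7(\mathbf{P}(V),\mathcal{O}(3))$ is the hypersurface $\{P=0\}$.
   Context: $K$ is an algebraically closed field of characteristic zero. $\mathbf{P}(V)$ is embedded in $\mathbf{P}(S^3V)$ as the Veronese variety of cubes $[v^3]$, $0\neq v\in V$; elements of $S^3V$ are regarded as homogeneous cubic polynomials in $5$ variables. $\sigma_s(\mathbf{P}(V),\mathcal{O}(3))$ is the $s$-secant variety: the Zariski closure in $\mathbf{P}(S^3V)$ of the set of classes of cubics of the form $\sum_{i=1}^s g_i^3$ with $g_i\in V$. For a partition $\alpha$, $\Gamma^\alpha V$ is the Schur module, an irreducible $SL(V)$-module. The contraction operator $B_\phi$ is determined up to a nonzero scalar multiple independent of $\phi$, and is realized explicitly as follows. Fix a basis $e_0,\dots,e_4$ of $V$ and the identification $\wedge^5V\simeq K$ given by $e_0\wedge e_1\wedge e_2\wedge e_3\wedge e_4\mapsto 1$. For $\phi\in S^3V$ define $B'_\phi\colon\wedge^4V\otimes\wedge^2V\to\wedge^3V\otimes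 V$, linearly in $\phi$, by the following formula for $\phi=u_1u_2u_3$ with $u_i\in V$, $\omega\in\wedge^4V$, $\xi\in\wedge^2V$: $$B'_{u_1u_2u_3}(\omega\otimes\xi)=\sum_{\sigma\in\Sigma_3}(\omega\wedge u_{\sigma(1)})\,(\xi\wedge u_{\sigma(2)})\otimes u_{\sigma(3)},$$ where $\omega\wedge u_{\sigma(1)}\in\wedge^5V\simeq K$ and $\Sigma_3$ is the symmetric group. Let $c\colon\wedge^4V\otimes\wedge^2V\to V$ be the contraction $c(\omega\otimes(a\wedge b))=(\omega\wedge a)b-(\omega\wedge b)a$, and let $d\colon V\otimes\wedge^3V\to\wedge^4V$ be the wedge product map. Then $\Gamma^{2,2,1,1}V$ is identified with $\ker c$ and $\Gamma^{2,1,1}V$ with $\ker d$; both have dimension $45$. $B'_\phi$ maps into $\ker d$, and $B_\phi$ is the restriction of $B'_\phi$ to $\ker c$, viewed as a map $\ker c\to\ker d$. $\det B_\phi$ is the determinant of the matrix of $B_\phi$ with respect to fixed bases (independent of $\phi$) of $\Gamma^{2,2,1,1}V$ and $\Gamma^{2,1,1}V$; changing the bases, or rescaling $B$, only multiplies $\det B_\phi$ by a nonzero constant independent of $\phi$. *)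

theory Defs
  imports "HOL-Analysis.Analysis" "HOL-Library.Poly_Mapping"
begin

text \<open>
  \<open>V\<close> is an abstract vector space with a chosen basis \<open>e :: 5 \<Rightarrow> 'v\<close>; the type \<open>5\<close> carries the
  linear order \<open>0 < 1 < 2 < 3 < 4\<close>. The symmetric and exterior algebras of \<open>V\<close> and their tensor
  products are written in the bases that \<open>e\<close> induces on them.
\<close>

definition is_basis :: "('a::field \<Rightarrow> 'v::ab_group_add \<Rightarrow> 'v) \<Rightarrow> ('i \<Rightarrow> 'v) \<Rightarrow> 'v set \<Rightarrow> bool" where
  "is_basis smul b S \<longleftrightarrow>
     inj b \<and> \<not> module.dependent smul (range b) \<and> module.span smul (range b) = S"

definition coords :: "('a::field \<Rightarrow> 'v::ab_group_add \<Rightarrow> 'v) \<Rightarrow> (5 \<Rightarrow> 'v) \<Rightarrow> 'v \<Rightarrow> 'a ^ 5" where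
  "coords smul e v = (\<chi> i. module.representation smul (range e) v (e i))"


section \<open>Polynomials\<close>

type_synonym ('i, 'a) mpolynomial = "('i \<Rightarrow>\<^sub>0 nat) \<Rightarrow>\<^sub>0 'a"

definition monomial_degree :: "('i \<Rightarrow>\<^sub>0 nat) \<Rightarrow> nat" where
  "monomial_degree m = (\<Sum>i\<in>Poly_Mapping.keys m. Poly_Mapping.lookup m i)"

definition homogeneous :: "nat \<Rightarrow> ('i, 'a::zero) mpolynomial \<Rightarrow> bool" where
  "homogeneous n p \<longleftrightarrow> (\<forall>m\<in>Poly_Mapping.keys p. monomial_degree m = n)"

definition peval :: "('i \<Rightarrow> 'a::comm_semiring_1) \<Rightarrow> ('i, 'a) mpolynomial \<Rightarrow> 'a" where
  "peval x p = (\<Sum>m\<in>Poly_Mapping.keys p. Poly_Mapping.lookup p m *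
     (\<Prod>i\<in>Poly_Mapping.keys m. x i ^ Poly_Mapping.lookup m i))"

text \<open>\<open>S\<^sup>3V\<close>, with the basis vector \<open>e i\<close> as the \<open>i\<close>-th variable.\<close>

definition cubics :: "(5, 'a::zero) mpolynomial set" where
  "cubics = {\<phi>. homogeneous 3 \<phi>}"

text \<open>The element of \<open>S\<^sup>1V\<close> with the given coordinates.\<close>

definition linear_form :: "'a::comm_semiring_1 ^ 5 \<Rightarrow> (5, 'a) mpolynomial" where
  "linear_form u = (\<Sum>i\<in>UNIV. Poly_Mapping.single (Poly_Mapping.single i 1) (u $ i))"

definition cubic_monomial_of :: "5 \<Rightarrow> 5 \<Rightarrow> 5 \<Rightarrow> (5 \<Rightarrow>\<^sub>0 nat)" where
  "cubic_monomial_of i j k =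
     Poly_Mapping.single i 1 + Poly_Mapping.single j 1 + Poly_Mapping.single k 1"

text \<open>
  The \<open>35\<close> cubic monomials index the coordinates on \<open>S\<^sup>3V\<close>, so the polynomials on \<open>S\<^sup>3V\<close> form the
  ring \<open>(cubic_monomial, 'a) mpolynomial\<close>.
\<close>

typedef cubic_monomial = "{m :: 5 \<Rightarrow>\<^sub>0 nat. monomial_degree m = 3}"
  by (rule exI[of _ "Poly_Mapping.single 0 3"]) (simp add: monomial_degree_def del: single_numeral)

definition eval_cubic ::
  "(cubic_monomial, 'a::comm_semiring_1) mpolynomial \<Rightarrow> (5, 'a) mpolynomial \<Rightarrow> 'a" where
  "eval_cubic P \<phi> = peval (\<lambda>m. Poly_Mapping.lookup \<phi> (Rep_cubic_monomial m)) P"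


section \<open>The projective space of cubics and the secant varieties\<close>

definition proj_point :: "(5, 'a::field) mpolynomial \<Rightarrow> (5, 'a) mpolynomial set" where
  "proj_point \<phi> = {Poly_Mapping.single 0 c * \<phi> |c. c \<noteq> 0}"

definition proj_zeros ::
  "(cubic_monomial, 'a::field) mpolynomial set \<Rightarrow> (5, 'a) mpolynomial set set" where
  "proj_zeros Fs = proj_point ` {\<phi> \<in> cubics. \<phi> \<noteq> 0 \<and> (\<forall>F\<in>Fs. eval_cubic F \<phi> = 0)}"

definition zariski_closed :: "(5, 'a::field) mpolynomial set set \<Rightarrow> bool" where
  "zariski_closed Z \<longleftrightarrow> (\<exists>Fs. (\<forall>F\<in>Fs. \<exists>d. homogeneous d F) \<and> Z = proj_zeros Fs)"

definition zariski_closure ::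
  "(5, 'a::field) mpolynomial set set \<Rightarrow> (5, 'a) mpolynomial set set" where
  "zariski_closure X = \<Inter>{Z. zariski_closed Z \<and> X \<subseteq> Z}"

definition sum_of_cubes ::
  "('a::field \<Rightarrow> 'v::ab_group_add \<Rightarrow> 'v) \<Rightarrow> (5 \<Rightarrow> 'v) \<Rightarrow> nat \<Rightarrow> (nat \<Rightarrow> 'v) \<Rightarrow> (5, 'a) mpolynomial" where
  "sum_of_cubes smul e s g = (\<Sum>i<s. linear_form (coords smul e (g i)) ^ 3)"

definition secant_variety ::
  "('a::field \<Rightarrow> 'v::ab_group_add \<Rightarrow> 'v) \<Rightarrow> (5 \<Rightarrow> 'v) \<Rightarrow> nat \<Rightarrow> (5, 'a) mpolynomial set set" where
  "secant_variety smul e s =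
     zariski_closure (proj_point ` {sum_of_cubes smul e s g |g. sum_of_cubes smul e s g \<noteq> 0})"


section \<open>Exterior algebra and tensor products\<close>

text \<open>
  An element \<open>x :: 'a ^ 5 set\<close> of the exterior algebra has \<open>x $ S\<close> as its coefficient at
  \<open>e i\<^sub>1 \<and> \<dots> \<and> e i\<^sub>k\<close>, where \<open>S = {i\<^sub>1 < \<dots> < i\<^sub>k}\<close>. Thus the \<open>k\<close>-th exterior power consists
  of the \<open>x\<close> supported on the sets of cardinality \<open>k\<close>.
\<close>

definition shuffle_sign :: "5 set \<Rightarrow> 5 set \<Rightarrow> 'a::comm_ring_1" where
  "shuffle_sign A B = (- 1) ^ card {(a, b). a \<in> A \<and> b \<in> B \<and> b < a}"

definition wedge :: "'a::comm_ring_1 ^ 5 set \<Rightarrow> 'a ^ 5 set \<Rightarrow> 'a ^ 5 set" (infixr "\<and>\<^sub>e" 72) where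
  "x \<and>\<^sub>e y = (\<chi> S. \<Sum>A\<in>Pow S. shuffle_sign A (S - A) * x $ A * y $ (S - A))"

definition ext_vec :: "'a::comm_ring_1 ^ 5 \<Rightarrow> 'a ^ 5 set" where
  "ext_vec u = (\<chi> S. \<Sum>i | S = {i}. u $ i)"

text \<open>The identification of the fifth exterior power with \<open>K\<close>.\<close>

definition vol :: "'a ^ 5 set \<Rightarrow> 'a" where
  "vol x = x $ UNIV"

definition tensor :: "'a::comm_ring_1 ^ 'm \<Rightarrow> 'a ^ 'n \<Rightarrow> 'a ^ ('m \<times> 'n)" where
  "tensor x y = (\<chi> p. x $ fst p * y $ snd p)"

text \<open>The linear map on the tensor product that a bilinear map \<open>f\<close> induces.\<close>

definition tensor_lift ::
  "('a::comm_ring_1 ^ 'm \<Rightarrow> 'a ^ 'n \<Rightarrow> 'a ^ 'k) \<Rightarrow> 'a ^ ('m \<times> 'n) \<Rightarrow> 'a ^ 'k" where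
  "tensor_lift f t = (\<Sum>p\<in>UNIV. t $ p *s f (axis (fst p) 1) (axis (snd p) 1))"


section \<open>The contraction operator\<close>

text \<open>\<open>B'\<close> at the product of the three linear forms with coordinates \<open>u 0\<close>, \<open>u 1\<close>, \<open>u 2\<close>.\<close>

definition B_product ::
  "(nat \<Rightarrow> 'a::comm_ring_1 ^ 5) \<Rightarrow> 'a ^ (5 set \<times> 5 set) \<Rightarrow> 'a ^ (5 set \<times> 5)" where
  "B_product u = tensor_lift (\<lambda>\<omega> \<xi>. \<Sum>\<sigma> | \<sigma> permutes {..<3}.
     vol (\<omega> \<and>\<^sub>e ext_vec (u (\<sigma> 0))) *s tensor (\<xi> \<and>\<^sub>e ext_vec (u (\<sigma> 1))) (u (\<sigma> 2)))"

text \<open>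
  \<open>B'\<close> is extended linearly from the basis of monomials of \<open>S\<^sup>3V\<close>. The lemma \<open>B_prime_product\<close>
  below confirms that it is given by \<open>B_product\<close> on every product of three linear forms.
\<close>

definition B_prime ::
  "(5, 'a::comm_ring_1) mpolynomial \<Rightarrow> 'a ^ (5 set \<times> 5 set) \<Rightarrow> 'a ^ (5 set \<times> 5)" where
  "B_prime \<phi> t = (\<Sum>(i, j, k) \<in> {(i, j, k). i \<le> j \<and> j \<le> k}.
     Poly_Mapping.lookup \<phi> (cubic_monomial_of i j k) *s
     B_product (\<lambda>n. axis ([i, j, k] ! n) 1) t)"

text \<open>
  The contraction \<open>c\<close>, extended linearly from the basis elements \<open>\<omega> \<otimes> (e i \<and> e j)\<close> with
  \<open>i < j\<close>; see \<open>contraction_c_tensor\<close> below for its value at \<open>\<omega> \<otimes> (a \<and> b)\<close>.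
\<close>

definition contraction_c :: "'a::comm_ring_1 ^ (5 set \<times> 5 set) \<Rightarrow> 'a ^ 5" where
  "contraction_c = tensor_lift (\<lambda>\<omega> \<xi>. \<Sum>(i, j) \<in> {(i, j). i < j}. \<xi> $ {i, j} *s
     (vol (\<omega> \<and>\<^sub>e ext_vec (axis i 1)) *s axis j 1 - vol (\<omega> \<and>\<^sub>e ext_vec (axis j 1)) *s axis i 1))"

text \<open>
  The wedge product map \<open>d\<close>. Its tensor factors are swapped here, because the third exterior
  power comes first in the codomain of \<open>B'\<close>.
\<close>

definition wedge_d :: "'a::comm_ring_1 ^ (5 set \<times> 5) \<Rightarrow> 'a ^ 5 set" where
  "wedge_d = tensor_lift (\<lambda>\<eta> u. ext_vec u \<and>\<^sub>e \<eta>)"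

definition Gamma_2211 :: "('a::comm_ring_1 ^ (5 set \<times> 5 set)) set" where
  "Gamma_2211 = {t. (\<forall>A C. t $ (A, C) \<noteq> 0 \<longrightarrow> card A = 4 \<and> card C = 2) \<and> contraction_c t = 0}"

definition Gamma_211 :: "('a::comm_ring_1 ^ (5 set \<times> 5)) set" where
  "Gamma_211 = {t. (\<forall>D i. t $ (D, i) \<noteq> 0 \<longrightarrow> card D = 3) \<and> wedge_d t = 0}"

text \<open>Meaningful for bases \<open>b\<close> of \<open>Gamma_2211\<close> and \<open>b'\<close> of \<open>Gamma_211\<close>; see \<open>B_prime_in_Gamma_211\<close>.\<close>

definition B_matrix ::
  "(45 \<Rightarrow> 'a::field ^ (5 set \<times> 5 set)) \<Rightarrow> (45 \<Rightarrow> 'a ^ (5 set \<times> 5)) \<Rightarrow>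
   (5, 'a) mpolynomial \<Rightarrow> 'a ^ 45 ^ 45" where
  "B_matrix b b' \<phi> = (\<chi> i j. vec.representation (range b') (B_prime \<phi> (b j)) (b' i))"


section \<open>Agreement with the defining formulas\<close>

lemma wedge_linear:
  "(x + x') \<and>\<^sub>e y = x \<and>\<^sub>e y + x' \<and>\<^sub>e y"
  "x \<and>\<^sub>e (y + y') = x \<and>\<^sub>e y + x \<and>\<^sub>e y'"
  "(a *s x) \<and>\<^sub>e y = a *s (x \<and>\<^sub>e y)"
  "x \<and>\<^sub>e (a *s y) = a *s (x \<and>\<^sub>e y)"
  by (simp_all add: wedge_def vec_eq_iff sum.distrib sum_distrib_left algebra_simps)

lemma ext_vec_linear:
  "ext_vec (u + v) = ext_vec u + ext_vec v"
  "ext_vec (a *s u) = a *s ext_vec u"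
  by (simp_all add: ext_vec_def vec_eq_iff sum.distrib sum_distrib_left)

lemma vol_linear:
  "vol (x + y) = vol x + vol y"
  "vol (a *s x) = a * vol x"
  for x :: "'a::comm_ring_1 ^ 5 set"
  by (simp_all add: vol_def)

lemma tensor_linear:
  "tensor (x + x') y = tensor x y + tensor x' y"
  "tensor x (y + y') = tensor x y + tensor x y'"
  "tensor (a *s x) y = a *s tensor x y"
  "tensor x (a *s y) = a *s tensor x y"
  by (simp_all add: tensor_def vec_eq_iff algebra_simps)

lemmas multilinear = wedge_linear ext_vec_linear vol_linear tensor_linear

lemma vec_scale_distribs:
  fixes x y :: "'a::comm_ring_1 ^ 'n"
  shows "a *s (x + y) = a *s x + a *s y" "(a + b) *s x = a *s x + b *s x" "a *s (b *s x) = (a * b) *s x"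
    "a *s (x - y) = a *s x - a *s y" "(a - b) *s x = a *s x - b *s x"
  by (simp_all add: vec_eq_iff algebra_simps)

lemma linear_expansion:
  fixes f :: "'a::comm_ring_1 ^ 'n \<Rightarrow> 'a ^ 'k"
  assumes add: "\<And>x y. f (x + y) = f x + f y" and sc: "\<And>a x. f (a *s x) = a *s f x"
  shows "f x = (\<Sum>i\<in>UNIV. x $ i *s f (axis i 1))"
proof -
  have 0: "f 0 = 0" using sc[of 0 0] by (simp add: vec_eq_iff)
  have S: "f (\<Sum>i\<in>A. g i) = (\<Sum>i\<in>A. f (g i))" for g and A :: "'n set"
    by (induction A rule: infinite_finite_induct) (simp_all add: 0 add)
  have "x = (\<Sum>i\<in>UNIV. x $ i *s axis i 1)" by (simp add: basis_expansion)
  then have "f x = f (\<Sum>i\<in>UNIV. x $ i *s axis i 1)" by simp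
  then show ?thesis by (simp only: S sc)
qed

lemma tensor_lift_tensor:
  fixes f :: "'a::comm_ring_1 ^ 'm \<Rightarrow> 'a ^ 'n \<Rightarrow> 'a ^ 'k"
  assumes "\<And>x x' y. f (x + x') y = f x y + f x' y" "\<And>a x y. f (a *s x) y = a *s f x y"
    and "\<And>x y y'. f x (y + y') = f x y + f x y'" "\<And>a x y. f x (a *s y) = a *s f x y"
  shows "tensor_lift f (tensor x y) = f x y"
proof -
  have "f x y = (\<Sum>i\<in>UNIV. x $ i *s f (axis i 1) y)"
    by (rule linear_expansion[of "\<lambda>x. f x y"]) (use assms in auto)
  also have "\<dots> = (\<Sum>i\<in>UNIV. x $ i *s (\<Sum>j\<in>UNIV. y $ j *s f (axis i 1) (axis j 1)))"
    using linear_expansion[of "f _" y] assms by (simp cong: sum.cong)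
  also have "\<dots> = (\<Sum>i\<in>UNIV. \<Sum>j\<in>UNIV. (x $ i * y $ j) *s f (axis i 1) (axis j 1))"
    by (simp add: vec_eq_iff sum_distrib_left mult.assoc)
  also have "\<dots> = tensor_lift f (tensor x y)"
    by (simp add: tensor_lift_def tensor_def sum.cartesian_product case_prod_beta flip: UNIV_Times_UNIV)
  finally show ?thesis by simp
qed

lemma tensor_lift_cong_sum:
  "tensor_lift f t = (\<Sum>A\<in>UNIV. \<Sum>C\<in>UNIV. t $ (A, C) *s f (axis A 1) (axis C 1))"
  by (simp add: tensor_lift_def sum.cartesian_product case_prod_beta flip: UNIV_Times_UNIV)

theorem B_product_tensor:
  fixes u :: "nat \<Rightarrow> 'a::comm_ring_1 ^ 5"
  shows "B_product u (tensor \<omega> \<xi>) = (\<Sum>\<sigma> | \<sigma> permutes {..<3}.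
     vol (\<omega> \<and>\<^sub>e ext_vec (u (\<sigma> 0))) *s tensor (\<xi> \<and>\<^sub>e ext_vec (u (\<sigma> 1))) (u (\<sigma> 2)))"
proof -
  have sc: "(\<Sum>x\<in>X. a *s h x) = a *s sum h X" for a and h :: "'z \<Rightarrow> 'a ^ 'k" and X
    by (simp add: vec_eq_iff sum_distrib_left)
  show ?thesis unfolding B_product_def
    by (rule tensor_lift_tensor)
      (simp_all add: multilinear vec_scale_distribs sum.distrib flip: sc, simp_all add: ac_simps)
qed

lemma sum_permutes_3:
  fixes h :: "nat \<Rightarrow> nat \<Rightarrow> nat \<Rightarrow> 'b::comm_monoid_add"
  shows "(\<Sum>\<sigma> | \<sigma> permutes {..<3}. h (\<sigma> 0) (\<sigma> 1) (\<sigma> 2)) =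
    h 0 1 2 + h 1 0 2 + h 2 1 0 + h 0 2 1 + h 1 2 0 + h 2 0 1"
proof -
  have 3: "{..<3} = {0, 1, 2::nat}" by auto
  have f: "finite {1, 2::nat}" "0 \<notin> {1, 2::nat}" "finite {2::nat}" "1 \<notin> {2::nat}"
    "finite {} " "2 \<notin> ({} :: nat set)" by auto
  show ?thesis
    unfolding 3 sum_over_permutations_insert[OF f(1,2)] sum_over_permutations_insert[OF f(3,4)]
      permutes_sing
    by (simp add: transpose_def ac_simps)
qed

text \<open>The trilinear symmetric map behind \<open>B_product\<close>.\<close>

definition B_tri ::
  "'a::comm_ring_1 ^ (5 set \<times> 5 set) \<Rightarrow> 'a ^ 5 \<Rightarrow> 'a ^ 5 \<Rightarrow> 'a ^ 5 \<Rightarrow> 'a ^ (5 set \<times> 5)" where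
  "B_tri t x y z = B_product (\<lambda>n. [x, y, z] ! n) t"

lemma B_product_expand:
  "B_product u t = (\<Sum>p\<in>UNIV. t $ p *s
    (let G = (\<lambda>x y z. vol (axis (fst p) 1 \<and>\<^sub>e ext_vec x) *s tensor (axis (snd p) 1 \<and>\<^sub>e ext_vec y) z)
     in G (u 0) (u 1) (u 2) + G (u 1) (u 0) (u 2) + G (u 2) (u 1) (u 0) + G (u 0) (u 2) (u 1)
        + G (u 1) (u 2) (u 0) + G (u 2) (u 0) (u 1)))"
  unfolding B_product_def tensor_lift_def Let_def
  by (subst sum_permutes_3[of "\<lambda>a b c. vol (_ \<and>\<^sub>e ext_vec (u a)) *s tensor (_ \<and>\<^sub>e ext_vec (u b)) (u c)"])
     (rule refl)

lemma B_product_B_tri: "B_product u t = B_tri t (u 0) (u 1) (u 2)"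
  by (simp add: B_tri_def B_product_expand eval_nat_numeral)

lemma B_tri_symmetric: "B_tri t x y z = B_tri t y x z" "B_tri t x y z = B_tri t x z y"
  by (simp_all add: B_tri_def B_product_expand eval_nat_numeral Let_def ac_simps)

lemma B_tri_linear:
  "B_tri t (x + x') y z = B_tri t x y z + B_tri t x' y z"
  "B_tri t (a *s x) y z = a *s B_tri t x y z"
proof -
  have sc: "(\<Sum>x\<in>X. a *s h x) = a *s sum h X" for a :: "'a::comm_ring_1" and h :: "'z \<Rightarrow> 'a ^ 'k" and X
    by (simp add: vec_eq_iff sum_distrib_left)
  show "B_tri t (x + x') y z = B_tri t x y z + B_tri t x' y z"
    by (simp add: B_tri_def B_product_expand eval_nat_numeral Let_def multilinear
        vec_scale_distribs sum.distrib)
  show "B_tri t (a *s x) y z = a *s B_tri t x y z"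
    by (simp add: B_tri_def B_product_expand eval_nat_numeral Let_def multilinear
        vec_scale_distribs flip: sc) (simp add: ac_simps)
qed

lemma B_tri_expansion:
  "B_tri t x y z = (\<Sum>i\<in>UNIV. \<Sum>j\<in>UNIV. \<Sum>k\<in>UNIV.
     (x $ i * y $ j * z $ k) *s B_tri t (axis i 1) (axis j 1) (axis k 1))"
proof -
  have 1: "B_tri t x y z = (\<Sum>i\<in>UNIV. x $ i *s B_tri t (axis i 1) y z)" for x y z
    by (rule linear_expansion[of "\<lambda>x. B_tri t x y z"]) (auto simp: B_tri_linear)
  have 2: "B_tri t x y z = (\<Sum>i\<in>UNIV. y $ i *s B_tri t x (axis i 1) z)" for x y z
    using 1[of y x z] by (simp add: B_tri_symmetric(1)[of t x])
  have 3: "B_tri t x y z = (\<Sum>i\<in>UNIV. z $ i *s B_tri t x y (axis i 1))" for x y z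
    using 2[of x z y] by (simp add: B_tri_symmetric(2)[of t x y])
  show ?thesis
    by (subst 1, subst 2, subst 3) (simp add: vec_eq_iff sum_distrib_left mult.assoc)
qed

lemma cubic_monomial_of_symmetric:
  "cubic_monomial_of i j k = cubic_monomial_of j i k"
  "cubic_monomial_of i j k = cubic_monomial_of i k j"
  by (simp_all add: cubic_monomial_of_def ac_simps)

lemma cubic_monomial_of_inject:
  assumes "cubic_monomial_of i j k = cubic_monomial_of a b c"
    and "i \<le> j" "j \<le> k" "a \<le> b" "b \<le> c"
  shows "i = a \<and> j = b \<and> k = c"
proof -
  have *: "(if i = x then 1 else 0) + (if j = x then 1 else 0) + (if k = x then 1 else 0 :: nat) =
     (if a = x then 1 else 0) + (if b = x then 1 else 0) + (if c = x then 1 else 0)" for x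
    using arg_cong[OF assms(1), of "\<lambda>m. Poly_Mapping.lookup m x"]
    by (simp add: cubic_monomial_of_def lookup_add lookup_single when_def del: One_nat_def split del: if_split)
  have "mset [i, j, k] = mset [a, b, c]"
  proof (rule multiset_eqI)
    fix x show "count (mset [i, j, k]) x = count (mset [a, b, c]) x"
      using *[of x] by (simp split: if_splits)
  qed
  then have "sort [i, j, k] = sort [a, b, c]"
    by (metis properties_for_sort mset_sort sorted_sort)
  moreover have "sorted [i, j, k]" "sorted [a, b, c]" using assms(2-) by auto
  ultimately show ?thesis by (metis list.inject sorted_sort_id)
qed

lemma B_prime_add: "B_prime (\<phi> + \<psi>) t = B_prime \<phi> t + B_prime \<psi> t"
  by (simp add: B_prime_def lookup_add vec_scale_distribs sum.distrib case_prod_beta)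

lemma B_prime_sum: "B_prime (\<Sum>x\<in>X. h x) t = (\<Sum>x\<in>X. B_prime (h x) t)"
proof (induction X rule: infinite_finite_induct)
  case (insert x F)
  then show ?case by (simp add: B_prime_add)
qed (simp_all add: B_prime_def vec_eq_iff case_prod_beta)

lemma B_prime_single:
  "B_prime (Poly_Mapping.single (cubic_monomial_of a b c) x) t =
   x *s B_tri t (axis a 1) (axis b 1) (axis c 1)"
proof -
  have sorted: "B_prime (Poly_Mapping.single (cubic_monomial_of a b c) x) t =
    x *s B_tri t (axis a 1) (axis b 1) (axis c 1)" if "a \<le> b" "b \<le> c" for a b c :: 5
  proof -
    have "B_prime (Poly_Mapping.single (cubic_monomial_of a b c) x) t =
      (\<Sum>q\<in>{(i, j, k). i \<le> j \<and> j \<le> k}. if q = (a, b, c) then x *s B_tri t (axis a 1) (axis b 1) (axis c 1) else 0)"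
      unfolding B_prime_def
    proof (rule sum.cong[OF refl])
      fix q :: "5 \<times> 5 \<times> 5" assume "q \<in> {(i, j, k). i \<le> j \<and> j \<le> k}"
      then obtain i j k where q: "q = (i, j, k)" "i \<le> j" "j \<le> k" by auto
      show "(case q of (i, j, k) \<Rightarrow> Poly_Mapping.lookup (Poly_Mapping.single (cubic_monomial_of a b c) x)
          (cubic_monomial_of i j k) *s B_product (\<lambda>n. axis ([i, j, k] ! n) 1) t) =
        (if q = (a, b, c) then x *s B_tri t (axis a 1) (axis b 1) (axis c 1) else 0)"
        using cubic_monomial_of_inject[of a b c i j k] that q
        by (auto simp: lookup_single when_def B_product_B_tri eval_nat_numeral vec_eq_iff)
    qed
    also have "\<dots> = x *s B_tri t (axis a 1) (axis b 1) (axis c 1)"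
      using that by (subst sum.delta) (auto intro: finite_subset[OF subset_UNIV])
    finally show ?thesis .
  qed
  note sym = B_tri_symmetric cubic_monomial_of_symmetric
  consider "a \<le> b" "b \<le> c" | "a \<le> c" "c \<le> b" | "b \<le> a" "a \<le> c" | "b \<le> c" "c \<le> a"
    | "c \<le> a" "a \<le> b" | "c \<le> b" "b \<le> a" by fastforce
  then show ?thesis
    by cases (metis sorted sym)+
qed

text \<open>\<open>B'\<close> is given by the defining formula on every product of linear forms.\<close>

theorem B_prime_product:
  "B_prime (linear_form (u 0) * linear_form (u 1) * linear_form (u 2)) t = B_product u t"
proof -
  have "linear_form x * linear_form y * linear_form z = (\<Sum>i\<in>UNIV. \<Sum>j\<in>UNIV. \<Sum>k\<in>UNIV.
     Poly_Mapping.single (cubic_monomial_of i j k) (x $ i * y $ j * z $ k))" for x y z :: "'a::comm_ring_1 ^ 5"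
    unfolding linear_form_def mult.assoc
    unfolding sum_distrib_right
    unfolding sum_distrib_left
    by (simp add: cubic_monomial_of_def mult_single ac_simps)
  then show ?thesis
    by (simp only: B_prime_sum B_prime_single B_product_B_tri B_tri_expansion[of t "u 0"])
qed

lemma ext_vec_nth: "ext_vec u $ S = (if \<exists>i. S = {i} then u $ (THE i. S = {i}) else 0)"
proof (cases "\<exists>i. S = {i}")
  case True
  then obtain i where i: "S = {i}" by blast
  then have "{j. S = {j}} = {i}" by auto
  then show ?thesis using i by (auto simp: ext_vec_def)
next
  case False
  then have "{j. S = {j}} = {}" by auto
  then show ?thesis using False by (auto simp: ext_vec_def)
qed

lemma ext_vec_nth_simps [simp]: "ext_vec u $ {i} = u $ i" "ext_vec u $ {} = 0"
  "i \<noteq> j \<Longrightarrow> ext_vec u $ {i, j} = 0"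
  by (auto simp: ext_vec_nth doubleton_eq_iff)

lemma wedge_ext_vec_nth:
  assumes "i < j"
  shows "(ext_vec a \<and>\<^sub>e ext_vec b) $ {i, j} = a $ i * b $ j - a $ j * b $ i"
proof -
  have P: "Pow {i, j} = {{}, {i}, {j}, {i, j}}" by auto
  have d: "{i, j} - {i} = {j}" "{i, j} - {j} = {i}" using assms by auto
  have "{(x, y). x \<in> {i} \<and> y \<in> {j} \<and> y < x} = {}" "{(x, y). x \<in> {j} \<and> y \<in> {i} \<and> y < x} = {(j, i)}"
    using assms by auto
  then have s: "shuffle_sign {i} {j} = 1" "shuffle_sign {j} {i} = - 1"
    by (simp_all only: shuffle_sign_def) simp_all
  have ne: "{i} \<noteq> {j}" "{i} \<noteq> {i, j}" "{j} \<noteq> {i, j}" using assms by auto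
  show ?thesis
    using assms ne by (simp add: wedge_def P d s)
qed

lemma vol_wedge_expansion:
  "vol (\<omega> \<and>\<^sub>e ext_vec u) = (\<Sum>i\<in>UNIV. u $ i * vol (\<omega> \<and>\<^sub>e ext_vec (axis i 1)))"
proof -
  have "(\<chi> (k::1). vol (\<omega> \<and>\<^sub>e ext_vec u)) =
      (\<Sum>i\<in>UNIV. u $ i *s (\<chi> (k::1). vol (\<omega> \<and>\<^sub>e ext_vec (axis i 1))))"
    by (rule linear_expansion[of "\<lambda>u. \<chi> k. vol (\<omega> \<and>\<^sub>e ext_vec u)"])
      (simp_all add: multilinear vec_eq_iff)
  then show ?thesis by (simp add: vec_eq_iff)
qed

lemma sum_off_diagonal:
  fixes F :: "'i::{finite, linorder} \<Rightarrow> 'i \<Rightarrow> 'b::comm_monoid_add"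
  assumes "\<And>i. F i i = 0"
  shows "(\<Sum>i\<in>UNIV. \<Sum>j\<in>UNIV. F i j) = (\<Sum>(i, j)\<in>{(i, j). i < j}. F i j + F j i)"
proof -
  have "(\<Sum>(i, j)\<in>{(i, j). i < j}. F j i) = (\<Sum>(i, j)\<in>{(i, j). j < i}. F i j)"
    by (rule sum.reindex_bij_witness[of _ prod.swap prod.swap]) auto
  then have "(\<Sum>(i, j)\<in>{(i, j). i < j}. F i j + F j i) =
      (\<Sum>(i, j)\<in>{(i, j). i < j}. F i j) + (\<Sum>(i, j)\<in>{(i, j). j < i}. F i j)"
    by (simp add: case_prod_beta sum.distrib)
  also have "\<dots> = (\<Sum>(i, j)\<in>{(i, j). i < j} \<union> {(i, j). j < i}. F i j)"
    by (rule sum.union_disjoint[symmetric]) (auto intro: finite_subset[OF subset_UNIV])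
  also have "\<dots> = (\<Sum>(i, j)\<in>UNIV. F i j)"
    by (rule sum.mono_neutral_left) (auto, metis assms linorder_neqE)
  finally show ?thesis by (simp add: sum.cartesian_product)
qed

theorem contraction_c_tensor:
  "contraction_c (tensor \<omega> (ext_vec a \<and>\<^sub>e ext_vec b)) =
     vol (\<omega> \<and>\<^sub>e ext_vec a) *s b - vol (\<omega> \<and>\<^sub>e ext_vec b) *s a"
proof -
  define w where "w i = vol (\<omega> \<and>\<^sub>e ext_vec (axis i 1))" for i
  have sc: "(\<Sum>x\<in>X. a *s h x) = a *s sum h X" for a :: "'a::comm_ring_1" and h :: "'z \<Rightarrow> 'a ^ 'k" and X
    by (simp add: vec_eq_iff sum_distrib_left)
  have "contraction_c (tensor \<omega> (ext_vec a \<and>\<^sub>e ext_vec b)) =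
      (\<Sum>(i, j)\<in>{(i, j). i < j}. (ext_vec a \<and>\<^sub>e ext_vec b) $ {i, j} *s (w i *s axis j 1 - w j *s axis i 1))"
    unfolding contraction_c_def w_def
    by (rule tensor_lift_tensor)
      (simp_all add: multilinear vec_scale_distribs sum.distrib case_prod_beta sum_subtractf algebra_simps
        flip: sc)
  also have "\<dots> = (\<Sum>(i, j)\<in>{(i, j). i < j}. (a $ i * b $ j) *s (w i *s axis j 1 - w j *s axis i 1) +
      (a $ j * b $ i) *s (w j *s axis i 1 - w i *s axis j 1))"
    by (rule sum.cong) (auto simp: wedge_ext_vec_nth vec_eq_iff algebra_simps)
  also have "\<dots> = (\<Sum>i\<in>UNIV. \<Sum>j\<in>UNIV. (a $ i * b $ j) *s (w i *s axis j 1 - w j *s axis i 1))"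
    by (rule sum_off_diagonal[symmetric]) simp
  also have "\<dots> = vol (\<omega> \<and>\<^sub>e ext_vec a) *s b - vol (\<omega> \<and>\<^sub>e ext_vec b) *s a"
  proof (rule vec_eq_iff[THEN iffD2], rule allI)
    fix k
    have "(\<Sum>i\<in>UNIV. \<Sum>j\<in>UNIV. (a $ i * b $ j) *s (w i *s axis j 1 - w j *s axis i 1)) $ k =
      (\<Sum>i\<in>UNIV. \<Sum>j\<in>UNIV. (if j = k then a $ i * b $ j * w i else 0)) -
      (\<Sum>i\<in>UNIV. \<Sum>j\<in>UNIV. (if i = k then a $ i * b $ j * w j else 0))"
      unfolding sum_subtractf[symmetric] sum_component
      by (intro sum.cong refl) (auto simp: axis_def algebra_simps)
    also have "(\<Sum>i\<in>UNIV. \<Sum>j\<in>UNIV. (if i = k then a $ i * b $ j * w j else 0)) =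
      (\<Sum>i\<in>UNIV. if i = k then \<Sum>j\<in>UNIV. a $ i * b $ j * w j else 0)"
      by (rule sum.cong) auto
    also have "(\<Sum>i\<in>UNIV. \<Sum>j\<in>UNIV. (if j = k then a $ i * b $ j * w i else 0)) -
      (\<Sum>i\<in>UNIV. if i = k then \<Sum>j\<in>UNIV. a $ i * b $ j * w j else 0) =
      (\<Sum>i\<in>UNIV. a $ i * b $ k * w i) - (\<Sum>j\<in>UNIV. a $ k * b $ j * w j)"
      by simp
    finally show "(\<Sum>i\<in>UNIV. \<Sum>j\<in>UNIV. (a $ i * b $ j) *s (w i *s axis j 1 - w j *s axis i 1)) $ k =
        (vol (\<omega> \<and>\<^sub>e ext_vec a) *s b - vol (\<omega> \<and>\<^sub>e ext_vec b) *s a) $ k"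
      unfolding vol_wedge_expansion[of \<omega> a] vol_wedge_expansion[of \<omega> b]
      by (simp add: w_def sum_distrib_left sum_distrib_right ac_simps)
  qed
  finally show ?thesis .
qed

lemma wedge_d_linear:
  "wedge_d (s + t) = wedge_d s + wedge_d t" "wedge_d (a *s t) = a *s wedge_d t"
  by (simp_all add: wedge_d_def tensor_lift_def vec_eq_iff sum.distrib sum_distrib_left algebra_simps)

lemma wedge_d_tensor: "wedge_d (tensor \<eta> u) = ext_vec u \<and>\<^sub>e \<eta>"
  unfolding wedge_d_def by (rule tensor_lift_tensor) (simp_all add: multilinear)

lemma ext_vec_axis: "ext_vec (axis i 1) = axis {i} 1"
  by (auto simp: vec_eq_iff ext_vec_nth axis_def)

lemma wedge_axis:
  "axis A 1 \<and>\<^sub>e axis B 1 = (if A \<inter> B = {} then shuffle_sign A B *s axis (A \<union> B) 1 else 0)"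
proof (rule vec_eq_iff[THEN iffD2], rule allI)
  fix S
  have "(axis A 1 \<and>\<^sub>e axis B 1) $ S =
      (\<Sum>A'\<in>Pow S. if A' = A then (if S - A = B then shuffle_sign A B else 0) else 0)"
    by (simp only: wedge_def vec_lambda_beta, rule sum.cong) (auto simp: axis_def)
  also have "\<dots> = (if A \<subseteq> S \<and> S - A = B then shuffle_sign A B else 0)"
    by (simp add: sum.delta)
  also have "A \<subseteq> S \<and> S - A = B \<longleftrightarrow> A \<inter> B = {} \<and> S = A \<union> B" by blast
  finally show "(axis A 1 \<and>\<^sub>e axis B 1) $ S =
      (if A \<inter> B = {} then shuffle_sign A B *s axis (A \<union> B) 1 else 0) $ S"
    by (cases "A \<inter> B = {}") (simp_all add: axis_def[of "A \<union> B"])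
qed

lemma shuffle_sign_swap:
  assumes "i \<noteq> j" "i \<notin> C" "j \<notin> C"
  shows "shuffle_sign C {j} * shuffle_sign {i} (insert j C) =
     - (shuffle_sign C {i} * shuffle_sign {j} (insert i C) :: 'a::comm_ring_1)"
proof -
  have r: "card {(a, b). a \<in> C \<and> b \<in> {k} \<and> b < a} = card {c\<in>C. k < c}" for k
    by (rule bij_betw_same_card[of fst]) (auto simp: bij_betw_def inj_on_def image_iff)
  have l: "card {(a, b). a \<in> {k} \<and> b \<in> D \<and> b < a} = card {c\<in>D. c < k}" for k D
    by (rule bij_betw_same_card[of snd]) (auto simp: bij_betw_def inj_on_def image_iff)
  have ins: "card {c\<in>insert k C. c < l} = card {c\<in>C. c < l} + (if k < l then 1 else 0)" if "k \<notin> C" for k l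
  proof -
    have "{c\<in>insert k C. c < l} = (if k < l then insert k {c\<in>C. c < l} else {c\<in>C. c < l})" by auto
    then show ?thesis using that by simp
  qed
  have tot: "card {c\<in>C. k < c} + card {c\<in>C. c < k} = card C" if "k \<notin> C" for k
  proof -
    have "c < k \<or> k < c" if "c \<in> C" for c using that \<open>k \<notin> C\<close> by (metis linorder_neqE)
    then have "{c\<in>C. k < c} \<union> {c\<in>C. c < k} = C" by blast
    moreover have "card ({c\<in>C. k < c} \<union> {c\<in>C. c < k}) = card {c\<in>C. k < c} + card {c\<in>C. c < k}"
      by (rule card_Un_disjoint) auto
    ultimately show ?thesis by simp
  qed
  let ?m = "card {c\<in>C. j < c} + (card {c\<in>C. c < i} + (if j < i then 1 else 0))"
  let ?n = "card {c\<in>C. i < c} + (card {c\<in>C. c < j} + (if i < j then 1 else 0))"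
  have "?m + ?n = 2 * card C + 1"
    using tot[of i] tot[of j] assms by (auto simp: neq_iff)
  then have "odd (?m + ?n)" by simp
  then have "(- 1) ^ ?m = - ((- 1) ^ ?n :: 'a)"
    by (cases "even ?m") auto
  then show ?thesis
    using assms unfolding shuffle_sign_def r l ins[OF assms(2)] ins[OF assms(3)] power_add by simp
qed

lemma wedge_antisymmetric:
  fixes x y :: "'a::comm_ring_1 ^ 5"
  shows "ext_vec y \<and>\<^sub>e (axis C 1 \<and>\<^sub>e ext_vec x) = - (ext_vec x \<and>\<^sub>e (axis C 1 \<and>\<^sub>e ext_vec y))"
proof -
  have basis: "axis {i} (1::'a) \<and>\<^sub>e (axis C 1 \<and>\<^sub>e axis {j} 1) = - (axis {j} 1 \<and>\<^sub>e (axis C 1 \<and>\<^sub>e axis {i} 1))"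
    for i j :: 5
  proof (cases "i = j \<or> i \<in> C \<or> j \<in> C")
    case True
    have "(x :: 'a ^ 5 set) \<and>\<^sub>e 0 = 0" for x by (simp add: wedge_def vec_eq_iff)
    with True show ?thesis by (auto simp: wedge_axis multilinear)
  next
    case False
    then show ?thesis
      using shuffle_sign_swap[of i j C, where 'a = 'a]
      by (simp add: wedge_axis multilinear vec_scale_distribs insert_commute) (simp add: vec_eq_iff)
  qed
  define f where "f y x = ext_vec y \<and>\<^sub>e (axis C 1 \<and>\<^sub>e ext_vec x)" for y x :: "'a ^ 5"
  have lin1: "f y x = (\<Sum>i\<in>UNIV. y $ i *s f (axis i 1) x)" for y x
    by (rule linear_expansion[of "\<lambda>y. f y x"]) (simp_all add: f_def multilinear)
  have lin2: "f y x = (\<Sum>i\<in>UNIV. x $ i *s f y (axis i 1))" for y x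
    by (rule linear_expansion[of "f y"]) (simp_all add: f_def multilinear)
  have b: "f (axis i 1) (axis j 1) = - f (axis j 1) (axis i 1)" for i j
    unfolding f_def ext_vec_axis by (rule basis)
  have "f y x = (\<Sum>i\<in>UNIV. \<Sum>j\<in>UNIV. (y $ i * x $ j) *s f (axis i 1) (axis j 1))"
    by (subst lin1, subst lin2) (simp add: vec_eq_iff sum_distrib_left mult.assoc)
  also have "\<dots> = (\<Sum>i\<in>UNIV. \<Sum>j\<in>UNIV. - ((x $ j * y $ i) *s f (axis j 1) (axis i 1)))"
    by (subst b) (simp add: vec_eq_iff sum_negf mult.commute)
  also have "\<dots> = - (\<Sum>j\<in>UNIV. \<Sum>i\<in>UNIV. (x $ j * y $ i) *s f (axis j 1) (axis i 1))"
    by (subst sum.swap) (simp add: sum_negf)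
  also have "\<dots> = - f x y"
    by (subst lin1[of x], subst lin2[of _ y]) (simp add: vec_eq_iff sum_distrib_left mult.assoc)
  finally show ?thesis by (simp add: f_def)
qed

lemma wedge_axis_ext_vec_support:
  fixes x :: "'a::comm_ring_1 ^ 5"
  assumes "(axis C 1 \<and>\<^sub>e ext_vec x) $ D \<noteq> 0"
  shows "card D = card C + 1"
proof -
  have "\<exists>A\<in>Pow D. shuffle_sign A (D - A) * axis C 1 $ A * ext_vec x $ (D - A) \<noteq> 0"
    using assms unfolding wedge_def vec_lambda_beta by (meson sum.neutral)
  then obtain A where A: "A \<subseteq> D" "axis C (1::'a) $ A \<noteq> 0" "ext_vec x $ (D - A) \<noteq> 0"
    by (metis Pow_iff mult_zero_left mult_zero_right)
  have "A = C" using A(2) by (auto simp: axis_def split: if_splits)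
  moreover obtain i where i: "D - A = {i}" using A(3) by (auto simp: ext_vec_nth split: if_splits)
  moreover have "D = insert i A" "i \<notin> A" using A(1) i by auto
  ultimately show ?thesis by simp
qed

theorem B_prime_in_Gamma_211:
  fixes t :: "'a::comm_ring_1 ^ (5 set \<times> 5 set)"
  assumes "\<And>A C. t $ (A, C) \<noteq> 0 \<Longrightarrow> card A = 4 \<and> card C = 2"
  shows "B_prime \<phi> t \<in> Gamma_211"
proof -
  have zero: "0 \<in> Gamma_211"
    using wedge_d_linear(2)[of 0 0] by (simp add: Gamma_211_def)
  have add: "x + y \<in> Gamma_211" if "x \<in> Gamma_211" "y \<in> Gamma_211" for x y
    using that by (auto simp: Gamma_211_def wedge_d_linear) (metis add.right_neutral)
  have sc: "a *s x \<in> Gamma_211" if "x \<in> Gamma_211" for a x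
    using that by (auto simp: Gamma_211_def wedge_d_linear) (metis mult_zero_right)
  have sum: "sum h X \<in> Gamma_211" if "\<And>x. x \<in> X \<Longrightarrow> h x \<in> Gamma_211" for h :: "'z \<Rightarrow> _" and X
    using that by (induction X rule: infinite_finite_induct) (auto simp: zero add)
  have pair: "tensor (axis C 1 \<and>\<^sub>e ext_vec x) y + tensor (axis C 1 \<and>\<^sub>e ext_vec y) x \<in> Gamma_211"
    if "card C = 2" for C x y
  proof -
    have "card D = 3" if "tensor (axis C 1 \<and>\<^sub>e ext_vec x) y $ (D, i) \<noteq> 0" for x y D i
      using that wedge_axis_ext_vec_support[of C x D] \<open>card C = 2\<close>
      by (cases "(axis C 1 \<and>\<^sub>e ext_vec x) $ D = 0") (simp_all add: tensor_def)
    then have "card D = 3" if "(tensor (axis C 1 \<and>\<^sub>e ext_vec x) y + tensor (axis C 1 \<and>\<^sub>e ext_vec y) x) $ (D, i) \<noteq> 0"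
      for D i using that by (metis add.right_neutral vector_add_component)
    then show ?thesis
      using wedge_antisymmetric[of y C x]
      by (auto simp: Gamma_211_def wedge_d_linear wedge_d_tensor)
  qed
  have "B_product u t \<in> Gamma_211" for u
    unfolding B_product_expand
  proof (rule sum)
    fix p :: "5 set \<times> 5 set"
    define v where "v x = vol (axis (fst p) 1 \<and>\<^sub>e ext_vec x)" for x :: "'a ^ 5"
    define T where "T x y = tensor (axis (snd p) 1 \<and>\<^sub>e ext_vec x) y" for x y :: "'a ^ 5"
    have "t $ p *s (v (u 0) *s (T (u 1) (u 2) + T (u 2) (u 1)) + v (u 1) *s (T (u 0) (u 2) + T (u 2) (u 0))
        + v (u 2) *s (T (u 1) (u 0) + T (u 0) (u 1))) \<in> Gamma_211"
    proof (cases "t $ p = 0")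
      case True
      then show ?thesis using zero by simp
    next
      case False
      then have "card (snd p) = 2" using assms[of "fst p" "snd p"] by simp
      then show ?thesis unfolding T_def by (intro sc add pair)
    qed
    then show "t $ p *s (let G = (\<lambda>x y z. vol (axis (fst p) 1 \<and>\<^sub>e ext_vec x) *s tensor (axis (snd p) 1 \<and>\<^sub>e ext_vec y) z)
     in G (u 0) (u 1) (u 2) + G (u 1) (u 0) (u 2) + G (u 2) (u 1) (u 0) + G (u 0) (u 2) (u 1)
        + G (u 1) (u 2) (u 0) + G (u 2) (u 0) (u 1)) \<in> Gamma_211"
      by (simp add: Let_def v_def T_def vec_scale_distribs ac_simps)
  qed
  then show ?thesis unfolding B_prime_def by (auto intro!: sum sc)
qed

end

theory Submission
  imports Defs
begin

text \<open>
  Write \<open>B\<^sub>\<phi>\<close> for the contraction operator, \<open>D(\<phi>) = det B\<^sub>\<phi>\<close>, a form of degree \<open>45\<close> in the \<open>35\<close>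
  coefficients of \<open>\<phi>\<close>, and \<open>I\<close> for the ideal of all polynomials that vanish on the sums of seven cubes.
  The proof finds a generator of \<open>I\<close> and compares it with \<open>D\<close>.
  \<open>I\<close> is prime, because the sums of seven cubes are the image of an affine space. At one explicit
  choice of seven points the tangent vectors \<open>g\<^sub>k\<^sup>2 w\<^sub>k\<close> together with the monomial \<open>x\<^sub>0x\<^sub>1x\<^sub>2\<close> span all cubics
  (\<open>tangent_space_cubics\<close>), so that no nonzero element of \<open>I\<close> is free of the coordinate
  belonging to \<open>x\<^sub>0x\<^sub>1x\<^sub>2\<close> (\<open>secant_elimination\<close>). Since polynomial rings are factorial, an irreducible
  \<open>P \<in> I\<close> and an element of \<open>I\<close> that \<open>P\<close> does not divide would have a nonzero combination free of
  that coordinate. Hence every irreducible element of \<open>I\<close> generates \<open>I\<close> (\<open>secant_ideal_generator\<close>).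
  For a cube \<open>v\<^sup>3\<close> the operator \<open>B\<close> has rank at most \<open>6\<close>, hence at a sum of seven cubes its rank is at most
  \<open>42 = 45 - 3\<close>, and \<open>D\<close> vanishes there to order at least \<open>3\<close> (\<open>B_det_order\<close>). In particular \<open>D \<in> I\<close>,
  and an irreducible factor \<open>P\<close> of \<open>D\<close> lies in \<open>I\<close>. As \<open>P\<close> generates \<open>I\<close>, its partial
  derivative in the direction of \<open>x\<^sub>0x\<^sub>1x\<^sub>2\<close> is not in \<open>I\<close>; so \<open>P\<close> has a simple zero along some line through
  a sum of seven cubes, and \<open>P\<^sup>3\<close> divides \<open>D\<close> (\<open>multiplicity_at_least\<close>). Therefore \<open>deg P \<le> 15\<close>,
  once \<open>D\<close> is known to be nonzero.
  Both \<open>D \<noteq> 0\<close> and the opposite bound come from the cubic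
  \<open>\<phi>\<^sub>0 = x\<^sub>4\<^sup>3 + x\<^sub>3\<^sup>3 + x\<^sub>1x\<^sub>2x\<^sub>4 + x\<^sub>0x\<^sub>2x\<^sub>3 + x\<^sub>0x\<^sub>1\<^sup>2\<close>. The operator at \<open>\<phi>\<^sub>0\<close> is injective
  (\<open>B_prime_test_cubic_injective\<close>), so \<open>D(\<phi>\<^sub>0) \<noteq> 0\<close> and \<open>P(\<phi>\<^sub>0) \<noteq> 0\<close>. The ideal \<open>I\<close> is stable under scaling
  and permuting the variables \<open>x\<^sub>i\<close>, so \<open>P\<close> is a semi-invariant, and each of its monomials involves
  all five variables to the same total exponent (\<open>generator_weights\<close>). Some monomial of \<open>P\<close> contains only
  the five coordinates that are nonzero at \<open>\<phi>\<^sub>0\<close>, and five linear equations show that such a balanced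
  monomial has degree at least \<open>15\<close> (\<open>test_monomial_degree\<close>). Thus \<open>deg P = 15\<close> and \<open>D = c P\<^sup>3\<close> with a
  constant \<open>c \<noteq> 0\<close>, which a cube root of \<open>c / 2\<close> turns into \<open>2\<close> (\<open>secant_equation\<close>).
\<close>

section \<open>Unique factorization\<close>

text \<open>
  Rings of polynomials in a finite set of variables are subrings of one fixed ring of polynomials, and
  variables are adjoined one at a time. Factoriality is therefore a property of a subset \<open>U\<close> of a
  domain, with units and divisibility taken inside \<open>U\<close>. The additive size \<open>N\<close>, which vanishes only
  at \<open>0\<close> and at units, makes repeated splitting into factors stop.
\<close>

locale factorial_subring =
  fixes U :: "'r::idom set" and N :: "'r \<Rightarrow> nat"
  assumes one_in: "1 \<in> U"
    and diff_in: "a \<in> U \<Longrightarrow> b \<in> U \<Longrightarrow> a - b \<in> U"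
    and mult_in: "a \<in> U \<Longrightarrow> b \<in> U \<Longrightarrow> a * b \<in> U"
    and N_mult: "a \<in> U \<Longrightarrow> b \<in> U \<Longrightarrow> a \<noteq> 0 \<Longrightarrow> b \<noteq> 0 \<Longrightarrow> N (a * b) = N a + N b"
    and N_eq_0: "a \<in> U \<Longrightarrow> a \<noteq> 0 \<Longrightarrow> N a = 0 \<Longrightarrow> \<exists>b\<in>U. a * b = 1"
    and irreducible_prime:
      "\<lbrakk>p \<in> U; p \<noteq> 0; \<not> (\<exists>c\<in>U. p * c = 1);
        \<And>a b. a \<in> U \<Longrightarrow> b \<in> U \<Longrightarrow> p = a * b \<Longrightarrow> (\<exists>c\<in>U. a * c = 1) \<or> (\<exists>c\<in>U. b * c = 1);
        a \<in> U; b \<in> U; c \<in> U; a * b = p * c\<rbrakk>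
       \<Longrightarrow> (\<exists>d\<in>U. a = p * d) \<or> (\<exists>d\<in>U. b = p * d)"
begin

definition unit :: "'r \<Rightarrow> bool" where
  "unit a \<longleftrightarrow> (\<exists>c\<in>U. a * c = 1)"

definition irred :: "'r \<Rightarrow> bool" where
  "irred p \<longleftrightarrow> p \<in> U \<and> p \<noteq> 0 \<and> \<not> unit p \<and> (\<forall>a\<in>U. \<forall>b\<in>U. p = a * b \<longrightarrow> unit a \<or> unit b)"

definition divs :: "'r \<Rightarrow> 'r \<Rightarrow> bool" where
  "divs p a \<longleftrightarrow> (\<exists>c\<in>U. a = p * c)"

lemma zero_in: "0 \<in> U"
  using diff_in[OF one_in one_in] by simp

lemma uminus_in: "a \<in> U \<Longrightarrow> - a \<in> U"
  using diff_in[OF zero_in] by simp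

lemma add_in: "a \<in> U \<Longrightarrow> b \<in> U \<Longrightarrow> a + b \<in> U"
  using diff_in[of a "- b"] uminus_in by simp

lemma sum_in: "(\<And>x. x \<in> X \<Longrightarrow> f x \<in> U) \<Longrightarrow> sum f X \<in> U"
  by (induction X rule: infinite_finite_induct) (auto simp: zero_in add_in)

lemma irred_prime:
  "irred p \<Longrightarrow> a \<in> U \<Longrightarrow> b \<in> U \<Longrightarrow> divs p (a * b) \<Longrightarrow> divs p a \<or> divs p b"
  unfolding irred_def divs_def unit_def using irreducible_prime[of p a b] by blast

lemma divs_diff: "divs p a \<Longrightarrow> divs p b \<Longrightarrow> divs p (a - b)"
  unfolding divs_def by (metis diff_in right_diff_distrib)

lemma divs_0: "divs p 0"
  unfolding divs_def using zero_in by force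

lemma divs_sum: "(\<And>x. x \<in> X \<Longrightarrow> divs p (f x)) \<Longrightarrow> divs p (sum f X)"
proof (induction X rule: infinite_finite_induct)
  case (insert x F)
  then have "divs p (f x)" "divs p (sum f F)" by auto
  then show ?case using insert.hyps unfolding divs_def
    by (metis add_in distrib_left sum.insert)
qed (auto simp: divs_0)

lemma divs_mult: "divs p a \<Longrightarrow> b \<in> U \<Longrightarrow> divs p (a * b)" "divs p a \<Longrightarrow> b \<in> U \<Longrightarrow> divs p (b * a)"
  unfolding divs_def by (metis mult.assoc mult_in, metis mult.left_commute mult_in)

lemma N_nonunit: "a \<in> U \<Longrightarrow> a \<noteq> 0 \<Longrightarrow> \<not> unit a \<Longrightarrow> N a > 0"
  using N_eq_0 unfolding unit_def by blast

lemma ex_irred_divisor: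
  assumes "a \<in> U" "a \<noteq> 0" "\<not> unit a"
  obtains p c where "irred p" "c \<in> U" "a = p * c"
proof -
  have "\<exists>p c. irred p \<and> c \<in> U \<and> a = p * c"
    using assms
  proof (induction "N a" arbitrary: a rule: less_induct)
    case less
    show ?case
    proof (cases "irred a")
      case True
      then show ?thesis using one_in by (intro exI[of _ a] exI[of _ 1]) simp
    next
      case False
      then obtain b c where bc: "b \<in> U" "c \<in> U" "a = b * c" "\<not> unit b" "\<not> unit c"
        using less.prems unfolding irred_def by blast
      then have "b \<noteq> 0" "c \<noteq> 0" using less.prems by auto
      then have "N b < N a"
        using N_mult[of b c] N_nonunit[of c] bc by simp
      then obtain p d where "irred p" "d \<in> U" "b = p * d"
        using less.hyps[of b] bc \<open>b \<noteq> 0\<close> by blast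
      then show ?thesis using bc by (metis mult.assoc mult_in)
    qed
  qed
  then show thesis using that by blast
qed

definition polys :: "'r poly set" where
  "polys = {f. \<forall>i. coeff f i \<in> U}"

definition primitive :: "'r poly \<Rightarrow> bool" where
  "primitive f \<longleftrightarrow> (\<forall>p. irred p \<longrightarrow> \<not> (\<forall>i. divs p (coeff f i)))"

lemma polys_coeff: "f \<in> polys \<Longrightarrow> coeff f i \<in> U"
  by (simp add: polys_def)

lemma polys_diff: "f \<in> polys \<Longrightarrow> g \<in> polys \<Longrightarrow> f - g \<in> polys"
  by (simp add: polys_def diff_in)

lemma polys_add: "f \<in> polys \<Longrightarrow> g \<in> polys \<Longrightarrow> f + g \<in> polys"
  by (simp add: polys_def add_in)

lemma polys_mult: "f \<in> polys \<Longrightarrow> g \<in> polys \<Longrightarrow> f * g \<in> polys"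
  by (auto simp: polys_def coeff_mult intro!: sum_in mult_in)

lemma polys_smult: "c \<in> U \<Longrightarrow> f \<in> polys \<Longrightarrow> smult c f \<in> polys"
  by (simp add: polys_def mult_in)

lemma polys_monom: "c \<in> U \<Longrightarrow> monom c n \<in> polys"
  by (simp add: polys_def zero_in)

lemma polys_const: "[:c:] \<in> polys \<longleftrightarrow> c \<in> U"
  by (auto simp: polys_def coeff_pCons zero_in split: nat.splits)

lemma polys_0: "0 \<in> polys" and polys_1: "1 \<in> polys"
  by (auto simp: polys_def zero_in one_in)

text \<open>
  Gauss's lemma. If \<open>i\<close> and \<open>j\<close> are the first indices at which \<open>p\<close> fails to divide \<open>f\<close> and \<open>g\<close>, then
  modulo \<open>p\<close> the coefficient of \<open>f * g\<close> at \<open>i + j\<close> is the product of these two coefficients.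
\<close>

lemma gauss:
  assumes p: "irred p" and fg: "f \<in> polys" "g \<in> polys"
    and d: "\<And>i. divs p (coeff (f * g) i)"
  shows "(\<forall>i. divs p (coeff f i)) \<or> (\<forall>i. divs p (coeff g i))"
proof (rule ccontr)
  assume "\<not> ?thesis"
  then have ex: "\<exists>i. \<not> divs p (coeff f i)" "\<exists>j. \<not> divs p (coeff g j)" by auto
  define i where "i = (LEAST i. \<not> divs p (coeff f i))"
  define j where "j = (LEAST j. \<not> divs p (coeff g j))"
  have i: "\<not> divs p (coeff f i)" "\<And>k. k < i \<Longrightarrow> divs p (coeff f k)"
    using LeastI_ex[OF ex(1)] not_less_Least unfolding i_def by blast+
  have j: "\<not> divs p (coeff g j)" "\<And>k. k < j \<Longrightarrow> divs p (coeff g k)"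
    using LeastI_ex[OF ex(2)] not_less_Least unfolding j_def by blast+
  let ?h = "\<lambda>k. coeff f k * coeff g (i + j - k)"
  have "coeff (f * g) (i + j) = ?h i + (\<Sum>k\<in>{..i + j} - {i}. ?h k)"
    by (simp add: coeff_mult sum.remove[of _ i])
  moreover have "divs p (\<Sum>k\<in>{..i + j} - {i}. ?h k)"
  proof (rule divs_sum)
    fix k assume k: "k \<in> {..i + j} - {i}"
    show "divs p (?h k)"
    proof (cases "k < i")
      case True
      then show ?thesis using i(2) divs_mult(1) polys_coeff fg by blast
    next
      case False
      then have "i + j - k < j" using k by auto
      then show ?thesis using j(2) divs_mult(2) polys_coeff fg by blast
    qed
  qed
  ultimately have "divs p (?h i)"
    using divs_diff[OF d[of "i + j"], of "\<Sum>k\<in>{..i + j} - {i}. ?h k"] by simp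
  then have "divs p (coeff f i * coeff g j)" by simp
  then show False using irred_prime[OF p] polys_coeff fg i(1) j(1) by blast
qed

lemma coeffs_divisible:
  assumes "\<And>i. divs p (coeff f i)"
  obtains h where "h \<in> polys" "f = smult p h"
proof -
  from assms obtain c where c: "\<And>i. c i \<in> U" "\<And>i. coeff f i = p * c i"
    unfolding divs_def by metis
  define h where "h = (\<Sum>i\<le>degree f. monom (c i) i)"
  have "coeff h n = (if n \<le> degree f then c n else 0)" for n
    by (simp add: h_def coeff_sum)
  then have "h \<in> polys" "f = smult p h"
    by (auto simp: polys_def c zero_in poly_eq_iff coeff_eq_0 simp flip: c(2))
  then show thesis using that by blast
qed

text \<open>
  The irreducible factors of \<open>c\<close> can be cancelled one after another: none of them divides \<open>f\<close>, so by
  Gauss's lemma each divides \<open>q\<close>.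
\<close>

lemma primitive_cancel:
  assumes "c \<in> U" "c \<noteq> 0" "f \<in> polys" "primitive f" "g \<in> polys" "q \<in> polys" "smult c g = f * q"
  shows "\<exists>h\<in>polys. g = f * h"
  using assms
proof (induction "N c" arbitrary: c q rule: less_induct)
  case less
  show ?case
  proof (cases "unit c")
    case True
    then obtain d where d: "d \<in> U" "c * d = 1" by (auto simp: unit_def)
    have "g = smult (c * d) g" using d by simp
    also have "\<dots> = smult d (smult c g)" by (simp add: mult.commute)
    also have "\<dots> = f * smult d q" using less.prems by simp
    finally show ?thesis using d less.prems polys_smult by blast
  next
    case False
    then obtain p c' where p: "irred p" "c' \<in> U" "c = p * c'"
      using ex_irred_divisor less.prems by metis
    have "divs p (coeff (f * q) i)" for i
    proof -
      have "coeff (f * q) i = p * (c' * coeff g i)"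
        using less.prems(7) p(3) by (metis coeff_smult mult.assoc)
      then show ?thesis unfolding divs_def
        using p(2) mult_in polys_coeff less.prems by blast
    qed
    then have "\<forall>i. divs p (coeff q i)"
      using gauss[OF p(1)] less.prems p(1) unfolding primitive_def by blast
    then obtain q' where q': "q' \<in> polys" "q = smult p q'"
      using coeffs_divisible by blast
    have p0: "p \<noteq> 0" "p \<in> U" "\<not> unit p" and c'0: "c' \<noteq> 0"
      using p less.prems by (auto simp: irred_def)
    have "smult p (smult c' g) = smult p (f * q')"
      using less.prems(7) q'(2) p(3) by simp
    then have eq: "smult c' g = f * q'" using p0 by (metis smult_cancel)
    have "N c' < N c" using N_mult[of p c'] p p0 c'0 N_nonunit[of p] by simp
    then show ?thesis using less.hyps[of c' q'] p c'0 less.prems q' eq by blast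
  qed
qed

lemma primitive_part:
  assumes "r \<in> polys" "r \<noteq> 0"
  obtains c s where "c \<in> U" "c \<noteq> 0" "s \<in> polys" "primitive s" "r = smult c s"
proof -
  have "\<exists>c s. c \<in> U \<and> c \<noteq> 0 \<and> s \<in> polys \<and> primitive s \<and> r = smult c s"
    using assms
  proof (induction "N (lead_coeff r)" arbitrary: r rule: less_induct)
    case less
    show ?case
    proof (cases "primitive r")
      case True
      then show ?thesis using less.prems one_in by (intro exI[of _ 1] exI[of _ r]) simp
    next
      case False
      then obtain p where p: "irred p" "\<forall>i. divs p (coeff r i)" by (auto simp: primitive_def)
      then obtain h where h: "h \<in> polys" "r = smult p h" using coeffs_divisible by blast
      have p0: "p \<noteq> 0" "p \<in> U" "\<not> unit p" using p by (auto simp: irred_def)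
      have h0: "h \<noteq> 0" using h less.prems by auto
      have "lead_coeff r = p * lead_coeff h" using h p0 by simp
      then have "N (lead_coeff h) < N (lead_coeff r)"
        using N_mult[of p "lead_coeff h"] p0 h0 N_nonunit[of p] polys_coeff h(1) by simp
      then obtain c s where "c \<in> U" "c \<noteq> 0" "s \<in> polys" "primitive s" "h = smult c s"
        using less.hyps[OF _ h(1) h0] by blast
      then show ?thesis using h p0 mult_in
        by (intro exI[of _ "p * c"] exI[of _ s]) simp
    qed
  qed
  then show thesis using that by blast
qed

lemma pseudo_division:
  assumes "f \<in> polys" "g \<in> polys" "g \<noteq> 0"
  shows "\<exists>c q s. c \<in> U \<and> c \<noteq> 0 \<and> q \<in> polys \<and> s \<in> polys \<and> smult c f = g * q + s \<and>
    (s = 0 \<or> degree s < degree g)"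
  using assms(1)
proof (induction "degree f" arbitrary: f rule: less_induct)
  case less
  let ?b = "lead_coeff g"
  show ?case
  proof (cases "f = 0 \<or> degree f < degree g")
    case True
    then show ?thesis using less.prems one_in polys_0
      by (intro exI[of _ 1] exI[of _ 0] exI[of _ f]) auto
  next
    case False
    define m where "m = monom (lead_coeff f) (degree f - degree g)"
    define f' where "f' = smult ?b f - g * m"
    have b: "?b \<in> U" "?b \<noteq> 0" using assms polys_coeff by auto
    have m: "m \<in> polys" using polys_monom polys_coeff less.prems by (simp add: m_def)
    have f': "f' \<in> polys" unfolding f'_def
      by (intro polys_diff polys_smult polys_mult m b less.prems assms)
    have dm: "degree m = degree f - degree g" "m \<noteq> 0"
      using False by (simp_all add: m_def degree_monom_eq)
    have deg: "degree (g * m) = degree f"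
      using False dm(2) assms by (subst degree_mult_eq) (auto simp: dm(1))
    have lc: "lead_coeff (g * m) = ?b * lead_coeff f"
      using False by (subst lead_coeff_mult) (simp add: m_def degree_monom_eq)
    have less_deg: "f' = 0 \<or> degree f' < degree f"
    proof (rule ccontr)
      assume a: "\<not> ?thesis"
      have "degree f' \<le> degree f" unfolding f'_def
        using deg b by (intro degree_diff_le) auto
      then have "degree f' = degree f" using a by simp
      moreover have "coeff f' (degree f) = 0" using lc deg by (simp add: f'_def)
      ultimately show False using a by (metis leading_coeff_0_iff)
    qed
    show ?thesis
    proof (cases "f' = 0")
      case True
      then show ?thesis using b m polys_0
        by (intro exI[of _ ?b] exI[of _ m] exI[of _ 0]) (auto simp: f'_def)
    next
      case False
      then obtain c q s where *: "c \<in> U" "c \<noteq> 0" "q \<in> polys" "s \<in> polys"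
        "smult c f' = g * q + s" "s = 0 \<or> degree s < degree g"
        using less.hyps[of f'] less_deg f' by blast
      have "smult (c * ?b) f = g * (smult c m + q) + s"
        using *(5) by (simp add: f'_def smult_diff_right algebra_simps)
      then show ?thesis using * b m mult_in polys_add polys_smult
        by (intro exI[of _ "c * ?b"] exI[of _ "smult c m + q"] exI[of _ s]) auto
    qed
  qed
qed

definition poly_unit :: "'r poly \<Rightarrow> bool" where
  "poly_unit f \<longleftrightarrow> (\<exists>h\<in>polys. f * h = 1)"

definition poly_irred :: "'r poly \<Rightarrow> bool" where
  "poly_irred f \<longleftrightarrow> f \<in> polys \<and> f \<noteq> 0 \<and> \<not> poly_unit f \<and>
    (\<forall>a\<in>polys. \<forall>b\<in>polys. f = a * b \<longrightarrow> poly_unit a \<or> poly_unit b)"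

lemma poly_unit_degree: "poly_unit f \<Longrightarrow> degree f = 0"
  unfolding poly_unit_def
  by (metis add_is_0 degree_1 degree_mult_eq mult_zero_left mult_zero_right zero_neq_one)

lemma poly_unit_const: "poly_unit [:a:] \<Longrightarrow> unit a"
proof -
  assume "poly_unit [:a:]"
  then obtain h where h: "h \<in> polys" "[:a:] * h = 1" by (auto simp: poly_unit_def)
  then have "coeff ([:a:] * h) 0 = 1" by simp
  then have "a * coeff h 0 = 1" by (simp add: coeff_mult)
  then show ?thesis unfolding unit_def using h polys_coeff by blast
qed

lemma unit_poly_unit: "unit a \<Longrightarrow> poly_unit [:a:]"
  unfolding unit_def poly_unit_def
  by (metis mult_pCons_left mult_zero_left add.right_neutral pCons_0_0 polys_const smult_pCons smult_0_right one_pCons)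

lemma poly_irred_primitive:
  assumes "poly_irred f" "degree f > 0"
  shows "primitive f"
  unfolding primitive_def
proof (intro allI impI notI)
  fix p assume p: "irred p" "\<forall>i. divs p (coeff f i)"
  then obtain h where h: "h \<in> polys" "f = smult p h" using coeffs_divisible by blast
  then have "f = [:p:] * h" by simp
  moreover have "[:p:] \<in> polys" using p by (simp add: irred_def polys_const)
  ultimately have "poly_unit [:p:] \<or> poly_unit h"
    using assms(1) h(1) unfolding poly_irred_def by blast
  moreover have "\<not> poly_unit [:p:]" using p poly_unit_const by (auto simp: irred_def)
  moreover have "degree h = degree f" using h p by (auto simp: irred_def)
  ultimately show False using poly_unit_degree[of h] assms(2) by simp
qed

text \<open>
  A nonzero element \<open>r\<close> of least degree in the ideal of \<open>f\<close> and \<open>g\<close> divides both up to constants, hence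
  its primitive part divides both. That primitive part is a unit, because otherwise it would be
  associated to the irreducible \<open>f\<close>, which would then divide \<open>g\<close>. So \<open>r\<close> has degree \<open>0\<close>.
\<close>

theorem elimination:
  assumes f: "poly_irred f" "degree f > 0" and g: "g \<in> polys" "\<not> (\<exists>h\<in>polys. g = f * h)"
  obtains u v r where "u \<in> polys" "v \<in> polys" "r \<in> U" "r \<noteq> 0" "u * f + v * g = [:r:]"
proof -
  define J where "J = {u * f + v * g |u v. u \<in> polys \<and> v \<in> polys}"
  have fp: "f \<in> polys" "f \<noteq> 0" using f by (auto simp: poly_irred_def)
  have J1: "f \<in> J" unfolding J_def
    by (rule CollectI, rule exI[of _ 1], rule exI[of _ 0]) (simp add: polys_0 polys_1)
  have J2: "g \<in> J" unfolding J_def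
    by (rule CollectI, rule exI[of _ 0], rule exI[of _ 1]) (simp add: polys_0 polys_1)
  have Jp: "x \<in> polys" if "x \<in> J" for x
    using that fp g by (auto simp: J_def intro!: polys_add polys_mult)
  have Jlin: "smult c x - y * q \<in> J" if xy: "x \<in> J" "y \<in> J" and "c \<in> U" "q \<in> polys" for c x y q
  proof -
    obtain u v u' v' where uv: "x = u * f + v * g" "y = u' * f + v' * g"
      "u \<in> polys" "v \<in> polys" "u' \<in> polys" "v' \<in> polys"
      using xy unfolding J_def by blast
    have "smult c x - y * q = (smult c u - u' * q) * f + (smult c v - v' * q) * g"
      by (simp add: uv algebra_simps smult_add_right)
    moreover have "smult c u - u' * q \<in> polys" "smult c v - v' * q \<in> polys"
      using uv that by (auto intro!: polys_diff polys_smult polys_mult)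
    ultimately show ?thesis unfolding J_def by blast
  qed
  define r where "r = (ARG_MIN degree x. x \<in> J \<and> x \<noteq> 0)"
  have r: "r \<in> J" "r \<noteq> 0" "\<And>x. x \<in> J \<Longrightarrow> x \<noteq> 0 \<Longrightarrow> degree r \<le> degree x"
    unfolding r_def using arg_min_natI[of "\<lambda>x. x \<in> J \<and> x \<noteq> 0" f degree]
      arg_min_nat_le[of "\<lambda>x. x \<in> J \<and> x \<noteq> 0" _ degree] J1 fp by auto
  have div: "\<exists>c q. c \<in> U \<and> c \<noteq> 0 \<and> q \<in> polys \<and> smult c x = r * q" if x: "x \<in> J" for x
  proof -
    obtain c q s where *: "c \<in> U" "c \<noteq> 0" "q \<in> polys" "smult c x = r * q + s" "s = 0 \<or> degree s < degree r"
      using pseudo_division[OF Jp[OF x] Jp[OF r(1)] r(2)] by blast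
    have "s = smult c x - r * q" using *(4) by simp
    then have "s \<in> J" using Jlin[OF x r(1) *(1,3)] by simp
    then have "s = 0" using r(3)[of s] *(5) by force
    then show ?thesis using * by auto
  qed
  obtain d r' where r': "d \<in> U" "d \<noteq> 0" "r' \<in> polys" "primitive r'" "r = smult d r'"
    using primitive_part[OF Jp[OF r(1)] r(2)] by blast
  have dvd: "\<exists>h\<in>polys. x = r' * h" if x: "x \<in> J" for x
  proof -
    obtain c q where *: "c \<in> U" "c \<noteq> 0" "q \<in> polys" "smult c x = r * q" using div[OF x] by blast
    then have "smult c x = r' * smult d q" by (simp add: r')
    then show ?thesis using primitive_cancel[OF *(1,2) r'(3,4) Jp[OF x]] polys_smult r' * by blast
  qed
  obtain h where h: "h \<in> polys" "f = r' * h" using dvd[OF J1] by blast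
  then have "poly_unit r' \<or> poly_unit h" using f(1) r' by (auto simp: poly_irred_def)
  then have "poly_unit r'"
  proof
    assume "poly_unit h"
    then obtain k where k: "k \<in> polys" "h * k = 1" by (auto simp: poly_unit_def)
    obtain l where l: "l \<in> polys" "g = r' * l" using dvd[OF J2] by blast
    have "r' = f * k" using h k by (simp add: mult.assoc)
    then have "g = f * (k * l)" using l by (simp add: mult.assoc)
    then show ?thesis using g(2) k l polys_mult by blast
  qed
  then have "degree r = 0" using r' poly_unit_degree[of r'] by simp
  then obtain r0 where r0: "r = [:r0:]" by (metis degree_eq_zeroE)
  moreover have "r0 \<in> U" "r0 \<noteq> 0" using Jp[OF r(1)] r(2) r0 by (auto simp: polys_const)
  ultimately show thesis using that r(1) unfolding J_def by auto
qed

text \<open>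
  For an irreducible constant this is Gauss's lemma. An irreducible \<open>f\<close> of positive degree that does not
  divide \<open>a\<close> yields \<open>u * f + v * a = r\<close> with a nonzero constant \<open>r\<close>. If \<open>f\<close> divides \<open>a * b\<close>, it divides
  \<open>r * b\<close>, and then \<open>b\<close> because it is primitive.
\<close>

theorem factorial_polys: "factorial_subring polys (\<lambda>f. degree f + N (lead_coeff f))"
proof
  fix f assume f: "f \<in> polys" "f \<noteq> 0" "degree f + N (lead_coeff f) = 0"
  then have c: "f = [:lead_coeff f:]" by (metis add_is_0 degree_eq_zeroE lead_coeff_pCons(2))
  then have "unit (lead_coeff f)"
    using N_nonunit[of "lead_coeff f"] f polys_coeff by auto
  then show "\<exists>h\<in>polys. f * h = 1" using unit_poly_unit[of "lead_coeff f"] c by (simp add: poly_unit_def)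
next
  fix f a b c
  assume f: "f \<in> polys" "f \<noteq> 0" "\<not> (\<exists>c\<in>polys. f * c = 1)"
    "\<And>a b. a \<in> polys \<Longrightarrow> b \<in> polys \<Longrightarrow> f = a * b \<Longrightarrow> (\<exists>c\<in>polys. a * c = 1) \<or> (\<exists>c\<in>polys. b * c = 1)"
    and abc: "a \<in> polys" "b \<in> polys" "c \<in> polys" "a * b = f * c"
  have irr: "poly_irred f" unfolding poly_irred_def poly_unit_def using f by blast
  show "(\<exists>d\<in>polys. a = f * d) \<or> (\<exists>d\<in>polys. b = f * d)"
  proof (cases "degree f = 0")
    case True
    then obtain p where p: "f = [:p:]" by (metis degree_eq_zeroE)
    have "irred p"
      unfolding irred_def
    proof (intro conjI ballI impI)
      show "p \<in> U" "p \<noteq> 0" "\<not> unit p"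
        using f p unit_poly_unit[of p] by (auto simp: polys_const poly_unit_def)
      fix x y assume xy: "x \<in> U" "y \<in> U" "p = x * y"
      then have "f = [:x:] * [:y:]" by (simp add: p)
      then have "poly_unit [:x:] \<or> poly_unit [:y:]"
        using irr xy unfolding poly_irred_def by (metis polys_const)
      then show "unit x \<or> unit y" using poly_unit_const by blast
    qed
    moreover have "divs p (coeff (a * b) i)" for i
      using abc p polys_coeff by (auto simp: divs_def)
    ultimately have "(\<forall>i. divs p (coeff a i)) \<or> (\<forall>i. divs p (coeff b i))"
      using gauss abc by blast
    then show ?thesis
    proof
      assume "\<forall>i. divs p (coeff a i)"
      then show ?thesis using coeffs_divisible[of p a] p by (metis mult_pCons_left mult_zero_left add.right_neutral pCons_0_0)
    next
      assume "\<forall>i. divs p (coeff b i)"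
      then show ?thesis using coeffs_divisible[of p b] p by (metis mult_pCons_left mult_zero_left add.right_neutral pCons_0_0)
    qed
  next
    case False
    show ?thesis
    proof (cases "\<exists>d\<in>polys. a = f * d")
      case no: False
      obtain u v r where uv: "u \<in> polys" "v \<in> polys" "r \<in> U" "r \<noteq> 0" "u * f + v * a = [:r:]"
        using elimination[OF irr _ abc(1) no] False by blast
      have "smult r b = (u * f + v * a) * b" by (simp add: uv)
      also have "\<dots> = u * f * b + v * (a * b)" by (simp add: algebra_simps)
      also have "\<dots> = f * (u * b + v * c)" unfolding abc(4) by (simp add: algebra_simps)
      finally have "\<exists>h\<in>polys. b = f * h"
        using primitive_cancel[OF uv(3,4) f(1) poly_irred_primitive[OF irr] abc(2)] False uv abc
        by (auto intro!: polys_add polys_mult)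
      then show ?thesis by blast
    qed simp
  qed
qed (auto simp: polys_1 polys_diff polys_mult degree_mult_eq N_mult polys_coeff coeff_mult_degree_sum)

end

section \<open>Multivariate polynomials\<close>

locale ring_morphism =
  fixes h :: "'x::comm_ring_1 \<Rightarrow> 'y::comm_ring_1"
  assumes add: "h (a + b) = h a + h b"
    and mult: "h (a * b) = h a * h b"
    and one: "h 1 = 1"
begin

lemma zero: "h 0 = 0"
  using add[of 0 0] by simp

lemma uminus: "h (- a) = - h a"
  using add[of a "- a"] zero by (simp add: eq_neg_iff_add_eq_0 add.commute)

lemma diff: "h (a - b) = h a - h b"
  using add[of a "- b"] uminus by simp

lemma sum: "h (sum f X) = (\<Sum>x\<in>X. h (f x))"
  by (induction X rule: infinite_finite_induct) (simp_all add: zero add)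

lemma prod: "h (prod f X) = (\<Prod>x\<in>X. h (f x))"
  by (induction X rule: infinite_finite_induct) (simp_all add: one mult)

lemma power: "h (a ^ n) = h a ^ n"
  by (induction n) (simp_all add: one mult)

lemma of_nat: "h (of_nat n) = of_nat n"
  by (induction n) (simp_all add: zero one add)

lemma of_int: "h (of_int n) = of_int n"
  by (cases n rule: int_diff_cases) (simp add: of_nat diff)

lemma det: "h (det A) = det (\<chi> i j. h (A $ i $ j))"
  by (simp add: det_def sum mult prod of_int)

end

definition monomial_value :: "('i \<Rightarrow> 'r) \<Rightarrow> ('i \<Rightarrow>\<^sub>0 nat) \<Rightarrow> 'r::comm_semiring_1" where
  "monomial_value x \<mu> = (\<Prod>i\<in>Poly_Mapping.keys \<mu>. x i ^ Poly_Mapping.lookup \<mu> i)"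

text \<open>
  The ring morphism that acts as \<open>c\<close> on constants and maps the variable \<open>i\<close> to \<open>x i\<close>.
\<close>

definition mpoly_subst ::
  "('a::comm_ring_1 \<Rightarrow> 'r::comm_ring_1) \<Rightarrow> ('i \<Rightarrow> 'r) \<Rightarrow> ('i, 'a) mpolynomial \<Rightarrow> 'r" where
  "mpoly_subst c x p = (\<Sum>\<mu>\<in>Poly_Mapping.keys p. c (Poly_Mapping.lookup p \<mu>) * monomial_value x \<mu>)"

abbreviation const :: "'a::zero \<Rightarrow> ('i, 'a) mpolynomial" where
  "const \<equiv> Poly_Mapping.single 0"

definition mvar :: "'i \<Rightarrow> ('i, 'a::comm_ring_1) mpolynomial" where
  "mvar i = Poly_Mapping.single (Poly_Mapping.single i 1) 1"

lemma peval_eq_subst: "peval x p = mpoly_subst (\<lambda>a. a) x p"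
  by (simp add: peval_def mpoly_subst_def monomial_value_def)

lemma monomial_value_superset:
  assumes "finite A" "Poly_Mapping.keys \<mu> \<subseteq> A"
  shows "monomial_value x \<mu> = (\<Prod>i\<in>A. x i ^ Poly_Mapping.lookup \<mu> i)"
  unfolding monomial_value_def using assms
  by (intro prod.mono_neutral_left) (auto simp: in_keys_iff)

lemma monomial_value_add: "monomial_value x (\<mu> + \<nu>) = monomial_value x \<mu> * monomial_value x \<nu>"
proof -
  let ?A = "Poly_Mapping.keys \<mu> \<union> Poly_Mapping.keys \<nu>"
  have "monomial_value x \<kappa> = (\<Prod>i\<in>?A. x i ^ Poly_Mapping.lookup \<kappa> i)" if "\<kappa> \<in> {\<mu>, \<nu>, \<mu> + \<nu>}" for \<kappa>
    using that keys_add[of \<mu> \<nu>] by (intro monomial_value_superset) auto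
  then show ?thesis by (simp add: lookup_add power_add prod.distrib)
qed

lemma monomial_value_single: "monomial_value x (Poly_Mapping.single i n) = x i ^ n"
  by (cases "n = 0") (simp_all add: monomial_value_def)

lemma monomial_value_0: "monomial_value x 0 = 1"
  by (simp add: monomial_value_def)

lemma sum_monomials: "p = (\<Sum>\<mu>\<in>Poly_Mapping.keys p. Poly_Mapping.single \<mu> (Poly_Mapping.lookup p \<mu>))"
  by (rule poly_mapping_eqI) (simp add: lookup_sum lookup_single when_def in_keys_iff sum.delta)

lemma ring_morphism_const: "ring_morphism (const :: 'a::comm_ring_1 \<Rightarrow> ('i, 'a) mpolynomial)"
  by unfold_locales (simp_all add: single_add mult_single flip: single_one)

lemma ring_morphism_id: "ring_morphism (\<lambda>a. a)"
  by unfold_locales auto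

lemma ring_morphism_comp: "ring_morphism f \<Longrightarrow> ring_morphism g \<Longrightarrow> ring_morphism (\<lambda>a. f (g a))"
  by (simp add: ring_morphism_def)

context
  fixes c :: "'a::comm_ring_1 \<Rightarrow> 'r::comm_ring_1" and x :: "'i \<Rightarrow> 'r"
  assumes c: "ring_morphism c"
begin

interpretation c: ring_morphism c by (rule c)

lemma mpoly_subst_superset:
  assumes "finite A" "Poly_Mapping.keys p \<subseteq> A"
  shows "mpoly_subst c x p = (\<Sum>\<mu>\<in>A. c (Poly_Mapping.lookup p \<mu>) * monomial_value x \<mu>)"
  unfolding mpoly_subst_def using assms
  by (intro sum.mono_neutral_left) (auto simp: in_keys_iff c.zero)

lemma mpoly_subst_single: "mpoly_subst c x (Poly_Mapping.single \<mu> a) = c a * monomial_value x \<mu>"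
  by (cases "a = 0") (simp_all add: mpoly_subst_def c.zero)

lemma mpoly_subst_add: "mpoly_subst c x (p + q) = mpoly_subst c x p + mpoly_subst c x q"
proof -
  let ?A = "Poly_Mapping.keys p \<union> Poly_Mapping.keys q"
  have "mpoly_subst c x r = (\<Sum>\<mu>\<in>?A. c (Poly_Mapping.lookup r \<mu>) * monomial_value x \<mu>)" if "r \<in> {p, q, p + q}" for r
    using that keys_add[of p q] by (intro mpoly_subst_superset) auto
  then show ?thesis by (simp add: lookup_add c.add ring_distribs sum.distrib)
qed

lemma mpoly_subst_0: "mpoly_subst c x 0 = 0"
  by (simp add: mpoly_subst_def)

lemma mpoly_subst_sum: "mpoly_subst c x (sum f X) = (\<Sum>y\<in>X. mpoly_subst c x (f y))"
  by (induction X rule: infinite_finite_induct) (simp_all add: mpoly_subst_0 mpoly_subst_add)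

lemma mpoly_subst_mult: "mpoly_subst c x (p * q) = mpoly_subst c x p * mpoly_subst c x q"
proof -
  let ?s = "\<lambda>p \<mu>. Poly_Mapping.single \<mu> (Poly_Mapping.lookup p \<mu>)"
  have "p * q = (\<Sum>\<mu>\<in>Poly_Mapping.keys p. \<Sum>\<nu>\<in>Poly_Mapping.keys q. ?s p \<mu> * ?s q \<nu>)"
    by (subst (1) sum_monomials[of p], subst (1) sum_monomials[of q]) (simp add: sum_product)
  then have "mpoly_subst c x (p * q) = (\<Sum>\<mu>\<in>Poly_Mapping.keys p. \<Sum>\<nu>\<in>Poly_Mapping.keys q.
      (c (Poly_Mapping.lookup p \<mu>) * monomial_value x \<mu>) * (c (Poly_Mapping.lookup q \<nu>) * monomial_value x \<nu>))"
    by (simp add: mpoly_subst_sum mult_single mpoly_subst_single c.mult monomial_value_add ac_simps)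
  then show ?thesis by (simp add: mpoly_subst_def sum_product)
qed

lemma ring_morphism_mpoly_subst: "ring_morphism (mpoly_subst c x)"
  by unfold_locales
    (simp_all add: mpoly_subst_add mpoly_subst_mult mpoly_subst_single monomial_value_0 c.one flip: single_one)

lemma mpoly_subst_mvar: "mpoly_subst c x (mvar i) = x i"
  by (simp add: mvar_def mpoly_subst_single monomial_value_single c.one)

lemma mpoly_subst_const: "mpoly_subst c x (const a) = c a"
  by (simp add: mpoly_subst_single monomial_value_0)

end

lemma ring_morphism_eq_subst:
  fixes h :: "('i, 'a::comm_ring_1) mpolynomial \<Rightarrow> 'r::comm_ring_1"
  assumes "ring_morphism h"
  shows "h p = mpoly_subst (\<lambda>a. h (const a)) (\<lambda>i. h (mvar i)) p"
proof -
  interpret h: ring_morphism h by fact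
  interpret c: ring_morphism const by (rule ring_morphism_const)
  have power_var: "mvar i ^ n = Poly_Mapping.single (Poly_Mapping.single i n) (1::'a)" for i :: 'i and n
    by (induction n) (simp_all add: mvar_def mult_single flip: single_add)
  have mono: "Poly_Mapping.single \<mu> a = const a * monomial_value mvar \<mu>" for \<mu> :: "'i \<Rightarrow>\<^sub>0 nat" and a :: 'a
  proof -
    have "Poly_Mapping.single (\<Sum>i\<in>A. Poly_Mapping.single i (Poly_Mapping.lookup \<mu> i)) (1::'a) =
        (\<Prod>i\<in>A. mvar i ^ Poly_Mapping.lookup \<mu> i)" for A
    proof (induction A rule: infinite_finite_induct)
      case (insert x F)
      then show ?case
        using mult_single[of "Poly_Mapping.single x (Poly_Mapping.lookup \<mu> x)" "1::'a"
            "\<Sum>i\<in>F. Poly_Mapping.single i (Poly_Mapping.lookup \<mu> i)" 1]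
        by (simp only: sum.insert[OF insert.hyps] prod.insert[OF insert.hyps] power_var mult_1_right)
    qed simp_all
    then have "Poly_Mapping.single \<mu> 1 = (monomial_value mvar \<mu> :: ('i, 'a) mpolynomial)"
      unfolding monomial_value_def by (subst sum_monomials[of \<mu>])
    then show ?thesis using mult_single[of 0 a \<mu> 1] by simp
  qed
  have "h p = (\<Sum>\<mu>\<in>Poly_Mapping.keys p. h (Poly_Mapping.single \<mu> (Poly_Mapping.lookup p \<mu>)))"
    by (subst sum_monomials) (simp add: h.sum)
  also have "\<dots> = (\<Sum>\<mu>\<in>Poly_Mapping.keys p. h (const (Poly_Mapping.lookup p \<mu>)) * monomial_value (\<lambda>i. h (mvar i)) \<mu>)"
    by (rule sum.cong[OF refl], subst mono) (simp add: h.mult monomial_value_def h.prod h.power)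
  finally show ?thesis unfolding mpoly_subst_def .
qed

lemma mpoly_subst_id: "mpoly_subst const mvar p = p"
  using ring_morphism_eq_subst[OF ring_morphism_id, of p] by simp

lemma ring_morphism_peval: "ring_morphism (peval (x :: 'i \<Rightarrow> 'a::comm_ring_1))"
  unfolding peval_eq_subst[abs_def] by (rule ring_morphism_mpoly_subst[OF ring_morphism_id])

lemmas peval_add = ring_morphism.add[OF ring_morphism_peval]
  and peval_mult = ring_morphism.mult[OF ring_morphism_peval]
  and peval_1 = ring_morphism.one[OF ring_morphism_peval]
  and peval_0 = ring_morphism.zero[OF ring_morphism_peval]
  and peval_diff = ring_morphism.diff[OF ring_morphism_peval]
  and peval_sum = ring_morphism.sum[OF ring_morphism_peval]
  and peval_prod = ring_morphism.prod[OF ring_morphism_peval]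
  and peval_power = ring_morphism.power[OF ring_morphism_peval]
  and peval_of_nat = ring_morphism.of_nat[OF ring_morphism_peval]
  and peval_det = ring_morphism.det[OF ring_morphism_peval]

lemma peval_single: "peval (x :: 'i \<Rightarrow> 'a::comm_ring_1) (Poly_Mapping.single \<mu> a) = a * monomial_value x \<mu>"
  unfolding peval_eq_subst by (rule mpoly_subst_single[OF ring_morphism_id])

lemma peval_const: "peval (x :: 'i \<Rightarrow> 'a::comm_ring_1) (const a) = a"
  by (simp add: peval_single monomial_value_0)

lemma peval_mvar: "peval (x :: 'i \<Rightarrow> 'a::comm_ring_1) (mvar i) = x i"
  unfolding peval_eq_subst by (rule mpoly_subst_mvar[OF ring_morphism_id])

lemma peval_subst:
  "peval y (mpoly_subst const x p) = peval (\<lambda>i. peval y (x i)) (p :: ('i, 'a::comm_ring_1) mpolynomial)"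
  using ring_morphism_eq_subst[OF ring_morphism_comp[OF ring_morphism_peval[of y]
      ring_morphism_mpoly_subst[OF ring_morphism_const, of x]], of p]
  by (simp add: peval_const peval_eq_subst[of "\<lambda>i. peval y (x i)"] mpoly_subst_const[OF ring_morphism_const]
      mpoly_subst_mvar[OF ring_morphism_const])

text \<open>
  The subring of polynomials in the variables from \<open>S\<close>.
\<close>

definition mpolys_in :: "'i set \<Rightarrow> ('i, 'a::zero) mpolynomial set" where
  "mpolys_in S = {p. \<forall>\<mu>\<in>Poly_Mapping.keys p. Poly_Mapping.keys \<mu> \<subseteq> S}"

lemma mpolys_in_add: "p \<in> mpolys_in S \<Longrightarrow> q \<in> mpolys_in S \<Longrightarrow> p + q \<in> mpolys_in S"
  using keys_add[of p q] by (auto simp: mpolys_in_def)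

lemma mpolys_in_diff:
  fixes p q :: "('i, 'a::ab_group_add) mpolynomial"
  shows "p \<in> mpolys_in S \<Longrightarrow> q \<in> mpolys_in S \<Longrightarrow> p - q \<in> mpolys_in S"
  using keys_diff[of p q] by (auto simp: mpolys_in_def)

lemma mpolys_in_mult:
  fixes p q :: "('i, 'a::comm_ring_1) mpolynomial"
  assumes "p \<in> mpolys_in S" "q \<in> mpolys_in S"
  shows "p * q \<in> mpolys_in S"
  unfolding mpolys_in_def
proof (intro CollectI ballI)
  fix \<mu> assume "\<mu> \<in> Poly_Mapping.keys (p * q)"
  then obtain a b where "a \<in> Poly_Mapping.keys p" "b \<in> Poly_Mapping.keys q" "\<mu> = a + b"
    using keys_mult[of p q] by blast
  then show "Poly_Mapping.keys \<mu> \<subseteq> S"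
    using assms keys_add[of a b] by (fastforce simp: mpolys_in_def)
qed

lemma mpolys_in_const: "const a \<in> mpolys_in S"
  by (cases "a = 0") (auto simp: mpolys_in_def)

lemma mpolys_in_1: "(1 :: ('i, 'a::comm_ring_1) mpolynomial) \<in> mpolys_in S"
  by (metis mpolys_in_const single_one)

lemma mpolys_in_mvar: "i \<in> S \<Longrightarrow> (mvar i :: ('i, 'a::comm_ring_1) mpolynomial) \<in> mpolys_in S"
  by (auto simp: mpolys_in_def mvar_def)

lemma mpolys_in_sum: "(\<And>x. x \<in> X \<Longrightarrow> f x \<in> mpolys_in S) \<Longrightarrow> sum f X \<in> mpolys_in S"
proof (induction X rule: infinite_finite_induct)
  case (insert x F)
  then show ?case by (simp add: mpolys_in_add)
qed (auto simp: mpolys_in_def)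

lemma mpolys_in_prod:
  "(\<And>x. x \<in> X \<Longrightarrow> f x \<in> mpolys_in S) \<Longrightarrow> prod f X \<in> (mpolys_in S :: ('i, 'a::comm_ring_1) mpolynomial set)"
  by (induction X rule: infinite_finite_induct) (auto simp: mpolys_in_1 mpolys_in_mult)

lemma mpolys_in_power:
  "p \<in> (mpolys_in S :: ('i, 'a::comm_ring_1) mpolynomial set) \<Longrightarrow> p ^ n \<in> mpolys_in S"
  by (induction n) (auto simp: mpolys_in_1 mpolys_in_mult)

lemma mpolys_in_mono: "S \<subseteq> T \<Longrightarrow> mpolys_in S \<subseteq> mpolys_in T"
  by (auto simp: mpolys_in_def)

lemma mpolys_in_UNIV: "mpolys_in UNIV = UNIV"
  by (auto simp: mpolys_in_def)

lemma mpolys_in_empty: "(mpolys_in {} :: ('i, 'a::zero) mpolynomial set) = range const"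
proof -
  have "p = const (Poly_Mapping.lookup p 0)" if "p \<in> mpolys_in {}" for p :: "('i, 'a) mpolynomial"
    using that by (intro poly_mapping_eqI) (auto simp: mpolys_in_def lookup_single when_def in_keys_iff)
  then show ?thesis by (auto simp: mpolys_in_const)
qed

lemma peval_cong_mpolys_in:
  assumes "p \<in> mpolys_in S" "\<And>i. i \<in> S \<Longrightarrow> x i = y i"
  shows "peval x p = peval y p"
  unfolding peval_def using assms
  by (intro sum.cong arg_cong2[where f = "(*)"] prod.cong refl) (auto simp: mpolys_in_def subset_iff)

definition coeffs_in :: "'i set \<Rightarrow> ('i, 'a::comm_ring_1) mpolynomial poly set" where
  "coeffs_in S = {q. \<forall>k. coeff q k \<in> mpolys_in S}"

text \<open>
  On \<open>coeffs_in S\<close> with \<open>x \<notin> S\<close>, putting the variable \<open>x\<close> for the indeterminate identifies univariate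
  polynomials over \<open>mpolys_in S\<close> with \<open>mpolys_in (insert x S)\<close>.
\<close>

definition at_var :: "'i \<Rightarrow> ('i, 'a::comm_ring_1) mpolynomial poly \<Rightarrow> ('i, 'a) mpolynomial" where
  "at_var x q = poly q (mvar x)"

lemma ring_morphism_at_var: "ring_morphism (at_var x)"
  by unfold_locales (simp_all add: at_var_def)

lemma ring_morphism_pCons: "ring_morphism f \<Longrightarrow> ring_morphism (\<lambda>a. [:f a:])"
  by (auto simp: ring_morphism_def one_pCons)

text \<open>
  The substitution \<open>\<Phi>\<close>, which sends \<open>x\<close> to the indeterminate and every other variable to itself as a
  constant, is a left inverse.
\<close>

lemma inj_on_at_var:
  assumes "x \<notin> S"
  shows "inj_on (at_var x) (coeffs_in S :: ('i, 'a::comm_ring_1) mpolynomial poly set)"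
proof -
  define \<Phi> where "\<Phi> = mpoly_subst (\<lambda>a::'a. [:const a:]) (\<lambda>i. if i = x then [:0, 1:] else [:mvar i:])"
  interpret \<Phi>: ring_morphism \<Phi>
    unfolding \<Phi>_def by (intro ring_morphism_mpoly_subst ring_morphism_pCons ring_morphism_const)
  interpret C: ring_morphism "\<lambda>a::('i, 'a) mpolynomial. [:a:]"
    by (intro ring_morphism_pCons ring_morphism_id)
  have \<Phi>_x: "\<Phi> (mvar x) = [:0, 1:]"
    unfolding \<Phi>_def by (subst mpoly_subst_mvar) (auto intro: ring_morphism_pCons ring_morphism_const)
  have \<Phi>_in: "\<Phi> p = [:p:]" if "p \<in> mpolys_in S" for p :: "('i, 'a) mpolynomial"
  proof -
    have "[:p:] = mpoly_subst (\<lambda>a. [:const a:]) (\<lambda>i. [:mvar i:]) p"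
      by (rule ring_morphism_eq_subst[OF C.ring_morphism_axioms])
    also have "\<dots> = \<Phi> p" unfolding \<Phi>_def mpoly_subst_def monomial_value_def
      using that assms by (intro sum.cong arg_cong2[where f = "(*)"] prod.cong refl) (auto simp: mpolys_in_def)
    finally show ?thesis by simp
  qed
  have "\<Phi> (at_var x q) = q" if "q \<in> coeffs_in S" for q
  proof -
    have "\<Phi> (at_var x q) = (\<Sum>k\<le>degree q. [:coeff q k:] * [:0, 1:] ^ k)"
      using that by (simp add: at_var_def poly_altdef \<Phi>.sum \<Phi>.mult \<Phi>.power \<Phi>_x \<Phi>_in coeffs_in_def)
    also have "\<dots> = q" using poly_as_sum_of_monoms[of q] by (simp add: monom_altdef)
    finally show ?thesis .
  qed
  then show ?thesis by (metis inj_onI)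
qed

lemma at_var_image:
  assumes "x \<notin> S"
  shows "at_var x ` coeffs_in S = (mpolys_in (insert x S) :: ('i, 'a::comm_ring_1) mpolynomial set)"
proof (intro subset_antisym subsetI)
  fix p :: "('i, 'a) mpolynomial" assume "p \<in> at_var x ` coeffs_in S"
  then obtain q where q: "q \<in> coeffs_in S" "p = at_var x q" by blast
  have "coeff q k \<in> mpolys_in (insert x S)" for k
    using q mpolys_in_mono[of S "insert x S"] by (auto simp: coeffs_in_def)
  then show "p \<in> mpolys_in (insert x S)" unfolding q at_var_def poly_altdef
    by (intro mpolys_in_sum mpolys_in_mult mpolys_in_power mpolys_in_mvar) auto
next
  fix p :: "('i, 'a) mpolynomial" assume p: "p \<in> mpolys_in (insert x S)"
  define q where "q \<mu> = monom (const (Poly_Mapping.lookup p \<mu>) *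
     (\<Prod>i\<in>Poly_Mapping.keys \<mu> - {x}. mvar i ^ Poly_Mapping.lookup \<mu> i)) (Poly_Mapping.lookup \<mu> x)" for \<mu>
  interpret h: ring_morphism "at_var x :: ('i, 'a) mpolynomial poly \<Rightarrow> _" by (rule ring_morphism_at_var)
  have "at_var x (q \<mu>) = const (Poly_Mapping.lookup p \<mu>) * monomial_value mvar \<mu>" for \<mu>
  proof -
    have "monomial_value mvar \<mu> = (mvar x ^ Poly_Mapping.lookup \<mu> x *
        (\<Prod>i\<in>Poly_Mapping.keys \<mu> - {x}. mvar i ^ Poly_Mapping.lookup \<mu> i) :: ('i, 'a) mpolynomial)"
    proof (cases "x \<in> Poly_Mapping.keys \<mu>")
      case True
      then show ?thesis unfolding monomial_value_def by (rule prod.remove[OF finite_keys])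
    qed (simp add: monomial_value_def in_keys_iff)
    then show ?thesis by (simp only: at_var_def q_def poly_monom mult_ac)
  qed
  then have "p = at_var x (\<Sum>\<mu>\<in>Poly_Mapping.keys p. q \<mu>)"
    using mpoly_subst_id[of p] by (simp add: h.sum mpoly_subst_def)
  moreover have "coeff (\<Sum>\<mu>\<in>Poly_Mapping.keys p. q \<mu>) k \<in> mpolys_in S" for k
  proof -
    have 0: "0 \<in> (mpolys_in S :: ('i, 'a) mpolynomial set)" by (simp add: mpolys_in_def)
    have "i \<in> S" if "\<mu> \<in> Poly_Mapping.keys p" "i \<in> Poly_Mapping.keys \<mu> - {x}" for \<mu> i
      using that p by (auto simp: mpolys_in_def)
    then have "coeff (q \<mu>) k \<in> mpolys_in S" if "\<mu> \<in> Poly_Mapping.keys p" for \<mu>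
      unfolding q_def coeff_monom using 0 that
      by (cases "Poly_Mapping.lookup \<mu> x = k")
        (auto intro!: mpolys_in_mult mpolys_in_prod mpolys_in_power mpolys_in_mvar mpolys_in_const)
    then show ?thesis unfolding coeff_sum by (rule mpolys_in_sum)
  qed
  ultimately show "p \<in> at_var x ` coeffs_in S" by (auto simp: coeffs_in_def)
qed

lemma peval_at_var:
  fixes q :: "('i, 'a::comm_ring_1) mpolynomial poly"
  assumes "q \<in> coeffs_in S" "x \<notin> S"
  shows "peval (y(x := s)) (at_var x q) = poly (map_poly (peval y) q) s"
proof -
  have "peval (y(x := s)) (coeff q k) = peval y (coeff q k)" for k
    using assms by (intro peval_cong_mpolys_in[of _ S]) (auto simp: coeffs_in_def)
  moreover have "poly (map_poly (peval y) q) s = (\<Sum>k\<le>degree q. peval y (coeff q k) * s ^ k)"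
  proof -
    have "poly (map_poly (peval y) q) s = (\<Sum>k\<le>degree q. coeff (map_poly (peval y) q) k * s ^ k)"
      unfolding poly_altdef
    proof (rule sum.mono_neutral_left)
      have "degree (map_poly (peval y) q) \<le> degree q"
        by (rule degree_le) (simp add: coeff_map_poly peval_0 coeff_eq_0)
      then show "{..degree (map_poly (peval y) q)} \<subseteq> {..degree q}" by simp
    qed (auto simp: coeff_eq_0)
    then show ?thesis by (simp add: coeff_map_poly peval_0)
  qed
  ultimately show ?thesis
    by (simp add: at_var_def poly_altdef peval_sum peval_mult peval_power peval_mvar)
qed

section \<open>Factorization of multivariate polynomials\<close>

lemma (in factorial_subring) factorial_image:
  assumes h: "ring_morphism h" "inj_on h U"
  shows "factorial_subring (h ` U) (\<lambda>a. N (inv_into U h a))"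
proof -
  interpret h: ring_morphism h by fact
  let ?g = "inv_into U h"
  have g: "?g (h a) = a" if "a \<in> U" for a using that h(2) by simp
  have eq: "h a = h b \<longleftrightarrow> a = b" if "a \<in> U" "b \<in> U" for a b
    using that h(2) by (auto dest: inj_onD)
  have u: "(\<exists>c\<in>h ` U. h a * c = 1) \<longleftrightarrow> (\<exists>c\<in>U. a * c = 1)" if "a \<in> U" for a
    using that eq[OF mult_in one_in] by (auto simp flip: h.mult simp: h.one)
  have d: "(\<exists>c\<in>h ` U. h a = h b * c) \<longleftrightarrow> (\<exists>c\<in>U. a = b * c)" if "a \<in> U" "b \<in> U" for a b
    using that eq mult_in by (auto simp flip: h.mult)
  show ?thesis
  proof
    show "1 \<in> h ` U" using one_in h.one by (metis imageI)
    show "a - b \<in> h ` U" if "a \<in> h ` U" "b \<in> h ` U" for a b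
      using that by (auto simp flip: h.diff intro: diff_in)
    show "a * b \<in> h ` U" if "a \<in> h ` U" "b \<in> h ` U" for a b
      using that by (auto simp flip: h.mult intro: mult_in)
    show "N (?g (a * b)) = N (?g a) + N (?g b)"
      if "a \<in> h ` U" "b \<in> h ` U" "a \<noteq> 0" "b \<noteq> 0" for a b
      using that by (auto simp: g mult_in h.zero simp flip: h.mult intro!: N_mult)
    show "\<exists>b\<in>h ` U. a * b = 1" if a: "a \<in> h ` U" "a \<noteq> 0" "N (?g a) = 0" for a
    proof -
      obtain a' where "a' \<in> U" "a = h a'" using a by blast
      moreover from this have "a' \<noteq> 0" using a(2) h.zero by auto
      ultimately show ?thesis using a u[of a'] N_eq_0[of a'] by (auto simp: g)
    qed
    fix p a b c
    assume p: "p \<in> h ` U" "p \<noteq> 0" "\<not> (\<exists>c\<in>h ` U. p * c = 1)"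
      "\<And>a b. a \<in> h ` U \<Longrightarrow> b \<in> h ` U \<Longrightarrow> p = a * b \<Longrightarrow>
         (\<exists>c\<in>h ` U. a * c = 1) \<or> (\<exists>c\<in>h ` U. b * c = 1)"
      and "a \<in> h ` U" "b \<in> h ` U" "c \<in> h ` U" "a * b = p * c"
    then obtain p' a' b' c' where e: "p = h p'" "a = h a'" "b = h b'" "c = h c'"
      and i: "p' \<in> U" "a' \<in> U" "b' \<in> U" "c' \<in> U" by blast
    have "a' * b' = p' * c'"
      using \<open>a * b = p * c\<close> i eq[OF mult_in mult_in] by (simp add: e flip: h.mult)
    moreover have "p' \<noteq> 0" using p(2) e h.zero by auto
    moreover have "\<not> (\<exists>c\<in>U. p' * c = 1)" using p(3) u i e by blast
    moreover have "(\<exists>c\<in>U. x * c = 1) \<or> (\<exists>c\<in>U. y * c = 1)" if "x \<in> U" "y \<in> U" "p' = x * y" for x y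
      using p(4)[of "h x" "h y"] that u by (simp add: e h.mult)
    ultimately have "(\<exists>d\<in>U. a' = p' * d) \<or> (\<exists>d\<in>U. b' = p' * d)"
      using irreducible_prime[of p' a' b' c'] i by blast
    then show "(\<exists>d\<in>h ` U. a = p * d) \<or> (\<exists>d\<in>h ` U. b = p * d)"
      using d i by (simp add: e)
  qed
qed

text \<open>
  Adjoining a variable to \<open>mpolys_in S\<close> is the passage to univariate polynomials, by \<open>at_var\<close>.
\<close>

theorem factorial_mpolys_in:
  assumes "finite S"
  shows "\<exists>N. factorial_subring (mpolys_in S :: ('i::linorder, 'a::field) mpolynomial set) N"
  using assms
proof (induction S)
  case empty
  interpret c: ring_morphism "const :: 'a \<Rightarrow> ('i, 'a) mpolynomial" by (rule ring_morphism_const)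
  have u: "\<exists>b\<in>mpolys_in {}. a * b = 1" if a: "a \<in> mpolys_in {}" "a \<noteq> 0" for a :: "('i, 'a) mpolynomial"
  proof -
    obtain x where x: "a = const x" using a by (auto simp: mpolys_in_empty)
    then have "x * inverse x = 1" using a by (cases "x = 0") (auto simp: c.zero)
    then have "a * const (inverse x) = 1" unfolding x c.mult[symmetric] by (simp only: c.one)
    then show ?thesis using mpolys_in_const by blast
  qed
  have "factorial_subring (mpolys_in {} :: ('i, 'a) mpolynomial set) (\<lambda>_. 0)"
    by unfold_locales (use u in \<open>auto intro: mpolys_in_1 mpolys_in_mult mpolys_in_diff\<close>)
  then show ?case by blast
next
  case (insert x S)
  then obtain N where "factorial_subring (mpolys_in S :: ('i, 'a) mpolynomial set) N" by blast
  then interpret F: factorial_subring "mpolys_in S :: ('i, 'a) mpolynomial set" N .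
  have eq: "F.polys = coeffs_in S" by (simp add: F.polys_def coeffs_in_def)
  have "factorial_subring (at_var x ` coeffs_in S)
      (\<lambda>a. (\<lambda>f. degree f + N (lead_coeff f)) (inv_into (coeffs_in S) (at_var x) a))"
    by (rule factorial_subring.factorial_image[OF F.factorial_polys[unfolded eq] ring_morphism_at_var
          inj_on_at_var[OF insert.hyps(2)]])
  then show ?case unfolding at_var_image[OF insert.hyps(2)] by blast
qed

context
  fixes N :: "('i::{finite, linorder}, 'a::field) mpolynomial \<Rightarrow> nat"
  assumes N: "factorial_subring UNIV N"
begin

interpretation factorial_subring UNIV N by (rule N)

lemma irred_iff: "irred p \<longleftrightarrow> irreducible p"
  unfolding irred_def irreducible_def unit_def by (auto simp: dvd_def mult.commute)

end

lemma factorial_mpolynomial: "\<exists>N. factorial_subring (UNIV :: ('i::{finite, linorder}, 'a::field) mpolynomial set) N"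
  using factorial_mpolys_in[of "UNIV :: 'i set"] by (simp add: mpolys_in_UNIV)

lemma irreducible_in_prime_ideal:
  fixes D :: "('i::{finite, linorder}, 'a::field) mpolynomial"
  assumes I: "\<And>a b. a * b \<in> I \<Longrightarrow> a \<in> I \<or> b \<in> I" "\<And>u. u dvd 1 \<Longrightarrow> u \<notin> I" and D: "D \<in> I" "D \<noteq> 0"
  obtains P where "irreducible P" "P \<in> I"
proof -
  obtain N where N: "factorial_subring (UNIV :: ('i, 'a) mpolynomial set) N" using factorial_mpolynomial by blast
  interpret factorial_subring "UNIV :: ('i, 'a) mpolynomial set" N by (rule N)
  have "\<exists>P. irreducible P \<and> P \<in> I" using D
  proof (induction "N D" arbitrary: D rule: less_induct)
    case less
    have "\<not> unit D" using less.prems I(2)[of D] by (auto simp: unit_def dvd_def)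
    then obtain p c where p: "irred p" "D = p * c" using ex_irred_divisor less.prems by (metis UNIV_I)
    then have "p \<noteq> 0" "c \<noteq> 0" "\<not> unit p" using less.prems by (auto simp: irred_def)
    then have "N c < N D" using N_mult[of p c] N_nonunit[of p] p by simp
    then show ?case using I(1)[of p c] less p \<open>c \<noteq> 0\<close> irred_iff[OF N] by blast
  qed
  then show thesis using that by blast
qed

lemma multiplicity_of_irreducible:
  fixes D :: "('i::{finite, linorder}, 'a::field) mpolynomial"
  assumes "irreducible P" "D \<noteq> 0"
  obtains k R where "D = P ^ k * R" "\<not> P dvd R"
proof -
  obtain N where N: "factorial_subring (UNIV :: ('i, 'a) mpolynomial set) N" using factorial_mpolynomial by blast
  interpret factorial_subring "UNIV :: ('i, 'a) mpolynomial set" N by (rule N)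
  have P: "irred P" using assms irred_iff[OF N] by blast
  have "\<exists>k R. D = P ^ k * R \<and> \<not> P dvd R" using assms(2)
  proof (induction "N D" arbitrary: D rule: less_induct)
    case less
    show ?case
    proof (cases "P dvd D")
      case False
      then show ?thesis by (intro exI[of _ 0] exI[of _ D]) simp
    next
      case True
      then obtain c where c: "D = P * c" by blast
      then have "c \<noteq> 0" "P \<noteq> 0" "\<not> unit P" using less.prems P by (auto simp: irred_def)
      then have "N c < N D" using N_mult[of P c] N_nonunit[of P] c by simp
      then obtain k R where "c = P ^ k * R" "\<not> P dvd R" using less \<open>c \<noteq> 0\<close> by blast
      then show ?thesis using c by (intro exI[of _ "Suc k"] exI[of _ R]) (simp add: mult.assoc)
    qed
  qed
  then show thesis using that by blast
qed

lemma at_var_surj: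
  fixes p :: "('i, 'a::comm_ring_1) mpolynomial"
  obtains q where "q \<in> coeffs_in (- {x})" "p = at_var x q"
proof -
  have "insert x (- {x}) = UNIV" by auto
  then have "p \<in> at_var x ` coeffs_in (- {x})"
    using at_var_image[of x "- {x}", where 'a = 'a] by (simp add: mpolys_in_UNIV)
  then show thesis using that by blast
qed

text \<open>
  The theorem on elimination for univariate polynomials, transported along \<open>at_var x\<close>.
\<close>

theorem elimination_mpoly:
  fixes P F :: "('i::{finite, linorder}, 'a::field) mpolynomial"
  assumes P: "irreducible P" "P \<notin> mpolys_in (- {x})" and F: "\<not> P dvd F"
  obtains u v r where "u * P + v * F = r" "r \<in> mpolys_in (- {x})" "r \<noteq> 0"
proof -
  let ?U = "mpolys_in (- {x}) :: ('i, 'a) mpolynomial set"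
  obtain N where "factorial_subring ?U N" using factorial_mpolys_in[of "- {x}"] by auto
  then interpret U: factorial_subring ?U N .
  interpret h: ring_morphism "at_var x :: ('i, 'a) mpolynomial poly \<Rightarrow> _" by (rule ring_morphism_at_var)
  have eq: "U.polys = coeffs_in (- {x})" by (simp add: U.polys_def coeffs_in_def)
  have inj: "inj_on (at_var x) (U.polys)" unfolding eq by (rule inj_on_at_var) simp
  obtain p where p: "p \<in> U.polys" "P = at_var x p" using at_var_surj[of x P] unfolding eq by blast
  obtain f where f: "f \<in> U.polys" "F = at_var x f" using at_var_surj[of x F] unfolding eq by blast
  have unit: "U.poly_unit a" if "at_var x a dvd 1" "a \<in> U.polys" for a
  proof -
    obtain b where "at_var x a * b = 1" using \<open>at_var x a dvd 1\<close> by (auto elim: dvdE)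
    moreover obtain c where c: "c \<in> U.polys" "b = at_var x c" using at_var_surj[of x b] unfolding eq by blast
    ultimately have "at_var x (a * c) = at_var x 1" by (simp add: h.mult h.one)
    then have "a * c = 1" using inj that c U.polys_mult U.polys_1 by (auto dest: inj_onD)
    then show ?thesis using c by (auto simp: U.poly_unit_def)
  qed
  have irr: "U.poly_irred p"
    unfolding U.poly_irred_def
  proof (intro conjI ballI impI)
    show "p \<noteq> 0" using P p h.zero by auto
    show "\<not> U.poly_unit p"
    proof
      assume "U.poly_unit p"
      then obtain c where "p * c = 1" by (auto simp: U.poly_unit_def)
      then have "P * at_var x c = 1" using p h.mult h.one by metis
      then show False using P(1) by (metis dvdI irreducible_not_unit)
    qed
    fix a b assume "a \<in> U.polys" "b \<in> U.polys" "p = a * b"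
    then show "U.poly_unit a \<or> U.poly_unit b"
      using P(1) p(2) irreducibleD[of P "at_var x a" "at_var x b"] unit by (auto simp: h.mult)
  qed (rule p)
  have "degree p > 0"
  proof (rule ccontr)
    assume "\<not> ?thesis"
    then obtain c where "p = [:c:]" by (auto elim: degree_eq_zeroE)
    then show False using p P(2) by (simp add: at_var_def U.polys_const)
  qed
  moreover have "\<not> (\<exists>h\<in>U.polys. f = p * h)" using F p f h.mult by (auto simp: dvd_def)
  ultimately obtain u v r where r: "r \<in> ?U" "r \<noteq> 0" "u * p + v * f = [:r:]"
    by (rule U.elimination[OF irr _ f(1)])
  have "at_var x (u * p + v * f) = r" unfolding r(3) by (simp add: at_var_def)
  then have "at_var x u * P + at_var x v * F = r" by (simp only: p f h.mult h.add)
  then show thesis using that r by blast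
qed

lemma exists_nonzero_value:
  fixes p :: "('i, 'a::field_char_0) mpolynomial"
  assumes "finite S" "p \<in> mpolys_in S" "p \<noteq> 0"
  shows "\<exists>y. peval y p \<noteq> 0"
  using assms
proof (induction S arbitrary: p)
  case empty
  then obtain a where "p = const a" by (auto simp: mpolys_in_empty)
  then show ?case using empty by (auto simp: peval_const)
next
  case (insert x S)
  then obtain q where q: "q \<in> coeffs_in S" "p = at_var x q" using at_var_image[OF insert.hyps(2)] by blast
  then have "q \<noteq> 0" using insert.prems by (auto simp: at_var_def)
  then obtain y where y: "peval y (lead_coeff q) \<noteq> 0"
    using insert.IH[of "lead_coeff q"] q by (auto simp: coeffs_in_def)
  then have "map_poly (peval y) q \<noteq> 0"
    by (metis coeff_0 coeff_map_poly peval_0)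
  then have "finite {s. poly (map_poly (peval y) q) s = 0}" by (rule poly_roots_finite)
  then obtain s where "poly (map_poly (peval y) q) s \<noteq> 0"
    using infinite_UNIV_char_0 by (metis (mono_tags) UNIV_eq_I finite_subset mem_Collect_eq subsetI)
  then show ?case using peval_at_var[OF q(1) insert.hyps(2)] q(2) by metis
qed

lemma mpoly_eqI:
  fixes p q :: "('i::finite, 'a::field_char_0) mpolynomial"
  assumes "\<And>y. peval y p = peval y q"
  shows "p = q"
  using exists_nonzero_value[of UNIV "p - q"] assms by (auto simp: mpolys_in_UNIV peval_diff)

section \<open>Polynomial functions of one variable\<close>

text \<open>
  Every density argument below restricts polynomials to a line or a curve. For these one-variable
  functions only the closure properties and the finiteness of the set of zeros matter.
\<close>

definition polynomial_fun :: "('a::comm_ring_1 \<Rightarrow> 'a) \<Rightarrow> bool" where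
  "polynomial_fun f \<longleftrightarrow> (\<exists>p. \<forall>t. f t = poly p t)"

named_theorems polynomial_intros

lemma polynomial_fun_const [polynomial_intros]: "polynomial_fun (\<lambda>t. c)"
  unfolding polynomial_fun_def by (rule exI[of _ "[:c:]"]) simp

lemma polynomial_fun_id [polynomial_intros]: "polynomial_fun (\<lambda>t. t)"
  unfolding polynomial_fun_def by (rule exI[of _ "[:0, 1:]"]) simp

lemma polynomial_fun_add [polynomial_intros]:
  "polynomial_fun f \<Longrightarrow> polynomial_fun g \<Longrightarrow> polynomial_fun (\<lambda>t. f t + g t)"
  unfolding polynomial_fun_def by (metis poly_add)

lemma polynomial_fun_mult [polynomial_intros]:
  "polynomial_fun f \<Longrightarrow> polynomial_fun g \<Longrightarrow> polynomial_fun (\<lambda>t. f t * g t)"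
  unfolding polynomial_fun_def by (metis poly_mult)

lemma polynomial_fun_diff [polynomial_intros]:
  "polynomial_fun f \<Longrightarrow> polynomial_fun g \<Longrightarrow> polynomial_fun (\<lambda>t. f t - g t)"
  unfolding polynomial_fun_def by (metis poly_diff)

lemma polynomial_fun_sum [polynomial_intros]:
  "(\<And>x. x \<in> X \<Longrightarrow> polynomial_fun (\<lambda>t. f t x)) \<Longrightarrow> polynomial_fun (\<lambda>t. \<Sum>x\<in>X. f t x)"
  by (induction X rule: infinite_finite_induct) (auto intro!: polynomial_intros)

lemma polynomial_fun_prod [polynomial_intros]:
  "(\<And>x. x \<in> X \<Longrightarrow> polynomial_fun (\<lambda>t. f t x)) \<Longrightarrow> polynomial_fun (\<lambda>t. \<Prod>x\<in>X. f t x)"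
  by (induction X rule: infinite_finite_induct) (auto intro!: polynomial_intros)

lemma polynomial_fun_power [polynomial_intros]: "polynomial_fun f \<Longrightarrow> polynomial_fun (\<lambda>t. f t ^ n)"
  by (induction n) (auto intro!: polynomial_intros)

lemma polynomial_fun_peval [polynomial_intros]:
  "(\<And>i. polynomial_fun (\<lambda>t. y t i)) \<Longrightarrow> polynomial_fun (\<lambda>t. peval (y t) p)"
  unfolding peval_def by (intro polynomial_intros)

lemma polynomial_fun_det [polynomial_intros]:
  "(\<And>i j. polynomial_fun (\<lambda>t. A t $ i $ j)) \<Longrightarrow> polynomial_fun (\<lambda>t. det (A t))"
  unfolding det_def by (intro polynomial_intros)

lemma polynomial_fun_nonzero_mult:
  fixes f g :: "'a::field_char_0 \<Rightarrow> 'a"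
  assumes "polynomial_fun f" "polynomial_fun g" "f s \<noteq> 0" "g t \<noteq> 0"
  shows "\<exists>x. f x * g x \<noteq> 0"
proof -
  obtain p q where p: "\<And>x. f x = poly p x" and q: "\<And>x. g x = poly q x"
    using assms unfolding polynomial_fun_def by blast
  have "p * q \<noteq> 0" using assms p q by auto
  then have "\<exists>x. poly (p * q) x \<noteq> 0" using poly_eq_poly_eq_iff[of "p * q" 0] by (auto simp: fun_eq_iff)
  then show ?thesis by (simp add: p q)
qed

lemma polynomial_fun_eq_at_0:
  fixes f g :: "'a::field_char_0 \<Rightarrow> 'a"
  assumes "polynomial_fun f" "polynomial_fun g" "\<And>t. t \<noteq> 0 \<Longrightarrow> f t = g t"
  shows "f t = g t"
proof (rule ccontr)
  assume "f t \<noteq> g t"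
  then have "\<exists>x. (f x - g x) * x \<noteq> 0"
    using polynomial_fun_nonzero_mult[of "\<lambda>x. f x - g x" "\<lambda>x. x" t 1] assms by (auto intro: polynomial_intros)
  then show False using assms(3) by force
qed

text \<open>
  On the line through \<open>y\<close> and \<open>z\<close> the polynomial \<open>u\<close> has no root, hence has degree \<open>0\<close>.
\<close>

lemma nonvanishing_constant:
  fixes u :: "('i, 'a::{alg_closed_field, field_char_0}) mpolynomial"
  assumes "\<And>y. peval y u \<noteq> 0"
  shows "peval y u = peval z u"
proof -
  have "polynomial_fun (\<lambda>t. peval (\<lambda>i. z i + t * (y i - z i)) u)" by (intro polynomial_intros)
  then obtain p where p: "\<And>t. peval (\<lambda>i. z i + t * (y i - z i)) u = poly p t"
    unfolding polynomial_fun_def by blast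
  have "degree p = 0"
    using alg_closed_imp_poly_has_root[of p] assms by (metis gr0I p)
  then obtain c where "p = [:c:]" by (metis degree_eq_zeroE)
  then show ?thesis using p[of 0] p[of 1] by simp
qed

section \<open>Determinants of pencils with a small leading rank\<close>

text \<open>
  Each further linear condition lowers the dimension by at most one.
\<close>

lemma dim_common_kernel:
  fixes f :: "'l \<Rightarrow> 'a::field ^ 'n \<Rightarrow> 'a"
  assumes "finite L"
    and add: "\<And>l x y. f l (x + y) = f l x + f l y" and scale: "\<And>l c x. f l (c *s x) = c * f l x"
  shows "CARD('n) \<le> vec.dim {x. \<forall>l\<in>L. f l x = 0} + card L"
  using assms(1)
proof (induction L)
  case empty
  then show ?case using vec_dim_card[where 'a = 'a and 'n = 'n] by simp
next
  case (insert l L)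
  define S where "S = {x. \<forall>l\<in>L. f l x = 0}"
  define K where "K = {x. \<forall>l\<in>insert l L. f l x = 0}"
  have diff: "f l (x - y) = f l x - f l y" for l x y
    using add[of l "x - y" y] by simp
  have "vec.dim S \<le> vec.dim K + 1"
  proof (cases "\<exists>v\<in>S. f l v \<noteq> 0")
    case False
    then have "K = S" by (auto simp: K_def S_def)
    then show ?thesis by simp
  next
    case True
    then obtain v where v: "v \<in> S" "f l v \<noteq> 0" by blast
    have "x \<in> vec.span (insert v K)" if "x \<in> S" for x
    proof -
      let ?c = "f l x / f l v"
      have "x - ?c *s v \<in> K" using that v by (auto simp: K_def S_def diff scale)
      then have "(x - ?c *s v) + ?c *s v \<in> vec.span (insert v K)"
        by (intro vec.span_add vec.span_scale vec.span_base) auto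
      then show ?thesis by simp
    qed
    then have "vec.dim S \<le> vec.dim (insert v K)" by (intro vec.dim_mono) auto
    also have "\<dots> \<le> vec.dim K + 1" by (simp add: vec.dim_insert)
    finally show ?thesis .
  qed
  then show ?case using insert.IH insert.hyps unfolding K_def S_def by simp
qed

lemma polynomial_fun_if [polynomial_intros]:
  "polynomial_fun f \<Longrightarrow> polynomial_fun g \<Longrightarrow> polynomial_fun (\<lambda>t. if b then f t else g t)"
  by (cases b) simp_all

text \<open>
  The hypothesis on the functionals \<open>f l\<close> says that \<open>M\<close> has a kernel of dimension at least \<open>r\<close>. In a
  basis that contains \<open>r\<close> vectors of the kernel, the corresponding columns of \<open>M + s N\<close> are divisible by
  \<open>s\<close>.
\<close>

theorem det_pencil_small_rank:
  fixes M N :: "'a::field_char_0 ^ 'n ^ 'n" and f :: "'l \<Rightarrow> 'a ^ 'n \<Rightarrow> 'a"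
  assumes "finite L" "card L + r \<le> CARD('n)"
    and lin: "\<And>l x y. f l (x + y) = f l x + f l y" "\<And>l c x. f l (c *s x) = c * f l x"
    and ker: "\<And>x. (\<And>l. l \<in> L \<Longrightarrow> f l x = 0) \<Longrightarrow> M *v x = 0"
  obtains g where "polynomial_fun g" "\<And>s. det (\<chi> i j. M $ i $ j + s * N $ i $ j) = s ^ r * g s"
proof -
  define K where "K = {x. \<forall>l\<in>L. f l x = 0}"
  obtain B where B: "B \<subseteq> K" "vec.independent B" "card B = vec.dim K"
    by (rule vec.basis_exists[of K])
  have "CARD('n) \<le> vec.dim K + card L"
    unfolding K_def by (rule dim_common_kernel[OF assms(1)]) (rule lin)+
  then have "r \<le> card B" using assms(2) B(3) by simp
  then obtain B0 where B0: "B0 \<subseteq> B" "card B0 = r" "finite B0"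
    by (rule obtain_subset_with_card_n)
  have ind: "vec.independent B0" using B0(1) B(2) by (rule vec.independent_mono[rotated])
  define E where "E = vec.extend_basis B0"
  have E: "B0 \<subseteq> E" "vec.independent E" "vec.span E = UNIV"
    using ind unfolding E_def
    by (simp_all add: vec.extend_basis_superset vec.independent_extend_basis)
  have finE: "finite E" using E(2) by (rule vec.finiteI_independent)
  have cardE: "card E = CARD('n)"
    using vec.dim_span_eq_card_independent[OF E(2)] vec_dim_card[where 'a = 'a and 'n = 'n] E(3) by simp
  obtain p where p: "bij_betw p (UNIV :: 'n set) E"
    using finite_same_card_bij[of "UNIV :: 'n set" E] finE cardE by auto
  define C where "C = (\<chi> i j. p j $ i)"
  have col: "column j C = p j" for j by (simp add: C_def column_def vec_eq_iff)
  have "\<forall>c. (\<Sum>j\<in>UNIV. c j *s column j C) = 0 \<longrightarrow> (\<forall>j. c j = 0)"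
  proof (intro allI impI)
    fix c j assume s: "(\<Sum>j\<in>UNIV. c j *s column j C) = 0"
    define q where "q = inv_into UNIV p"
    have qp: "q (p j) = j" for j using p by (simp add: q_def bij_betw_def)
    have "(\<Sum>v\<in>E. c (q v) *s v) = (\<Sum>j\<in>UNIV. c j *s p j)"
      using sum.reindex_bij_betw[OF p, of "\<lambda>v. c (q v) *s v"] by (simp add: qp)
    then have "(\<Sum>v\<in>E. c (q v) *s v) = 0" using s by (simp add: col)
    then have "c (q (p j)) = 0"
      using vec.independentD[OF E(2) finE subset_refl, of "\<lambda>v. c (q v)" "p j"] p by (auto simp: bij_betw_def)
    then show "c j = 0" by (simp add: qp)
  qed
  then have "\<exists>D. D ** C = mat 1" using matrix_left_invertible_independent_columns by blast
  then have detC: "det C \<noteq> 0" by (metis invertible_det_nz invertible_left_inverse)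
  define J where "J = {j. p j \<in> B0}"
  have cardJ: "card J = r"
  proof -
    have "B0 = p ` J" using E(1) p by (auto simp: J_def bij_betw_def)
    moreover have "inj_on p J" using p by (auto simp: bij_betw_def inj_on_def)
    ultimately show ?thesis using B0(2) by (simp add: card_image)
  qed
  have MC: "(M ** C) $ i $ j = 0" if "j \<in> J" for i j
  proof -
    have "p j \<in> K" using that B0 B by (auto simp: J_def)
    then have "M *v p j = 0" using ker by (simp add: K_def)
    then have "(M *v p j) $ i = 0" by simp
    then show ?thesis by (simp add: matrix_matrix_mult_def matrix_vector_mult_def C_def)
  qed
  \<comment> \<open>The transpose of \<open>(M + s N) C\<close>, with the factor \<open>s\<close> taken out of the rows in \<open>J\<close>.\<close>
  define G where "G s = (\<chi> j i. if j \<in> J then (N ** C) $ i $ j else (M ** C) $ i $ j + s * (N ** C) $ i $ j)" for s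
  have "det (\<chi> i j. M $ i $ j + s * N $ i $ j) * det C = s ^ r * det (G s)" for s
  proof -
    have "transpose ((\<chi> i j. M $ i $ j + s * N $ i $ j) ** C) = (\<chi> j. (if j \<in> J then s else 1) *s G s $ j)"
    proof -
      have "((\<chi> i j. M $ i $ j + s * N $ i $ j) ** C) $ i $ j = (M ** C) $ i $ j + s * (N ** C) $ i $ j" for i j
        by (simp add: matrix_matrix_mult_def sum.distrib sum_distrib_left algebra_simps)
      then show ?thesis by (simp add: vec_eq_iff transpose_def G_def MC)
    qed
    then have "det ((\<chi> i j. M $ i $ j + s * N $ i $ j) ** C) = det (\<chi> j. (if j \<in> J then s else 1) *s G s $ j)"
      by (subst det_transpose[symmetric]) (simp only:)
    also have "\<dots> = (\<Prod>j\<in>UNIV. if j \<in> J then s else 1) * det (\<chi> j. G s $ j)"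
      by (rule det_rows_mul)
    finally have "det ((\<chi> i j. M $ i $ j + s * N $ i $ j) ** C) =
      (\<Prod>j\<in>UNIV. if j \<in> J then s else 1) * det (\<chi> j. G s $ j)" .
    then show ?thesis by (simp add: det_mul prod.If_cases cardJ)
  qed
  then have "det (\<chi> i j. M $ i $ j + s * N $ i $ j) = s ^ r * (det (G s) * inverse (det C))" for s
    using detC by (simp add: field_simps)
  moreover have "polynomial_fun (\<lambda>s. det (G s) * inverse (det C))"
    unfolding G_def by (intro polynomial_intros) (auto intro!: polynomial_intros)
  ultimately show thesis using that by blast
qed

section \<open>The contraction operator in coordinates\<close>

lemma UNIV_5: "(UNIV :: 5 set) = {0, 1, 2, 3, 4}"
  by (rule card_seteq[symmetric]) auto

lemma less_5:
  "(0::5) < 1" "(0::5) < 2" "(0::5) < 3" "(0::5) < 4" "(1::5) < 2" "(1::5) < 3" "(1::5) < 4"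
  "(2::5) < 3" "(2::5) < 4" "(3::5) < 4"
  by (simp_all add: less_bit1_def bit1.Rep_numeral bit1.Rep_0 bit1.Rep_1)

lemma shuffle_sign_singleton:
  "shuffle_sign A {b} = ((- 1) ^ card {a \<in> A. b < a} :: 'a::comm_ring_1)"
proof -
  have "card {(x, y). x \<in> A \<and> y \<in> {b} \<and> y < x} = card {a \<in> A. b < a}"
    by (rule bij_betw_same_card[of fst]) (auto simp: bij_betw_def inj_on_def image_iff)
  then show ?thesis by (simp add: shuffle_sign_def)
qed

text \<open>
  Multiplication with \<open>e a\<close> identifies the fourth exterior power with the dual of \<open>V\<close>. The value
  \<open>tcoeff t a C\<close> is the coefficient of \<open>t\<close> at the dual basis vector of \<open>e a\<close> and the basis element \<open>C\<close>;
  the sign is that of this identification.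
\<close>

definition tcoeff :: "'a::comm_ring_1 ^ (5 set \<times> 5 set) \<Rightarrow> 5 \<Rightarrow> 5 set \<Rightarrow> 'a" where
  "tcoeff t a C = shuffle_sign (- {a}) {a} * t $ (- {a}, C)"

lemma vol_axis: "vol (axis A 1 \<and>\<^sub>e ext_vec (axis a 1)) = (if A = - {a} then shuffle_sign (- {a}) {a} else 0)"
proof -
  have "A \<inter> {a} = {} \<and> UNIV = A \<union> {a} \<longleftrightarrow> A = - {a}" by blast
  then show ?thesis
    by (simp only: ext_vec_axis wedge_axis vol_def) (auto simp: axis_def[of "insert a A"])
qed

lemma wedge_axis_nth:
  "(axis C 1 \<and>\<^sub>e ext_vec (axis b 1)) $ D = (if b \<in> D \<and> C = D - {b} then shuffle_sign (D - {b}) {b} else 0)"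
proof -
  have iff: "C \<inter> {b} = {} \<and> D = C \<union> {b} \<longleftrightarrow> b \<in> D \<and> C = D - {b}" by blast
  have "(axis C 1 \<and>\<^sub>e ext_vec (axis b 1)) $ D = (if C \<inter> {b} = {} \<and> D = C \<union> {b} then shuffle_sign C {b} else 0)"
    unfolding ext_vec_axis wedge_axis by (simp add: axis_def[of "insert b C"])
  also have "\<dots> = (if b \<in> D \<and> C = D - {b} then shuffle_sign (D - {b}) {b} else 0)"
    unfolding iff by auto
  finally show ?thesis .
qed

text \<open>
  The coefficient at \<open>D\<close> of the vector in the third exterior power that \<open>t\<close> gives when \<open>e a\<close> is
  contracted with the first factor and \<open>e b\<close> is multiplied to the second one.
\<close>

definition contraction_term :: "'a::comm_ring_1 ^ (5 set \<times> 5 set) \<Rightarrow> 5 \<Rightarrow> 5 \<Rightarrow> 5 set \<Rightarrow> 'a" where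
  "contraction_term t a b D = (if b \<in> D then shuffle_sign (D - {b}) {b} * tcoeff t a (D - {b}) else 0)"

lemma sum_UNIV_prod: "(\<Sum>p\<in>UNIV. F p) = (\<Sum>A\<in>UNIV. \<Sum>C\<in>UNIV. F (A, C))"
  by (simp add: sum.cartesian_product case_prod_beta flip: UNIV_Times_UNIV)

lemma B_tri_axis_nth:
  "B_tri t (axis a 1) (axis b 1) (axis c 1) $ (D, l) =
    (let g = \<lambda>a b c. if l = c then contraction_term t a b D else 0
     in g a b c + g b a c + g c b a + g a c b + g b c a + g c a b)"
proof -
  define h where "h a b c = (\<Sum>p\<in>UNIV. t $ p *
    (vol (axis (fst p) 1 \<and>\<^sub>e ext_vec (axis a 1)) * ((axis (snd p) 1 \<and>\<^sub>e ext_vec (axis b 1)) $ D * axis c 1 $ l)))"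
    for a b c :: 5
  have h: "h a b c = (if l = c then contraction_term t a b D else 0)" for a b c
  proof -
    have "h a b c = (\<Sum>A\<in>UNIV. \<Sum>C\<in>UNIV. if A = - {a} then if C = D - {b} then
        (if l = c \<and> b \<in> D then shuffle_sign (D - {b}) {b} * tcoeff t a (D - {b}) else 0) else 0 else 0)"
      unfolding h_def vol_axis wedge_axis_nth sum_UNIV_prod
      by (intro sum.cong refl) (auto simp: tcoeff_def axis_def)
    also have "\<dots> = (\<Sum>A\<in>UNIV. if A = - {a} then \<Sum>C\<in>UNIV. if C = D - {b} then
        (if l = c \<and> b \<in> D then shuffle_sign (D - {b}) {b} * tcoeff t a (D - {b}) else 0) else 0 else 0)"
      by (intro sum.cong refl) simp
    finally show ?thesis by (auto simp: contraction_term_def)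
  qed
  have "B_tri t (axis a 1) (axis b 1) (axis c 1) $ (D, l) =
      h a b c + h b a c + h c b a + h a c b + h b c a + h c a b"
    by (simp add: B_tri_def B_product_expand eval_nat_numeral Let_def h_def tensor_def sum.distrib distrib_left mult.assoc)
  then show ?thesis by (simp add: h Let_def)
qed

lemma contraction_term_triple:
  assumes "i < j" "j < k"
  shows "contraction_term t a b {i, j, k} =
    (if b = i then tcoeff t a {j, k} else if b = j then - tcoeff t a {i, k} else if b = k then tcoeff t a {i, j} else 0)"
proof -
  have ne: "i \<noteq> j" "j \<noteq> k" "i \<noteq> k" "i < k" using assms by auto
  have d: "{i, j, k} - {i} = {j, k}" "{i, j, k} - {j} = {i, k}" "{i, j, k} - {k} = {i, j}" using ne by auto
  have c: "{a \<in> {j, k}. i < a} = {j, k}" "{a \<in> {i, k}. j < a} = {k}" "{a \<in> {i, j}. k < a} = {}"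
    using assms ne by auto
  have s: "card {a \<in> {j, k}. i < a} = 2" "card {a \<in> {i, k}. j < a} = 1" "card {a \<in> {i, j}. k < a} = 0"
    unfolding c using ne by simp_all
  consider "b = i" | "b = j" | "b = k" | "b \<notin> {i, j, k}" by blast
  then show ?thesis
  proof cases
    case 1
    then show ?thesis unfolding contraction_term_def 1 d shuffle_sign_singleton s by simp
  next
    case 2
    then show ?thesis unfolding contraction_term_def 2 d shuffle_sign_singleton s using ne by simp
  next
    case 3
    then show ?thesis unfolding contraction_term_def 3 d shuffle_sign_singleton s using ne by simp
  next
    case 4
    then show ?thesis by (simp add: contraction_term_def)
  qed
qed

lemma sum_swap_inner:
  "(\<Sum>a\<in>A. \<Sum>b\<in>B. \<Sum>c\<in>C. f a b c) = (\<Sum>c\<in>C. \<Sum>a\<in>A. \<Sum>b\<in>B. f a b c)"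
proof -
  have "(\<Sum>a\<in>A. \<Sum>b\<in>B. \<Sum>c\<in>C. f a b c) = (\<Sum>a\<in>A. \<Sum>c\<in>C. \<Sum>b\<in>B. f a b c)"
    by (intro sum.cong refl sum.swap)
  also have "\<dots> = (\<Sum>c\<in>C. \<Sum>a\<in>A. \<Sum>b\<in>B. f a b c)" by (rule sum.swap)
  finally show ?thesis .
qed

lemma contraction_c_nth:
  "contraction_c t $ k = (\<Sum>i | i < k. tcoeff t i {i, k}) - (\<Sum>j | k < j. tcoeff t j {k, j})"
proof -
  define H where "H A C = (\<Sum>(i, j)\<in>{(i::5, j). i < j}. if C = {i, j} then
      (if A = - {i} \<and> j = k then shuffle_sign (- {i}) {i} else 0) -
      (if A = - {j} \<and> i = k then shuffle_sign (- {j}) {j} else 0) else (0::'a))" for A C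
  have "contraction_c t $ k = (\<Sum>A\<in>UNIV. \<Sum>C\<in>UNIV. t $ (A, C) * H A C)"
    unfolding contraction_c_def tensor_lift_cong_sum H_def vol_axis sum_component vector_smult_component
    by (intro sum.cong arg_cong2[where f = "(*)"] refl) (auto simp: axis_def)
  also have "\<dots> = (\<Sum>A\<in>UNIV. \<Sum>C\<in>UNIV. \<Sum>(i, j)\<in>{(i, j). i < j}. if C = {i, j} then t $ (A, {i, j}) *
      ((if A = - {i} \<and> j = k then shuffle_sign (- {i}) {i} else 0) -
      (if A = - {j} \<and> i = k then shuffle_sign (- {j}) {j} else 0)) else 0)"
    unfolding H_def sum_distrib_left by (auto simp: case_prod_beta intro!: sum.cong)
  also have "\<dots> = (\<Sum>(i, j)\<in>{(i, j). i < j}. \<Sum>A\<in>UNIV. \<Sum>C\<in>UNIV. if C = {i, j} then t $ (A, {i, j}) *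
      ((if A = - {i} \<and> j = k then shuffle_sign (- {i}) {i} else 0) -
      (if A = - {j} \<and> i = k then shuffle_sign (- {j}) {j} else 0)) else 0)"
    unfolding case_prod_beta by (rule sum_swap_inner)
  also have "\<dots> = (\<Sum>(i, j)\<in>{(i, j). i < j}. (if j = k then tcoeff t i {i, j} else 0) - (if i = k then tcoeff t j {i, j} else 0))"
  proof (intro sum.cong refl, clarify)
    fix i j :: 5
    have "(\<Sum>A\<in>UNIV. \<Sum>C\<in>UNIV. if C = {i, j} then t $ (A, {i, j}) *
      ((if A = - {i} \<and> j = k then shuffle_sign (- {i}) {i} else 0) -
      (if A = - {j} \<and> i = k then shuffle_sign (- {j}) {j} else 0)) else 0) =
      (\<Sum>A\<in>UNIV. (if A = - {i} then (if j = k then tcoeff t i {i, j} else 0) else 0) -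
        (if A = - {j} then (if i = k then tcoeff t j {i, j} else 0) else 0))"
      by (intro sum.cong refl) (auto simp: tcoeff_def algebra_simps)
    also have "\<dots> = (if j = k then tcoeff t i {i, j} else 0) - (if i = k then tcoeff t j {i, j} else 0)"
      by (simp add: sum_subtractf)
    finally show "(\<Sum>A\<in>UNIV. \<Sum>C\<in>UNIV. if C = {i, j} then t $ (A, {i, j}) *
      ((if A = - {i} \<and> j = k then shuffle_sign (- {i}) {i} else 0) -
      (if A = - {j} \<and> i = k then shuffle_sign (- {j}) {j} else 0)) else 0) =
      (if j = k then tcoeff t i {i, j} else 0) - (if i = k then tcoeff t j {i, j} else 0)" .
  qed
  also have "\<dots> = (\<Sum>(i, j)\<in>{(i, j). i < j \<and> j = k}. tcoeff t i {i, j}) - (\<Sum>(i, j)\<in>{(i, j). i < j \<and> i = k}. tcoeff t j {i, j})"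
    unfolding case_prod_beta sum_subtractf
    by (intro arg_cong2[where f = "(-)"] sum.mono_neutral_cong_right finite) auto
  also have "(\<Sum>(i, j)\<in>{(i, j). i < j \<and> j = k}. tcoeff t i {i, j}) = (\<Sum>i | i < k. tcoeff t i {i, k})"
    by (rule sum.reindex_bij_witness[of _ "\<lambda>i. (i, k)" fst]) auto
  also have "(\<Sum>(i, j)\<in>{(i, j). i < j \<and> i = k}. tcoeff t j {i, j}) = (\<Sum>j | k < j. tcoeff t j {k, j})"
    by (rule sum.reindex_bij_witness[of _ "\<lambda>j. (k, j)" snd]) auto
  finally show ?thesis .
qed

section \<open>A cubic at which the contraction operator is injective\<close>

text \<open>
  The exponent vectors of the five monomials are linearly independent, and the smallest product of
  powers of them in which all five variables have the same exponent has degree \<open>15\<close>; see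
  \<open>test_monomial_degree\<close>.
\<close>

definition test_cubic :: "(5, 'a::comm_ring_1) mpolynomial" where
  "test_cubic = Poly_Mapping.single (cubic_monomial_of 4 4 4) 1 + Poly_Mapping.single (cubic_monomial_of 3 3 3) 1 +
     Poly_Mapping.single (cubic_monomial_of 1 2 4) 1 + Poly_Mapping.single (cubic_monomial_of 0 2 3) 1 +
     Poly_Mapping.single (cubic_monomial_of 0 1 1) 1"

lemma less_sets_5:
  "{i. i < (0::5)} = {}" "{i. i < (1::5)} = {0}" "{i. i < (2::5)} = {0, 1}" "{i. i < (3::5)} = {0, 1, 2}"
  "{i. i < (4::5)} = {0, 1, 2, 3}"
  "{i. (0::5) < i} = {1, 2, 3, 4}" "{i. (1::5) < i} = {2, 3, 4}" "{i. (2::5) < i} = {3, 4}"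
  "{i. (3::5) < i} = {4}" "{i. (4::5) < i} = {}"
proof -
  have five: "i = 0 \<or> i = 1 \<or> i = 2 \<or> i = 3 \<or> i = 4" for i :: 5 using UNIV_5 by blast
  note F = less_5 less_5[THEN order_less_not_sym]
  show "{i. i < (0::5)} = {}" "{i. i < (1::5)} = {0}" "{i. i < (2::5)} = {0, 1}" "{i. i < (3::5)} = {0, 1, 2}"
    "{i. i < (4::5)} = {0, 1, 2, 3}"
    "{i. (0::5) < i} = {1, 2, 3, 4}" "{i. (1::5) < i} = {2, 3, 4}" "{i. (2::5) < i} = {3, 4}"
    "{i. (3::5) < i} = {4}" "{i. (4::5) < i} = {}"
    by (rule set_eqI, rename_tac x, cut_tac i = x in five, use F in force)+
qed

text \<open>
  The equations \<open>B_prime test_cubic t = 0\<close> and \<open>contraction_c t = 0\<close> are sparse in the unknowns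
  \<open>u a i j\<close>, since the stabilizer of the cubic in the torus splits them into small systems. The equation
  \<open>eijkl\<close> is the coordinate at \<open>e i \<and> e j \<and> e k \<otimes> e l\<close>, and \<open>ck\<close> is the coordinate of the contraction at \<open>e k\<close>.
  In every system all unknowns are multiples of a single one (facts \<open>s\<close>), which is then shown to vanish
  (facts \<open>z\<close>).
\<close>

theorem B_prime_test_cubic_injective:
  fixes t :: "'a::field_char_0 ^ (5 set \<times> 5 set)"
  assumes t: "t \<in> Gamma_2211" and B: "B_prime test_cubic t = 0"
  shows "t = 0"
proof -
  define u where "u a i j = tcoeff t a {i, j}" for a i j
  have con: "(\<Sum>i | i < k. u i i k) - (\<Sum>j | k < j. u j k j) = 0" for k
    using t contraction_c_nth[of t k] by (simp add: Gamma_2211_def u_def)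
  have eq: "(B_tri t (axis 4 1) (axis 4 1) (axis 4 1) + B_tri t (axis 3 1) (axis 3 1) (axis 3 1) +
      B_tri t (axis 1 1) (axis 2 1) (axis 4 1) + B_tri t (axis 0 1) (axis 2 1) (axis 3 1) +
      B_tri t (axis 0 1) (axis 1 1) (axis 1 1)) $ (D, l) = 0" for D l
    using B by (simp add: test_cubic_def B_prime_add B_prime_single)
  note F = B_tri_axis_nth contraction_term_triple less_5 Let_def u_def[symmetric]
  have e0134: "- u 2 0 3 = 0"
    using eq[of "{0, 1, 3}" 4] by (simp add: F algebra_simps)
  have e0140: "- 2 * u 1 0 4 = 0"
    using eq[of "{0, 1, 4}" 0] by (simp add: F algebra_simps)
  have e0143: "u 2 1 4 = 0"
    using eq[of "{0, 1, 4}" 3] by (simp add: F algebra_simps)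
  have e0234: "- u 1 0 3 = 0"
    using eq[of "{0, 2, 3}" 4] by (simp add: F algebra_simps)
  have e0130: "- 2 * u 1 0 3 + u 2 0 1 = 0"
    using eq[of "{0, 1, 3}" 0] by (simp add: F algebra_simps)
  have e0240: "- u 3 0 4 = 0"
    using eq[of "{0, 2, 4}" 0] by (simp add: F algebra_simps)
  have e0244: "- u 1 0 4 + 6 * u 4 0 2 = 0"
    using eq[of "{0, 2, 4}" 4] by (simp add: F algebra_simps)
  have e0122: "u 3 1 2 - u 4 0 2 = 0"
    using eq[of "{0, 1, 2}" 2] by (simp add: F algebra_simps)
  have e0340: "- u 2 0 4 = 0"
    using eq[of "{0, 3, 4}" 0] by (simp add: F algebra_simps)
  have e0144: "- u 2 0 4 + 6 * u 4 0 1 = 0"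
    using eq[of "{0, 1, 4}" 4] by (simp add: F algebra_simps)
  have e0341: "2 * u 1 3 4 + u 2 0 3 = 0"
    using eq[of "{0, 3, 4}" 1] by (simp add: F algebra_simps)
  have e0343: "u 2 3 4 - 6 * u 3 0 4 = 0"
    using eq[of "{0, 3, 4}" 3] by (simp add: F algebra_simps)
  have e0344: "6 * u 4 0 3 = 0"
    using eq[of "{0, 3, 4}" 4] by (simp add: F algebra_simps)
  have e0231: "2 * u 1 2 3 - u 4 0 3 = 0"
    using eq[of "{0, 2, 3}" 1] by (simp add: F algebra_simps)
  have e1233: "- u 0 1 3 + 6 * u 3 1 2 = 0"
    using eq[of "{1, 2, 3}" 3] by (simp add: F algebra_simps)
  have e1243: "- u 0 1 4 = 0"
    using eq[of "{1, 2, 4}" 3] by (simp add: F algebra_simps)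
  have e1343: "- 6 * u 3 1 4 = 0"
    using eq[of "{1, 3, 4}" 3] by (simp add: F algebra_simps)
  have e1240: "2 * u 1 2 4 - u 3 1 4 = 0"
    using eq[of "{1, 2, 4}" 0] by (simp add: F algebra_simps)
  have e1344: "u 2 3 4 + 6 * u 4 1 3 = 0"
    using eq[of "{1, 3, 4}" 4] by (simp add: F algebra_simps)
  have e1231: "2 * u 0 2 3 - u 4 1 3 = 0"
    using eq[of "{1, 2, 3}" 1] by (simp add: F algebra_simps)
  have e2342: "- u 0 2 4 + u 1 2 3 = 0"
    using eq[of "{2, 3, 4}" 2] by (simp add: F algebra_simps)
  have e2344: "u 1 3 4 + 6 * u 4 2 3 = 0"
    using eq[of "{2, 3, 4}" 4] by (simp add: F algebra_simps)
  have e1232: "u 4 2 3 + u 0 1 2 = 0"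
    using eq[of "{1, 2, 3}" 2] by (simp add: F algebra_simps)
  have e0120: "- 2 * u 1 0 2 + u 3 0 1 = 0"
    using eq[of "{0, 1, 2}" 0] by (simp add: F algebra_simps)
  have e0133: "u 2 1 3 + 6 * u 3 0 1 = 0"
    using eq[of "{0, 1, 3}" 3] by (simp add: F algebra_simps)
  have e0242: "u 3 2 4 + u 1 0 2 = 0"
    using eq[of "{0, 2, 4}" 2] by (simp add: F algebra_simps)
  have e1341: "2 * u 0 3 4 + u 2 1 3 = 0"
    using eq[of "{1, 3, 4}" 1] by (simp add: F algebra_simps)
  have e2343: "u 0 3 4 - 6 * u 3 2 4 = 0"
    using eq[of "{2, 3, 4}" 3] by (simp add: F algebra_simps)
  have e0121: "2 * u 1 1 2 - 2 * u 0 0 2 + u 4 0 1 = 0"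
    using eq[of "{0, 1, 2}" 1] by (simp add: F algebra_simps)
  have e0232: "u 3 2 3 + u 0 0 2 = 0"
    using eq[of "{0, 2, 3}" 2] by (simp add: F algebra_simps)
  have e1242: "u 4 2 4 + u 1 1 2 = 0"
    using eq[of "{1, 2, 4}" 2] by (simp add: F algebra_simps)
  have c2: "u 0 0 2 + u 1 1 2 - u 3 2 3 - u 4 2 4 = 0"
    using con[of 2] by (simp add: less_sets_5 algebra_simps)
  have e0123: "u 2 1 2 + u 0 0 1 = 0"
    using eq[of "{0, 1, 2}" 3] by (simp add: F algebra_simps)
  have e0132: "u 3 1 3 - u 4 0 3 + u 0 0 1 = 0"
    using eq[of "{0, 1, 3}" 2] by (simp add: F algebra_simps)
  have e1241: "u 2 1 2 - u 4 1 4 + 2 * u 0 2 4 = 0"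
    using eq[of "{1, 2, 4}" 1] by (simp add: F)
  have c1: "u 0 0 1 - u 2 1 2 - u 3 1 3 - u 4 1 4 = 0"
    using con[of 1] by (simp add: less_sets_5 algebra_simps)
  have e0124: "- u 2 0 2 + u 1 0 1 = 0"
    using eq[of "{0, 1, 2}" 4] by (simp add: F algebra_simps)
  have e0142: "u 3 1 4 - u 4 0 4 + u 1 0 1 = 0"
    using eq[of "{0, 1, 4}" 2] by (simp add: F algebra_simps)
  have e0230: "- u 3 0 3 + u 2 0 2 = 0"
    using eq[of "{0, 2, 3}" 0] by (simp add: F algebra_simps)
  have c0: "- u 1 0 1 - u 2 0 2 - u 3 0 3 - u 4 0 4 = 0"
    using con[of 0] by (simp add: less_sets_5 algebra_simps)
  have e0131: "2 * u 1 1 3 - 2 * u 0 0 3 = 0"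
    using eq[of "{0, 1, 3}" 1] by (simp add: F algebra_simps)
  have e1234: "u 2 2 3 - u 1 1 3 = 0"
    using eq[of "{1, 2, 3}" 4] by (simp add: F algebra_simps)
  have e0233: "u 2 2 3 - u 0 0 3 + 6 * u 3 0 2 = 0"
    using eq[of "{0, 2, 3}" 3] by (simp add: F algebra_simps)
  have e1342: "u 4 3 4 - u 0 1 4 + u 1 1 3 = 0"
    using eq[of "{1, 3, 4}" 2] by (simp add: F algebra_simps)
  have c3: "u 0 0 3 + u 1 1 3 + u 2 2 3 - u 4 3 4 = 0"
    using con[of 3] by (simp add: less_sets_5 algebra_simps)
  have e0141: "2 * u 1 1 4 - 2 * u 0 0 4 + u 2 0 1 = 0"
    using eq[of "{0, 1, 4}" 1] by (simp add: F algebra_simps)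
  have e0243: "u 2 2 4 - u 0 0 4 = 0"
    using eq[of "{0, 2, 4}" 3] by (simp add: F algebra_simps)
  have e0342: "u 3 3 4 - u 0 0 4 + u 1 0 3 = 0"
    using eq[of "{0, 3, 4}" 2] by (simp add: F algebra_simps)
  have e1244: "u 2 2 4 - u 1 1 4 + 6 * u 4 1 2 = 0"
    using eq[of "{1, 2, 4}" 4] by (simp add: F algebra_simps)
  have c4: "u 0 0 4 + u 1 1 4 + u 2 2 4 + u 3 3 4 = 0"
    using con[of 4] by (simp add: less_sets_5 algebra_simps)
  have s22: "u 2 0 3 = 0" using e0134 by simp
  have s13: "u 1 0 4 = 0" using e0140 by simp
  have s26: "u 2 1 4 = 0" using e0143 by simp
  have s12: "u 1 0 3 = 0" using e0234 by simp
  have s20: "u 2 0 1 = 0" using e0130 s12 by algebra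
  have s33: "u 3 0 4 = 0" using e0240 by simp
  have s41: "u 4 0 2 = 0" using e0244 s13 by algebra
  have s34: "u 3 1 2 = 0" using e0122 s41 by algebra
  have s23: "u 2 0 4 = 0" using e0340 by simp
  have s40: "u 4 0 1 = 0" using e0144 s23 by algebra
  have s19: "u 1 3 4 = 0" using e0341 s22 by algebra
  have s29: "u 2 3 4 = 0" using e0343 s33 by algebra
  have s42: "u 4 0 3 = 0" using e0344 by simp
  have s17: "u 1 2 3 = 0" using e0231 s42 by algebra
  have s5: "u 0 1 3 = 0" using e1233 s34 by algebra
  have s6: "u 0 1 4 = 0" using e1243 by simp
  have s36: "u 3 1 4 = 0" using e1343 by simp
  have s18: "u 1 2 4 = 0" using e1240 s36 by algebra
  have s45: "u 4 1 3 = 0" using e1344 s29 by algebra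
  have s7: "u 0 2 3 = 0" using e1231 s45 by algebra
  have s8: "u 0 2 4 = 0" using e2342 s17 by algebra
  have s47: "u 4 2 3 = 0" using e2344 s19 by algebra
  have s4: "u 0 1 2 = 0" using e1232 s47 by algebra
  have s30: "u 3 0 1 = 2 * u 1 0 2" using e0120 by algebra
  have s25: "u 2 1 3 = - 12 * u 1 0 2" using e0133 s30 by algebra
  have s38: "u 3 2 4 = - u 1 0 2" using e0242 by algebra
  have s9: "u 0 3 4 = 6 * u 1 0 2" using e1341 s25 by algebra
  have z11: "u 1 0 2 = 0" using e2343 s9 s38 by algebra
  have s1: "u 0 0 2 = u 1 1 2" using e0121 s40 by algebra
  have s37: "u 3 2 3 = - u 1 1 2" using e0232 s1 by algebra
  have s48: "u 4 2 4 = - u 1 1 2" using e1242 by algebra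
  have z14: "u 1 1 2 = 0" using c2 s1 s37 s48 by algebra
  have s0: "u 0 0 1 = - u 2 1 2" using e0123 by algebra
  have s35: "u 3 1 3 = u 2 1 2" using e0132 s42 s0 by algebra
  have s46: "u 4 1 4 = u 2 1 2" using e1241 s8 by algebra
  have z24: "u 2 1 2 = 0" using c1 s0 s35 s46 by algebra
  have s10: "u 1 0 1 = u 2 0 2" using e0124 by algebra
  have s43: "u 4 0 4 = u 2 0 2" using e0142 s36 s10 by algebra
  have s32: "u 3 0 3 = u 2 0 2" using e0230 by algebra
  have z21: "u 2 0 2 = 0" using c0 s10 s32 s43 by algebra
  have s2: "u 0 0 3 = u 1 1 3" using e0131 by algebra
  have s27: "u 2 2 3 = u 1 1 3" using e1234 by algebra
  have s31: "u 3 0 2 = 0" using e0233 s27 s2 by algebra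
  have s49: "u 4 3 4 = - u 1 1 3" using e1342 s6 by algebra
  have z15: "u 1 1 3 = 0" using c3 s2 s27 s49 by algebra
  have s3: "u 0 0 4 = u 1 1 4" using e0141 s20 by algebra
  have s28: "u 2 2 4 = u 1 1 4" using e0243 s3 by algebra
  have s39: "u 3 3 4 = u 1 1 4" using e0342 s3 s12 by algebra
  have s44: "u 4 1 2 = 0" using e1244 s28 by algebra
  have z16: "u 1 1 4 = 0" using c4 s3 s28 s39 by algebra
  have five: "i \<in> {0, 1, 2, 3, 4}" for i :: 5 using UNIV_5 by blast
  have "\<forall>a\<in>{0, 1, 2, 3, 4}. \<forall>i\<in>{0, 1, 2, 3, 4}. \<forall>j\<in>{0, 1, 2, 3, 4}. i < j \<longrightarrow> u a i j = 0"
    by (simp add: less_5 less_5[THEN order_less_not_sym]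
      s22 s13 s26 s12 s20 s33 s41 s34 s23 s40 s19 s29 s42 s17 s5 s6 s36 s18 s45 s7 s8 s47 s4 s30 s25 s38 s9 z11 s1 s37 s48 z14 s0 s35 s46 z24 s10 s43 s32 z21 s2 s27 s31 s49 z15 s3 s28 s39 s44 z16)
  then have u0: "u a i j = 0" if "i < j" for a i j
    using that five by blast
  have "t $ (A, C) = 0" for A C
  proof (rule ccontr)
    assume nz: "t $ (A, C) \<noteq> 0"
    then have card: "card A = 4" "card C = 2" using t by (auto simp: Gamma_2211_def)
    have "card (- A) = 1" using card by (simp add: Compl_eq_Diff_UNIV card_Diff_subset)
    then obtain a where "- A = {a}" by (auto simp: card_1_singleton_iff)
    then have A: "A = - {a}" by blast
    obtain i j where "C = {i, j}" "i \<noteq> j" using card by (auto simp: card_2_iff)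
    then obtain i j where C: "C = {i, j}" "i < j" by (metis insert_commute linorder_neqE)
    have "shuffle_sign (- {a}) {a} * t $ (- {a}, {i, j}) = 0"
      using u0[OF C(2), of a] by (simp add: u_def tcoeff_def)
    then show False using nz by (simp add: A C shuffle_sign_def)
  qed
  then show "t = 0" by (simp add: vec_eq_iff split_paired_all)
qed

section \<open>The rank of the contraction operator at a sum of cubes\<close>

text \<open>
  The first factor of \<open>t\<close> is contracted with \<open>u\<close>. Then \<open>B'\<close> at \<open>u\<^sup>3\<close> maps \<open>t\<close> to
  \<open>6 (zeta t u \<and> u) \<otimes> u\<close>, as \<open>B_tri_cube\<close> shows.
\<close>

definition zeta :: "'a::comm_ring_1 ^ (5 set \<times> 5 set) \<Rightarrow> 'a ^ 5 \<Rightarrow> 'a ^ 5 set" where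
  "zeta t u = (\<chi> C. \<Sum>A\<in>UNIV. t $ (A, C) * vol (axis A 1 \<and>\<^sub>e ext_vec u))"

lemma wedge_expansion:
  "x \<and>\<^sub>e y = (\<Sum>C\<in>UNIV. x $ C *s (axis C 1 \<and>\<^sub>e y))"
  by (rule linear_expansion[of "\<lambda>x. x \<and>\<^sub>e y"]) (rule multilinear)+

lemma B_tri_cube: "B_tri t u u u $ (D, l) = 6 * ((zeta t u \<and>\<^sub>e ext_vec u) $ D * u $ l)"
proof -
  have "B_tri t u u u $ (D, l) =
      6 * (\<Sum>p\<in>UNIV. t $ p * (vol (axis (fst p) 1 \<and>\<^sub>e ext_vec u) * ((axis (snd p) 1 \<and>\<^sub>e ext_vec u) $ D * u $ l)))"
    by (simp add: B_tri_def B_product_expand eval_nat_numeral Let_def tensor_def sum.distrib distrib_left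
        sum_distrib_left mult.assoc mult.left_commute)
  also have "(\<Sum>p\<in>UNIV. t $ p * (vol (axis (fst p) 1 \<and>\<^sub>e ext_vec u) * ((axis (snd p) 1 \<and>\<^sub>e ext_vec u) $ D * u $ l))) =
      (\<Sum>C\<in>UNIV. \<Sum>A\<in>UNIV. t $ (A, C) * vol (axis A 1 \<and>\<^sub>e ext_vec u) * (axis C 1 \<and>\<^sub>e ext_vec u) $ D * u $ l)"
    unfolding sum_UNIV_prod by (subst sum.swap) (simp add: mult.assoc)
  also have "\<dots> = (zeta t u \<and>\<^sub>e ext_vec u) $ D * u $ l"
    by (subst wedge_expansion) (simp add: zeta_def sum_distrib_right)
  finally show ?thesis .
qed

lemma B_prime_cube: "B_prime (linear_form u ^ 3) t = B_tri t u u u"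
  using B_prime_product[of "\<lambda>_. u" t] by (simp add: B_product_B_tri power3_eq_cube)

text \<open>
  Exchanging the two factors \<open>u\<close> changes the sign, and \<open>2\<close> is invertible.
\<close>

lemma wedge_wedge_self:
  fixes u :: "'a::field_char_0 ^ 5"
  shows "ext_vec u \<and>\<^sub>e (x \<and>\<^sub>e ext_vec u) = 0"
proof -
  have 0: "ext_vec u \<and>\<^sub>e (axis C 1 \<and>\<^sub>e ext_vec u) = 0" for C
  proof -
    have "2 * (ext_vec u \<and>\<^sub>e (axis C 1 \<and>\<^sub>e ext_vec u)) $ S = 0" for S
      using wedge_antisymmetric[of u C u] by (metis add.inverse_inverse add.right_inverse mult_2 vector_uminus_component)
    then show ?thesis by (simp add: vec_eq_iff)
  qed
  have "ext_vec u \<and>\<^sub>e (x \<and>\<^sub>e ext_vec u) = (\<Sum>C\<in>UNIV. x $ C *s (ext_vec u \<and>\<^sub>e (axis C 1 \<and>\<^sub>e ext_vec u)))"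
    by (rule linear_expansion[of "\<lambda>x. ext_vec u \<and>\<^sub>e (x \<and>\<^sub>e ext_vec u)"]) (simp_all only: multilinear)
  then show ?thesis by (simp add: 0)
qed

text \<open>
  Let \<open>y = x \<and> u\<close>, so that \<open>u \<and> y = 0\<close>. If \<open>i \<notin> D\<close>, the coefficient of \<open>u \<and> y\<close> at \<open>insert i D\<close> is a sum
  over the ways to remove one element. Removing any element but \<open>i\<close> leaves a set that contains \<open>i\<close>, where
  \<open>y\<close> vanishes by hypothesis; what remains is \<open>u $ i * y $ D\<close> up to sign.
\<close>

lemma wedge_ext_vec_eq_0:
  fixes u :: "'a::field_char_0 ^ 5"
  assumes x: "\<And>C. x $ C \<noteq> 0 \<Longrightarrow> card C = 2" and u: "u $ i \<noteq> 0"
    and D: "\<And>D. i \<in> D \<Longrightarrow> card D = 3 \<Longrightarrow> (x \<and>\<^sub>e ext_vec u) $ D = 0"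
  shows "x \<and>\<^sub>e ext_vec u = 0"
proof -
  define y where "y = x \<and>\<^sub>e ext_vec u"
  have supp: "y $ D = 0" if "card D \<noteq> 3" for D
  proof -
    have 0: "x $ C * (axis C 1 \<and>\<^sub>e ext_vec u) $ D = 0" for C
      using x[of C] wedge_axis_ext_vec_support[of C u D] that by fastforce
    show ?thesis unfolding y_def
      by (subst wedge_expansion) (simp only: sum_component vector_smult_component 0 sum.neutral_const)
  qed
  have "y $ D = 0" for D
  proof (cases "i \<in> D \<or> card D \<noteq> 3")
    case True
    then show ?thesis using D supp by (auto simp: y_def)
  next
    case False
    define S where "S = insert i D"
    have zero: "shuffle_sign A (S - A) * ext_vec u $ A * y $ (S - A) = 0" if A: "A \<in> Pow S - {{i}}" for A
    proof (cases "ext_vec u $ A = 0")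
      case False
      then obtain j where j: "A = {j}" by (auto simp: ext_vec_nth split: if_splits)
      then have "i \<in> S - A" using A by (auto simp: S_def)
      then have "y $ (S - A) = 0" using D[of "S - A"] supp[of "S - A"] by (auto simp: y_def)
      then show ?thesis by simp
    qed simp
    have "0 = (ext_vec u \<and>\<^sub>e y) $ S" by (simp add: y_def wedge_wedge_self)
    also have "\<dots> = (\<Sum>A\<in>{{i}}. shuffle_sign A (S - A) * ext_vec u $ A * y $ (S - A))"
      unfolding wedge_def vec_lambda_beta
      by (rule sum.mono_neutral_right) (use zero in \<open>auto simp: S_def\<close>)
    also have "\<dots> = shuffle_sign {i} (S - {i}) * u $ i * y $ D"
      using False by (simp add: S_def)
    finally show ?thesis using u by (simp add: shuffle_sign_def)
  qed
  then show ?thesis by (simp add: y_def vec_eq_iff)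
qed

lemma card_triples_containing: "card {D :: 5 set. i \<in> D \<and> card D = 3} = 6"
proof -
  have "bij_betw (insert i) {B. B \<subseteq> - {i} \<and> card B = 2} {D. i \<in> D \<and> card D = 3}"
    by (rule bij_betw_byWitness[of _ "\<lambda>D. D - {i}"]) (auto simp: card_insert_if)
  then have "card {D. i \<in> D \<and> card D = 3} = card {B. B \<subseteq> - {i} \<and> card B = 2}"
    by (rule bij_betw_same_card[symmetric])
  also have "\<dots> = card (- {i}) choose 2" by (rule n_subsets) simp
  also have "card (- {i}) = 4" by (simp add: Compl_eq_Diff_UNIV card_Diff_subset)
  finally show ?thesis by (simp add: choose_two)
qed

text \<open>
  By \<open>wedge_ext_vec_eq_0\<close>, the image of \<open>t\<close> under the operator at the \<open>k\<close>-th cube vanishes as soon as the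
  six coefficients of \<open>zeta t (u k) \<and> u k\<close> at the triples containing \<open>i k\<close> vanish. So every cube
  imposes six linear conditions.
\<close>

theorem B_prime_sum_of_cubes_rank:
  fixes u :: "nat \<Rightarrow> 'a::field_char_0 ^ 5"
  obtains L and f :: "nat \<times> 5 set \<Rightarrow> 'a ^ (5 set \<times> 5 set) \<Rightarrow> 'a"
  where "finite L" "card L = 6 * n"
    and "\<And>l s t. f l (s + t) = f l s + f l t" "\<And>l c t. f l (c *s t) = c * f l t"
    and "\<And>t. t \<in> Gamma_2211 \<Longrightarrow> (\<And>l. l \<in> L \<Longrightarrow> f l t = 0) \<Longrightarrow>
      B_prime (\<Sum>k<n. linear_form (u k) ^ 3) t = 0"
proof -
  \<comment> \<open>An arbitrary index if \<open>u k = 0\<close>; then the \<open>k\<close>-th cube contributes nothing.\<close>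
  define i where "i k = (SOME i. u k $ i \<noteq> 0)" for k
  define L where "L = (SIGMA k:{..<n}. {D. i k \<in> D \<and> card D = 3})"
  define f where "f l t = (zeta t (u (fst l)) \<and>\<^sub>e ext_vec (u (fst l))) $ snd l" for l and t :: "'a ^ (5 set \<times> 5 set)"
  have z: "zeta (s + t) v = zeta s v + zeta t v" "zeta (c *s t) v = c *s zeta t v"
    for s t :: "'a ^ (5 set \<times> 5 set)" and c v
    by (simp_all add: zeta_def vec_eq_iff sum.distrib distrib_right sum_distrib_left mult.assoc)
  show thesis
  proof (rule that[of L f])
    show "finite L" unfolding L_def by auto
    show "card L = 6 * n" unfolding L_def by (subst card_SigmaI) (auto simp: card_triples_containing)
    show "f l (s + t) = f l s + f l t" "f l (c *s t) = c * f l t" for l c s t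
      by (simp_all add: f_def z multilinear)
    fix t :: "'a ^ (5 set \<times> 5 set)"
    assume t: "t \<in> Gamma_2211" and L: "\<And>l. l \<in> L \<Longrightarrow> f l t = 0"
    have "B_prime (linear_form (u k) ^ 3) t = 0" if k: "k < n" for k
    proof (cases "u k = 0")
      case True
      then have "linear_form (u k) = 0" by (simp add: linear_form_def)
      then show ?thesis by (simp add: B_prime_def vec_eq_iff case_prod_beta)
    next
      case False
      then have "\<exists>i. u k $ i \<noteq> 0" by (simp add: vec_eq_iff)
      then have "u k $ i k \<noteq> 0" unfolding i_def by (rule someI_ex)
      moreover have "card C = 2" if C: "zeta t (u k) $ C \<noteq> 0" for C
      proof -
        obtain A where "t $ (A, C) * vol (axis A 1 \<and>\<^sub>e ext_vec (u k)) \<noteq> 0"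
          using C sum.neutral[of UNIV "\<lambda>A. t $ (A, C) * vol (axis A 1 \<and>\<^sub>e ext_vec (u k))"]
          by (auto simp: zeta_def)
        then show ?thesis using t by (auto simp: Gamma_2211_def)
      qed
      moreover have "(zeta t (u k) \<and>\<^sub>e ext_vec (u k)) $ D = 0" if "i k \<in> D" "card D = 3" for D
        using L[of "(k, D)"] k that by (simp add: L_def f_def)
      ultimately have "zeta t (u k) \<and>\<^sub>e ext_vec (u k) = 0" by (intro wedge_ext_vec_eq_0)
      then show ?thesis by (simp add: B_prime_cube vec_eq_iff split_paired_all B_tri_cube)
    qed
    then show "B_prime (\<Sum>k<n. linear_form (u k) ^ 3) t = 0" by (simp add: B_prime_sum)
  qed
qed

section \<open>Coordinates on the space of cubics\<close>

text \<open>
  Any linear order on the index type makes the ring of polynomials a domain, through the leading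
  monomials; the one of the exponent vectors is at hand.
\<close>

instantiation cubic_monomial :: linorder
begin

definition less_eq_cubic_monomial :: "cubic_monomial \<Rightarrow> cubic_monomial \<Rightarrow> bool" where
  "less_eq_cubic_monomial a b \<longleftrightarrow> Rep_cubic_monomial a \<le> Rep_cubic_monomial b"

definition less_cubic_monomial :: "cubic_monomial \<Rightarrow> cubic_monomial \<Rightarrow> bool" where
  "less_cubic_monomial a b \<longleftrightarrow> Rep_cubic_monomial a < Rep_cubic_monomial b"

instance
proof
  fix a b c :: cubic_monomial
  note defs = less_eq_cubic_monomial_def less_cubic_monomial_def
  show "a < b \<longleftrightarrow> a \<le> b \<and> \<not> b \<le> a" unfolding defs by (rule less_le_not_le)
  show "a \<le> a" unfolding defs by (rule order_refl)
  show "a \<le> b \<Longrightarrow> b \<le> c \<Longrightarrow> a \<le> c" unfolding defs by (rule order_trans)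
  show "a \<le> b \<Longrightarrow> b \<le> a \<Longrightarrow> a = b"
    unfolding defs by (metis Rep_cubic_monomial_inject order_antisym)
  show "a \<le> b \<or> b \<le> a" unfolding defs by (rule linear)
qed

end

lemma monomial_degree_UNIV: "monomial_degree m = (\<Sum>i\<in>UNIV. Poly_Mapping.lookup m i)" for m :: "'i::finite \<Rightarrow>\<^sub>0 nat"
  unfolding monomial_degree_def by (rule sum.mono_neutral_left) (auto simp: in_keys_iff)

lemma monomial_degree_single: "monomial_degree (Poly_Mapping.single i n) = n"
  by (cases "n = 0") (simp_all add: monomial_degree_def)

lemma monomial_degree_add: "monomial_degree (a + b) = monomial_degree a + monomial_degree b" for a b :: "'i::finite \<Rightarrow>\<^sub>0 nat"
  by (simp add: monomial_degree_UNIV lookup_add sum.distrib)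

lemma monomial_degree_Suc:
  fixes m :: "'i::finite \<Rightarrow>\<^sub>0 nat"
  assumes "monomial_degree m = Suc n"
  obtains i m' where "m = Poly_Mapping.single i 1 + m'" "monomial_degree m' = n"
proof -
  have "m \<noteq> 0" using assms by (auto simp: monomial_degree_def)
  then obtain i where i: "Poly_Mapping.lookup m i \<noteq> 0" by (metis lookup_zero poly_mapping_eqI)
  define m' where "m' = m - Poly_Mapping.single i 1"
  have "m = Poly_Mapping.single i 1 + m'"
    using i by (intro poly_mapping_eqI) (auto simp: m'_def lookup_add lookup_minus lookup_single when_def)
  moreover from this have "monomial_degree m' = n"
    using assms monomial_degree_add[of "Poly_Mapping.single i 1" m'] by (simp add: monomial_degree_single)
  ultimately show thesis using that by blast
qed

lemma monomial_degree_eq_0: "monomial_degree m = 0 \<Longrightarrow> m = 0"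
  by (rule poly_mapping_eqI) (auto simp: monomial_degree_def in_keys_iff)

lemma cubic_monomial_of_degree: "monomial_degree (cubic_monomial_of i j k) = 3"
  by (simp add: cubic_monomial_of_def monomial_degree_add monomial_degree_single)

lemma cubic_monomial_of_surj:
  assumes "monomial_degree m = 3"
  obtains i j k where "m = cubic_monomial_of i j k"
proof -
  obtain i m1 where 1: "m = Poly_Mapping.single i 1 + m1" "monomial_degree m1 = 2"
    using monomial_degree_Suc[of m 2] assms by auto
  obtain j m2 where 2: "m1 = Poly_Mapping.single j 1 + m2" "monomial_degree m2 = 1"
    using monomial_degree_Suc[of m1 1] 1 by auto
  obtain k m3 where 3: "m2 = Poly_Mapping.single k 1 + m3" "monomial_degree m3 = 0"
    using monomial_degree_Suc[of m2 0] 2 by auto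
  have "m3 = 0" using 3 monomial_degree_eq_0 by blast
  then have "m = cubic_monomial_of i j k" using 1 2 3 by (simp add: cubic_monomial_of_def add.assoc)
  then show thesis using that by blast
qed

definition cmon :: "5 \<Rightarrow> 5 \<Rightarrow> 5 \<Rightarrow> cubic_monomial" where
  "cmon i j k = Abs_cubic_monomial (cubic_monomial_of i j k)"

lemma Rep_cmon: "Rep_cubic_monomial (cmon i j k) = cubic_monomial_of i j k"
  by (simp add: cmon_def Abs_cubic_monomial_inverse cubic_monomial_of_degree)

lemma cmon_surj: obtains i j k where "m = cmon i j k"
  using Rep_cubic_monomial[of m] cubic_monomial_of_surj[of "Rep_cubic_monomial m"]
  by (metis Rep_cubic_monomial_inverse cmon_def mem_Collect_eq)

instance cubic_monomial :: finite
proof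
  have "(UNIV :: cubic_monomial set) \<subseteq> (\<lambda>(i, j, k). cmon i j k) ` UNIV"
    by (auto simp: image_iff) (metis cmon_surj)
  then show "finite (UNIV :: cubic_monomial set)" by (rule finite_subset) simp
qed

definition cubic_coords :: "(5, 'a::zero) mpolynomial \<Rightarrow> cubic_monomial \<Rightarrow> 'a" where
  "cubic_coords \<phi> m = Poly_Mapping.lookup \<phi> (Rep_cubic_monomial m)"

definition cubic_of :: "(cubic_monomial \<Rightarrow> 'a::comm_monoid_add) \<Rightarrow> (5, 'a) mpolynomial" where
  "cubic_of y = (\<Sum>m\<in>UNIV. Poly_Mapping.single (Rep_cubic_monomial m) (y m))"

lemma eval_cubic_eq: "eval_cubic P \<phi> = peval (cubic_coords \<phi>) P"
  by (simp add: eval_cubic_def cubic_coords_def[abs_def])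

lemma cubic_coords_of [simp]: "cubic_coords (cubic_of y) = y"
proof
  fix m
  have "cubic_coords (cubic_of y) m = (\<Sum>m'\<in>UNIV. if m' = m then y m' else 0)"
    unfolding cubic_coords_def cubic_of_def lookup_sum
    by (intro sum.cong refl) (auto simp: lookup_single when_def Rep_cubic_monomial_inject)
  then show "cubic_coords (cubic_of y) m = y m" by simp
qed

lemma cubic_of_in: "cubic_of y \<in> cubics"
proof -
  have "monomial_degree m = 3" if "m \<in> Poly_Mapping.keys (cubic_of y)" for m
  proof -
    obtain m' where "m \<in> Poly_Mapping.keys (Poly_Mapping.single (Rep_cubic_monomial m') (y m'))"
      using \<open>m \<in> _\<close> keys_sum[of "\<lambda>m'. Poly_Mapping.single (Rep_cubic_monomial m') (y m')" UNIV]
      unfolding cubic_of_def by blast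
    then have "m = Rep_cubic_monomial m'" by (auto split: if_splits)
    then show ?thesis using Rep_cubic_monomial[of m'] by simp
  qed
  then show ?thesis by (simp add: cubics_def homogeneous_def)
qed

lemma cubic_of_coords: "\<phi> \<in> cubics \<Longrightarrow> cubic_of (cubic_coords \<phi>) = \<phi>"
proof (rule poly_mapping_eqI)
  fix m assume \<phi>: "\<phi> \<in> cubics"
  show "Poly_Mapping.lookup (cubic_of (cubic_coords \<phi>)) m = Poly_Mapping.lookup \<phi> m"
  proof (cases "monomial_degree m = 3")
    case True
    then have "Poly_Mapping.lookup \<psi> m = cubic_coords \<psi> (Abs_cubic_monomial m)" for \<psi> :: "(5, 'a) mpolynomial"
      by (simp add: cubic_coords_def Abs_cubic_monomial_inverse)
    then show ?thesis by simp
  next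
    case False
    then have "Poly_Mapping.lookup \<psi> m = 0" if "\<psi> \<in> cubics" for \<psi> :: "(5, 'a) mpolynomial"
      using that by (auto simp: cubics_def homogeneous_def in_keys_iff)
    then show ?thesis using \<phi> cubic_of_in by metis
  qed
qed

lemma cubic_coords_add: "cubic_coords (\<phi> + \<psi>) m = cubic_coords \<phi> m + cubic_coords \<psi> m"
  by (simp add: cubic_coords_def lookup_add)

lemma cubic_coords_sum: "cubic_coords (\<Sum>x\<in>X. f x) m = (\<Sum>x\<in>X. cubic_coords (f x) m)"
  by (simp add: cubic_coords_def lookup_sum)

lemma lookup_const_mult: "Poly_Mapping.lookup (const c * p) m = c * Poly_Mapping.lookup p m"
  for p :: "('i, 'a::comm_ring_1) mpolynomial"
proof -
  have "Poly_Mapping.lookup (const c * p) m =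
      (\<Sum>\<mu>\<in>Poly_Mapping.keys p. if \<mu> = m then c * Poly_Mapping.lookup p \<mu> else 0)"
    by (subst sum_monomials[of p])
      (simp add: sum_distrib_left mult_single lookup_sum lookup_single when_def eq_commute)
  then show ?thesis by (simp add: in_keys_iff)
qed

lemma cubic_coords_scale: "cubic_coords (const c * \<phi>) m = c * cubic_coords \<phi> m"
  for \<phi> :: "(5, 'a::comm_ring_1) mpolynomial"
  by (simp add: cubic_coords_def lookup_const_mult)

definition cubes :: "(nat \<Rightarrow> 'a::comm_ring_1 ^ 5) \<Rightarrow> (5, 'a) mpolynomial" where
  "cubes u = (\<Sum>k<7. linear_form (u k) ^ 3)"

lemma linear_form_product:
  "linear_form x * linear_form y * linear_form z = (\<Sum>i\<in>UNIV. \<Sum>j\<in>UNIV. \<Sum>k\<in>UNIV.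
     Poly_Mapping.single (cubic_monomial_of i j k) (x $ i * y $ j * z $ k :: 'a::comm_ring_1))"
  unfolding linear_form_def mult.assoc
  unfolding sum_distrib_right
  unfolding sum_distrib_left
  by (simp add: cubic_monomial_of_def mult_single ac_simps)

lemma cubic_coords_product:
  "cubic_coords (linear_form x * linear_form y * linear_form z) m = (\<Sum>i\<in>UNIV. \<Sum>j\<in>UNIV. \<Sum>k\<in>UNIV.
     if cmon i j k = m then x $ i * y $ j * z $ k else 0 :: 'a::comm_ring_1)"
proof -
  have "cubic_monomial_of i j k = Rep_cubic_monomial m \<longleftrightarrow> cmon i j k = m" for i j k
    by (metis Rep_cmon Rep_cubic_monomial_inject)
  then show ?thesis
    by (simp add: linear_form_product cubic_coords_def lookup_sum lookup_single when_def)
qed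

lemma cubics_sum: "(\<And>x. x \<in> X \<Longrightarrow> f x \<in> cubics) \<Longrightarrow> sum f X \<in> (cubics :: (5, 'a::comm_ring_1) mpolynomial set)"
  using keys_sum[of f X] by (fastforce simp: cubics_def homogeneous_def)

lemma linear_form_products_in_cubics:
  "linear_form x * linear_form y * linear_form z \<in> (cubics :: (5, 'a::comm_ring_1) mpolynomial set)"
  unfolding linear_form_product
  by (intro cubics_sum) (auto simp: cubics_def homogeneous_def cubic_monomial_of_degree)

lemma cubes_in_cubics: "cubes u \<in> cubics"
  unfolding cubes_def power3_eq_cube by (intro cubics_sum linear_form_products_in_cubics)

lemma linear_form_add: "linear_form (x + y) = linear_form x + linear_form y"
  by (simp add: linear_form_def single_add sum.distrib)

lemma linear_form_scale: "linear_form (c *s x) = const c * linear_form x" for x :: "'a::comm_ring_1 ^ 5"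
  by (simp add: linear_form_def sum_distrib_left mult_single)

lemma linear_form_0: "linear_form 0 = 0"
  by (simp add: linear_form_def)

lemma linear_form_axis: "linear_form (axis i 1) = mvar i"
proof -
  have "linear_form (axis i 1) = (\<Sum>j\<in>UNIV. if j = i then mvar i else 0)"
    unfolding linear_form_def by (intro sum.cong refl) (auto simp: axis_def mvar_def)
  then show ?thesis by simp
qed

section \<open>The tangent space of the secant variety\<close>

text \<open>
  Seven points of which any five are linearly independent. The coordinates of the last one are chosen to keep
  the coefficients in \<open>squarefree_cubic_identities\<close> small.
\<close>

definition secant_point :: "nat \<Rightarrow> 'a::comm_ring_1 ^ 5" where
  "secant_point k = (if k < 5 then axis (of_nat k) 1 else if k = 5 then 1
     else (\<chi> i. if i = 0 then 3 else if i = 1 then - 3 else if i = 2 then - 1 else if i = 3 then 2 else 1))"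

text \<open>
  Up to a factor \<open>3\<close>, the first summand is the derivative of \<open>cubes\<close> at \<open>secant_point\<close> in the
  direction \<open>w\<close>. The second one spans a complement to the tangent space.
\<close>

definition tangent_space :: "(5, 'a::comm_ring_1) mpolynomial set" where
  "tangent_space = {(\<Sum>k<7. (linear_form (secant_point k))\<^sup>2 * linear_form (w k)) +
     Poly_Mapping.single (cubic_monomial_of 0 1 2) s |w s. True}"

lemma tangent_spaceI:
  "(\<Sum>k<7. (linear_form (secant_point k))\<^sup>2 * linear_form (w k)) +
     Poly_Mapping.single (cubic_monomial_of 0 1 2) s \<in> tangent_space"
  unfolding tangent_space_def by blast

lemma tangent_space_add:
  assumes "p \<in> tangent_space" "q \<in> tangent_space"
  shows "p + q \<in> tangent_space"
proof -
  obtain w s w' s' where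
    "p = (\<Sum>k<7. (linear_form (secant_point k))\<^sup>2 * linear_form (w k)) + Poly_Mapping.single (cubic_monomial_of 0 1 2) s"
    "q = (\<Sum>k<7. (linear_form (secant_point k))\<^sup>2 * linear_form (w' k)) + Poly_Mapping.single (cubic_monomial_of 0 1 2) s'"
    using assms unfolding tangent_space_def by blast
  then have "p + q = (\<Sum>k<7. (linear_form (secant_point k))\<^sup>2 * linear_form (w k + w' k)) +
      Poly_Mapping.single (cubic_monomial_of 0 1 2) (s + s')"
    by (simp add: linear_form_add distrib_left sum.distrib single_add algebra_simps)
  then show ?thesis using tangent_spaceI[of "\<lambda>k. w k + w' k" "s + s'"] by simp
qed

lemma tangent_space_scale:
  assumes "p \<in> tangent_space"
  shows "const c * p \<in> tangent_space"
proof -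
  obtain w s where
    "p = (\<Sum>k<7. (linear_form (secant_point k))\<^sup>2 * linear_form (w k)) + Poly_Mapping.single (cubic_monomial_of 0 1 2) s"
    using assms unfolding tangent_space_def by blast
  then have "const c * p = (\<Sum>k<7. (linear_form (secant_point k))\<^sup>2 * linear_form (c *s w k)) +
      Poly_Mapping.single (cubic_monomial_of 0 1 2) (c * s)"
    by (simp add: linear_form_scale distrib_left sum_distrib_left mult_single mult.left_commute)
  then show ?thesis using tangent_spaceI[of "\<lambda>k. c *s w k" "c * s"] by simp
qed

lemma tangent_space_uminus: "p \<in> tangent_space \<Longrightarrow> - p \<in> tangent_space"
proof -
  have "const (- 1) * p = - p" for p :: "(5, 'a) mpolynomial"
    by (rule poly_mapping_eqI) (simp add: lookup_const_mult)
  then show "p \<in> tangent_space \<Longrightarrow> - p \<in> tangent_space" using tangent_space_scale[of p "- 1"] by simp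
qed

lemma tangent_space_diff: "p \<in> tangent_space \<Longrightarrow> q \<in> tangent_space \<Longrightarrow> p - q \<in> tangent_space"
  using tangent_space_add[of p "- q"] tangent_space_uminus[of q] by simp

lemma numeral_mpoly: "numeral n = (const (numeral n) :: ('i, 'a::comm_ring_1) mpolynomial)"
  by (simp add: single_numeral)

lemma tangent_space_numeral: "p \<in> tangent_space \<Longrightarrow> numeral n * p \<in> tangent_space"
  unfolding numeral_mpoly by (rule tangent_space_scale)

lemma tangent_space_square:
  assumes "k < 7"
  shows "(linear_form (secant_point k))\<^sup>2 * linear_form v \<in> tangent_space"
proof -
  have "(\<Sum>j<7. (linear_form (secant_point j))\<^sup>2 * linear_form (if j = k then v else 0)) =
      (\<Sum>j<7. if j = k then (linear_form (secant_point k))\<^sup>2 * linear_form v else 0)"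
    by (intro sum.cong refl) (auto simp: linear_form_0)
  then have "(linear_form (secant_point k))\<^sup>2 * linear_form v =
      (\<Sum>j<7. (linear_form (secant_point j))\<^sup>2 * linear_form (if j = k then v else 0)) +
      Poly_Mapping.single (cubic_monomial_of 0 1 2) 0"
    using assms by simp
  then show ?thesis using tangent_spaceI[of "\<lambda>j. if j = k then v else 0" 0] by simp
qed

text \<open>
  Modulo the multiples of the squares \<open>x\<^sub>i\<^sup>2\<close>, the multiples of the squares of the last two
  linear forms and \<open>x0 * x1 * x2\<close> span the ten squarefree monomials. The coefficients solve this linear
  system; the multiples of \<open>x\<^sub>i\<^sup>2\<close> balance the monomials that are not squarefree.
\<close>

lemma squarefree_cubic_identities:
  fixes x0 x1 x2 x3 x4 :: "'r::comm_ring_1"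
  shows
    "16 * (x0 * x1 * x3) = (x0 + x1 + x2 + x3 + x4)\<^sup>2 * (2 * x0 - 4 * x1 - 2 * x2 + x3 + 2 * x4) + (3 * x0 - 3 * x1 - x2 + 2 * x3 + x4)\<^sup>2 * (- x0 - x1 - x2 - x3) - 10 * (x0 * x1 * x2)
      - x0\<^sup>2 * (- 7 * x0 + 9 * x1 - x2 - 16 * x3)
      - x1\<^sup>2 * (3 * x0 - 13 * x1 - 25 * x2 - 4 * x3)
      - x2\<^sup>2 * (3 * x0 - 15 * x1 - 3 * x2)
      - x3\<^sup>2 * (- 12 * x0 + 6 * x1 - 3 * x3)
      - x4\<^sup>2 * (5 * x0 - x1 + x2 + 4 * x3 + 2 * x4)"
    "6 * (x0 * x1 * x4) = (x0 + x1 + x2 + x3 + x4)\<^sup>2 * (- x0 - x1 - 7 * x2 + 2 * x3 + 5 * x4) + (3 * x0 - 3 * x1 - x2 + 2 * x3 + x4)\<^sup>2 * (- 3 * x0 - 3 * x1) + 18 * (x0 * x1 * x2)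
      - x0\<^sup>2 * (- 28 * x0 + 24 * x1 + 9 * x2 - 36 * x3 - 15 * x4)
      - x1\<^sup>2 * (24 * x0 - 28 * x1 - 27 * x2 + 36 * x3 + 21 * x4)
      - x2\<^sup>2 * (- 18 * x0 - 18 * x1 - 7 * x2 - 12 * x3 - 9 * x4)
      - x3\<^sup>2 * (- 9 * x0 - 9 * x1 - 3 * x2 + 2 * x3 + 9 * x4)
      - x4\<^sup>2 * (6 * x0 + 6 * x1 + 3 * x2 + 12 * x3 + 5 * x4)"
    "24 * (x0 * x2 * x3) = (x0 + x1 + x2 + x3 + x4)\<^sup>2 * (2 * x0 - 4 * x1 - 34 * x2 + 11 * x3 + 20 * x4) + (3 * x0 - 3 * x1 - x2 + 2 * x3 + x4)\<^sup>2 * (- 12 * x0 - 18 * x1 - 3 * x3) + 36 * (x0 * x1 * x2)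
      - x0\<^sup>2 * (- 106 * x0 + 54 * x1 + 42 * x2 - 156 * x3 - 48 * x4)
      - x1\<^sup>2 * (210 * x0 - 166 * x1 - 150 * x2 + 192 * x3 + 120 * x4)
      - x2\<^sup>2 * (- 78 * x0 - 90 * x1 - 34 * x2 - 60 * x3 - 48 * x4)
      - x3\<^sup>2 * (- 60 * x0 - 18 * x1 - x3 + 30 * x4)
      - x4\<^sup>2 * (30 * x0 + 18 * x1 + 6 * x2 + 48 * x3 + 20 * x4)"
    "6 * (x0 * x2 * x4) = (x0 + x1 + x2 + x3 + x4)\<^sup>2 * (x0 + 7 * x1 + 25 * x2 - 8 * x3 - 17 * x4) + (3 * x0 - 3 * x1 - x2 + 2 * x3 + x4)\<^sup>2 * (9 * x0 + 12 * x1 + x2 + 2 * x3) - 30 * (x0 * x1 * x2)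
      - x0\<^sup>2 * (82 * x0 - 45 * x1 - 18 * x2 + 120 * x3 + 39 * x4)
      - x1\<^sup>2 * (- 120 * x0 + 115 * x1 + 120 * x2 - 120 * x3 - 75 * x4)
      - x2\<^sup>2 * (54 * x0 + 75 * x1 + 26 * x2 + 40 * x3 + 31 * x4)
      - x3\<^sup>2 * (45 * x0 + 15 * x1 + 5 * x2 - 25 * x4)
      - x4\<^sup>2 * (- 24 * x0 - 15 * x1 - 8 * x2 - 40 * x3 - 17 * x4)"
    "48 * (x0 * x3 * x4) = (x0 + x1 + x2 + x3 + x4)\<^sup>2 * (5 * x0 - x1 - 7 * x2 + 5 * x3 + 5 * x4) + (3 * x0 - 3 * x1 - x2 + 2 * x3 + x4)\<^sup>2 * (x3 + x4) + 6 * (x0 * x1 * x2)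
      - x0\<^sup>2 * (5 * x0 + 9 * x1 + 3 * x2 + 24 * x3 + 24 * x4)
      - x1\<^sup>2 * (3 * x0 - x1 - 9 * x2 + 12 * x3 + 12 * x4)
      - x2\<^sup>2 * (- 9 * x0 - 15 * x1 - 7 * x2 - 8 * x3 - 8 * x4)
      - x3\<^sup>2 * (27 * x0 - 3 * x1 - x2 + 9 * x3 + 23 * x4)
      - x4\<^sup>2 * (21 * x0 + 3 * x1 + x2 + 20 * x3 + 6 * x4)"
    "48 * (x1 * x2 * x3) = (x0 + x1 + x2 + x3 + x4)\<^sup>2 * (- 2 * x0 + 28 * x1 + 82 * x2 - 17 * x3 - 62 * x4) + (3 * x0 - 3 * x1 - x2 + 2 * x3 + x4)\<^sup>2 * (27 * x0 + 39 * x1 + 3 * x2 + 9 * x3) - 90 * (x0 * x1 * x2)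
      - x0\<^sup>2 * (241 * x0 - 111 * x1 - 57 * x2 + 384 * x3 + 96 * x4)
      - x1\<^sup>2 * (- 405 * x0 + 379 * x1 + 399 * x2 - 348 * x3 - 240 * x4)
      - x2\<^sup>2 * (171 * x0 + 249 * x1 + 85 * x2 + 144 * x3 + 96 * x4)
      - x3\<^sup>2 * (180 * x0 + 42 * x1 + 24 * x2 + 19 * x3 - 60 * x4)
      - x4\<^sup>2 * (- 99 * x0 - 57 * x1 - 39 * x2 - 132 * x3 - 62 * x4)"
    "6 * (x1 * x2 * x4) = (x0 + x1 + x2 + x3 + x4)\<^sup>2 * (x0 - 5 * x1 - 17 * x2 + 4 * x3 + 13 * x4) + (3 * x0 - 3 * x1 - x2 + 2 * x3 + x4)\<^sup>2 * (- 6 * x0 - 9 * x1 - x2 - 2 * x3) + 6 * (x0 * x1 * x2)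
      - x0\<^sup>2 * (- 53 * x0 + 24 * x1 + 12 * x2 - 84 * x3 - 21 * x4)
      - x1\<^sup>2 * (99 * x0 - 86 * x1 - 90 * x2 + 84 * x3 + 57 * x4)
      - x2\<^sup>2 * (- 33 * x0 - 54 * x1 - 18 * x2 - 28 * x3 - 19 * x4)
      - x3\<^sup>2 * (- 39 * x0 - 9 * x1 - 5 * x2 - 4 * x3 + 13 * x4)
      - x4\<^sup>2 * (21 * x0 + 12 * x1 + 8 * x2 + 28 * x3 + 13 * x4)"
    "24 * (x1 * x3 * x4) = (x0 + x1 + x2 + x3 + x4)\<^sup>2 * (- 2 * x0 + 28 * x1 + 58 * x2 - 17 * x3 - 44 * x4) + (3 * x0 - 3 * x1 - x2 + 2 * x3 + x4)\<^sup>2 * (24 * x0 + 30 * x1 + 4 * x2 + 5 * x3) - 60 * (x0 * x1 * x2)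
      - x0\<^sup>2 * (214 * x0 - 138 * x1 - 54 * x2 + 312 * x3 + 96 * x4)
      - x1\<^sup>2 * (- 270 * x0 + 298 * x1 + 330 * x2 - 276 * x3 - 168 * x4)
      - x2\<^sup>2 * (114 * x0 + 198 * x1 + 62 * x2 + 88 * x3 + 64 * x4)
      - x3\<^sup>2 * (120 * x0 + 54 * x1 + 20 * x2 + 3 * x3 - 58 * x4)
      - x4\<^sup>2 * (- 66 * x0 - 30 * x1 - 26 * x2 - 100 * x3 - 44 * x4)"
    "16 * (x2 * x3 * x4) = (x0 + x1 + x2 + x3 + x4)\<^sup>2 * (- 6 * x0 - 12 * x1 - 18 * x2 + 9 * x3 + 18 * x4) + (3 * x0 - 3 * x1 - x2 + 2 * x3 + x4)\<^sup>2 * (- 9 * x0 - 9 * x1 - x2 - x3) + 54 * (x0 * x1 * x2)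
      - x0\<^sup>2 * (- 87 * x0 + 57 * x1 + 15 * x2 - 120 * x3 - 48 * x4)
      - x1\<^sup>2 * (51 * x0 - 93 * x1 - 105 * x2 + 84 * x3 + 48 * x4)
      - x2\<^sup>2 * (- 45 * x0 - 63 * x1 - 19 * x2 - 24 * x3 - 16 * x4)
      - x3\<^sup>2 * (- 36 * x0 - 18 * x1 + 5 * x3 + 32 * x4)
      - x4\<^sup>2 * (21 * x0 + 15 * x1 + 17 * x2 + 44 * x3 + 18 * x4)"
  by (simp_all add: power2_eq_square algebra_simps)

text \<open>
  The multiples of \<open>x\<^sub>i\<^sup>2\<close> give all monomials that are not squarefree, the preceding identities the others.
\<close>

theorem tangent_space_cubics:
  fixes \<phi> :: "(5, 'a::field_char_0) mpolynomial"
  assumes "\<phi> \<in> cubics"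
  shows "\<phi> \<in> tangent_space"
proof -
  define x :: "5 \<Rightarrow> (5, 'a) mpolynomial" where "x = mvar"
  define L :: "(5, 'a) mpolynomial set" where "L = range linear_form"
  have L_x: "x i \<in> L" for i unfolding L_def x_def linear_form_axis[symmetric] by blast
  have L_add: "p + q \<in> L" if "p \<in> L" "q \<in> L" for p q
    using that unfolding L_def by (auto simp flip: linear_form_add)
  have L_scale: "const c * p \<in> L" if "p \<in> L" for p c
    using that unfolding L_def by (auto simp flip: linear_form_scale)
  have L_numeral: "numeral n * p \<in> L" if "p \<in> L" for p n
    unfolding numeral_mpoly using that by (rule L_scale)
  have minus: "- p = const (- 1) * p" for p :: "(5, 'a) mpolynomial"
    by (rule poly_mapping_eqI) (simp add: lookup_const_mult)
  have L_uminus: "- p \<in> L" if "p \<in> L" for p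
    unfolding minus[of p] using that by (rule L_scale)
  have L_diff: "p - q \<in> L" if "p \<in> L" "q \<in> L" for p q
    using L_add[OF that(1) L_uminus[OF that(2)]] by simp
  have L_neg: "- numeral n * p \<in> L" if "p \<in> L" for p n
    using L_uminus[OF L_numeral[OF that]] by simp
  note L = L_x L_add L_numeral L_neg L_uminus L_diff
  have sq: "(linear_form (secant_point k))\<^sup>2 * p \<in> tangent_space" if "p \<in> L" "k < 7" for p k
    using that tangent_space_square unfolding L_def by blast
  have sqx: "(x i)\<^sup>2 * p \<in> tangent_space" if "p \<in> L" for p i
  proof -
    have "i \<in> {0, 1, 2, 3, 4}" using UNIV_5 by blast
    then have "\<exists>k\<in>{0, 1, 2, 3, 4 :: nat}. i = of_nat k" by simp
    then obtain k :: nat where k': "k \<in> {0, 1, 2, 3, 4}" and k: "i = of_nat k" by (rule bexE)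
    have "k < 5" using k' by auto
    note k = this k
    then show ?thesis using sq[OF that, of k] by (simp add: secant_point_def x_def linear_form_axis)
  qed
  have form: "linear_form v = (\<Sum>i\<in>UNIV. const (v $ i) * x i)" for v
    by (simp add: linear_form_def x_def mvar_def mult_single)
  have sum5: "(\<Sum>i\<in>UNIV. f i) = f 0 + f 1 + f 2 + f 3 + f 4" for f :: "5 \<Rightarrow> (5, 'a) mpolynomial"
    unfolding UNIV_5 by (simp add: add.assoc)
  have "linear_form (secant_point 5) = x 0 + x 1 + x 2 + x 3 + x 4"
    unfolding form sum5 by (simp add: secant_point_def)
  then have sqS: "(x 0 + x 1 + x 2 + x 3 + x 4)\<^sup>2 * p \<in> tangent_space" if "p \<in> L" for p
    using sq[OF that, of 5] by simp
  have "linear_form (secant_point 6) = 3 * x 0 - 3 * x 1 - x 2 + 2 * x 3 + x 4"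
    unfolding form sum5 by (simp add: secant_point_def single_uminus)
  then have sqQ: "(3 * x 0 - 3 * x 1 - x 2 + 2 * x 3 + x 4)\<^sup>2 * p \<in> tangent_space" if "p \<in> L" for p
    using sq[OF that, of 6] by simp
  have mon: "x i * x j * x k = Poly_Mapping.single (cubic_monomial_of i j k) 1" for i j k
    by (simp add: x_def mvar_def mult_single cubic_monomial_of_def)
  have o: "x 0 * x 1 * x 2 \<in> tangent_space"
    unfolding mon tangent_space_def
    by (rule CollectI, rule exI[of _ "\<lambda>_. 0"], rule exI[of _ 1]) (simp add: linear_form_0)
  have cancel: "p \<in> tangent_space" if "numeral n * p \<in> tangent_space" for p :: "(5, 'a) mpolynomial" and n
  proof -
    have eq: "const (inverse (numeral n)) * (numeral n * p) = p"
      unfolding numeral_mpoly by (rule poly_mapping_eqI) (simp only: lookup_const_mult, simp)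
    show ?thesis using tangent_space_scale[OF that, of "inverse (numeral n)"] unfolding eq .
  qed
  note T = tangent_space_add tangent_space_diff tangent_space_numeral sqx sqS sqQ o L
  note identities = squarefree_cubic_identities[where ?x0.0 = "x 0" and ?x1.0 = "x 1" and ?x2.0 = "x 2"
      and ?x3.0 = "x 3" and ?x4.0 = "x 4"]
  have triples:
    "x 0 * x 1 * x 3 \<in> tangent_space"
    "x 0 * x 1 * x 4 \<in> tangent_space"
    "x 0 * x 2 * x 3 \<in> tangent_space"
    "x 0 * x 2 * x 4 \<in> tangent_space"
    "x 0 * x 3 * x 4 \<in> tangent_space"
    "x 1 * x 2 * x 3 \<in> tangent_space"
    "x 1 * x 2 * x 4 \<in> tangent_space"
    "x 1 * x 3 * x 4 \<in> tangent_space"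
    "x 2 * x 3 * x 4 \<in> tangent_space"
    subgoal by (rule cancel, subst identities(1), intro T)
    subgoal by (rule cancel, subst identities(2), intro T)
    subgoal by (rule cancel, subst identities(3), intro T)
    subgoal by (rule cancel, subst identities(4), intro T)
    subgoal by (rule cancel, subst identities(5), intro T)
    subgoal by (rule cancel, subst identities(6), intro T)
    subgoal by (rule cancel, subst identities(7), intro T)
    subgoal by (rule cancel, subst identities(8), intro T)
    subgoal by (rule cancel, subst identities(9), intro T)
    done
  have prod: "x i * x j * x k \<in> tangent_space" for i j k
  proof -
    have sorted: "x i * x j * x k \<in> tangent_space" if "i < j" "j < k" for i j k
    proof -
      have "i \<in> {0, 1, 2, 3, 4}" "j \<in> {0, 1, 2, 3, 4}" "k \<in> {0, 1, 2, 3, 4}" using UNIV_5 by blast+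
      moreover have "\<forall>i\<in>{0, 1, 2, 3, 4}. \<forall>j\<in>{0, 1, 2, 3, 4}. \<forall>k\<in>{0, 1, 2, 3, 4}. i < j \<longrightarrow> j < k \<longrightarrow>
          x i * x j * x k \<in> tangent_space"
        by (simp add: less_5 less_5[THEN order_less_not_sym] o triples)
      ultimately show ?thesis using that by blast
    qed
    have equal: "x i * x i * x k \<in> tangent_space" for i k
      using sqx[OF L_x[of k], of i] by (simp add: power2_eq_square)
    have swap: "x i * x j * x k = x j * x i * x k" "x i * x j * x k = x i * x k * x j" for i j k
      by (simp_all add: ac_simps)
    consider "i = j" | "j = k" | "i = k" | "i < j" "j < k" | "i < k" "k < j" | "j < i" "i < k" | "j < k" "k < i"
      | "k < i" "i < j" | "k < j" "j < i" by fastforce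
    then show ?thesis
      by cases (metis sorted equal swap)+
  qed
  have "0 \<in> (tangent_space :: (5, 'a) mpolynomial set)"
    using tangent_space_scale[OF o, of 0] by simp
  then have sum: "sum f X \<in> tangent_space" if "\<And>y. y \<in> X \<Longrightarrow> f y \<in> tangent_space"
    for f :: "cubic_monomial \<Rightarrow> (5, 'a) mpolynomial" and X
    using that by (induction X rule: infinite_finite_induct) (auto intro: tangent_space_add)
  have "Poly_Mapping.single (Rep_cubic_monomial m) c \<in> tangent_space" for m and c :: 'a
  proof -
    obtain i j k where m: "m = cmon i j k" by (rule cmon_surj)
    have "Poly_Mapping.single (Rep_cubic_monomial m) c = const c * (x i * x j * x k)"
      by (simp add: m Rep_cmon mon mult_single)
    then show ?thesis using tangent_space_scale[OF prod] by simp
  qed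
  then have "cubic_of (cubic_coords \<phi>) \<in> tangent_space" unfolding cubic_of_def by (intro sum)
  then show ?thesis using assms by (simp add: cubic_of_coords)
qed

section \<open>Polynomials that vanish on the sums of seven cubes\<close>

lemma mpolys_in_subst:
  fixes p :: "('i, 'a::comm_ring_1) mpolynomial" and x :: "'i \<Rightarrow> ('j, 'a) mpolynomial"
  assumes "p \<in> mpolys_in S" "\<And>i. i \<in> S \<Longrightarrow> x i \<in> mpolys_in T"
  shows "mpoly_subst const x p \<in> mpolys_in T"
  unfolding mpoly_subst_def monomial_value_def using assms
  by (intro mpolys_in_sum mpolys_in_mult mpolys_in_prod mpolys_in_power mpolys_in_const)
    (auto simp: mpolys_in_def[of S])

lemma monomial_value_scale: "monomial_value (\<lambda>i. t * z i) \<mu> = t ^ monomial_degree \<mu> * monomial_value z \<mu>"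
  by (simp add: monomial_value_def monomial_degree_def power_mult_distrib prod.distrib power_sum)

lemma peval_monomials: "peval y p = (\<Sum>\<mu>\<in>Poly_Mapping.keys p. Poly_Mapping.lookup p \<mu> * monomial_value y \<mu>)"
  by (simp add: peval_def monomial_value_def)

text \<open>
  Here \<open>q\<close> is the homogeneous part of \<open>p\<close> of least degree \<open>m\<close>. Along a curve \<open>t * Z t\<close> through the origin
  the other parts only contribute terms divisible by \<open>t ^ (m + 1)\<close>.
\<close>

lemma lowest_form:
  fixes p :: "('i, 'a::comm_ring_1) mpolynomial"
  assumes "p \<in> mpolys_in S" "p \<noteq> 0"
  obtains m q where "q \<in> mpolys_in S" "q \<noteq> 0"
    "\<And>Z. (\<And>i. polynomial_fun (\<lambda>t. Z t i)) \<Longrightarrow>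
      \<exists>h. polynomial_fun h \<and> (\<forall>t. peval (\<lambda>i. t * Z t i) p = t ^ m * h t) \<and> h 0 = peval (Z 0) q"
proof -
  define m where "m = Min (monomial_degree ` Poly_Mapping.keys p)"
  have ne: "monomial_degree ` Poly_Mapping.keys p \<noteq> {}" "finite (monomial_degree ` Poly_Mapping.keys p)"
    using assms by auto
  have le: "m \<le> monomial_degree \<mu>" if "\<mu> \<in> Poly_Mapping.keys p" for \<mu>
    using that ne unfolding m_def by auto
  obtain \<nu> where \<nu>: "\<nu> \<in> Poly_Mapping.keys p" "monomial_degree \<nu> = m"
    using Min_in[OF ne(2,1)] unfolding m_def by force
  define K where "K = {\<mu> \<in> Poly_Mapping.keys p. monomial_degree \<mu> = m}"
  have K: "finite K" "K \<subseteq> Poly_Mapping.keys p" by (auto simp: K_def)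
  define q where "q = (\<Sum>\<mu>\<in>K. Poly_Mapping.single \<mu> (Poly_Mapping.lookup p \<mu>))"
  have lq: "Poly_Mapping.lookup q \<mu> = (if \<mu> \<in> K then Poly_Mapping.lookup p \<mu> else 0)" for \<mu>
    using K(1) by (simp add: q_def lookup_sum lookup_single when_def)
  have "q \<in> mpolys_in S" using assms(1) lq by (auto simp: mpolys_in_def in_keys_iff split: if_splits)
  moreover have "Poly_Mapping.lookup q \<nu> \<noteq> 0" using lq \<nu> by (simp add: K_def in_keys_iff)
  then have "q \<noteq> 0" by auto
  moreover have "\<exists>h. polynomial_fun h \<and> (\<forall>t. peval (\<lambda>i. t * Z t i) p = t ^ m * h t) \<and> h 0 = peval (Z 0) q"
    if Z: "\<And>i. polynomial_fun (\<lambda>t. Z t i)" for Z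
  proof -
    define h where "h t = (\<Sum>\<mu>\<in>Poly_Mapping.keys p. Poly_Mapping.lookup p \<mu> *
      (t ^ (monomial_degree \<mu> - m) * monomial_value (Z t) \<mu>))" for t
    have "polynomial_fun h" unfolding h_def monomial_value_def by (intro polynomial_intros Z)
    moreover have "peval (\<lambda>i. t * Z t i) p = t ^ m * h t" for t
      unfolding peval_monomials monomial_value_scale h_def sum_distrib_left
    proof (intro sum.cong refl)
      fix \<mu> assume "\<mu> \<in> Poly_Mapping.keys p"
      then have "t ^ monomial_degree \<mu> = t ^ m * t ^ (monomial_degree \<mu> - m)"
        using le by (simp flip: power_add)
      then show "Poly_Mapping.lookup p \<mu> * (t ^ monomial_degree \<mu> * monomial_value (Z t) \<mu>) =
        t ^ m * (Poly_Mapping.lookup p \<mu> * (t ^ (monomial_degree \<mu> - m) * monomial_value (Z t) \<mu>))"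
        by (simp add: ac_simps)
    qed
    moreover have "h 0 = peval (Z 0) q"
    proof -
      have "h 0 = (\<Sum>\<mu>\<in>K. Poly_Mapping.lookup p \<mu> * (0 ^ (monomial_degree \<mu> - m) * monomial_value (Z 0) \<mu>))"
        unfolding h_def by (intro sum.mono_neutral_right) (auto simp: K_def power_0_left, use le leD in blast)
      also have "\<dots> = (\<Sum>\<mu>\<in>K. Poly_Mapping.lookup p \<mu> * monomial_value (Z 0) \<mu>)"
        by (intro sum.cong refl) (simp add: K_def)
      also have "\<dots> = peval (Z 0) q" by (simp add: q_def peval_sum peval_single)
      finally show ?thesis .
    qed
    ultimately show ?thesis by blast
  qed
  ultimately show thesis using that by blast
qed

text \<open>
  Expand \<open>r\<close> around \<open>c = cubes g\<close> for the seven points \<open>g\<close>, and let \<open>q\<close> be the part of least degree.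
  Since the tangent space and the omitted coordinate span everything, every \<open>z\<close> with \<open>q z \<noteq> 0\<close> is, up to
  that coordinate, the velocity of a curve of sums of seven cubes through \<open>c\<close>. If \<open>r\<close> vanished on this
  curve, then so would \<open>q\<close> on its velocity, but \<open>q\<close> does not depend on the omitted coordinate.
\<close>

theorem secant_elimination:
  fixes r :: "(cubic_monomial, 'a::field_char_0) mpolynomial"
  assumes r: "r \<in> mpolys_in (- {cmon 0 1 2})" "r \<noteq> 0"
  shows "\<exists>u. peval (cubic_coords (cubes u)) r \<noteq> 0"
proof (rule ccontr)
  assume "\<not> ?thesis"
  then have vanish: "peval (cubic_coords (cubes u)) r = 0" for u by blast
  let ?S = "- {cmon 0 1 2}"
  define g :: "nat \<Rightarrow> 'a ^ 5" where "g = secant_point"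
  define c where "c = cubic_coords (cubes g)"
  define r' where "r' = mpoly_subst const (\<lambda>m. mvar m + const (c m)) r"
  have r'_eval: "peval z r' = peval (\<lambda>m. z m + c m) r" for z
    unfolding r'_def peval_subst peval_add peval_mvar peval_const ..
  have "r' \<in> mpolys_in ?S"
    unfolding r'_def using r(1)
    by (rule mpolys_in_subst) (auto intro: mpolys_in_add mpolys_in_mvar mpolys_in_const)
  moreover have "r' \<noteq> 0"
  proof
    assume "r' = 0"
    obtain y where "peval y r \<noteq> 0" using exists_nonzero_value[of UNIV r] r(2) by (auto simp: mpolys_in_UNIV)
    then show False using r'_eval[of "\<lambda>m. y m - c m"] \<open>r' = 0\<close> by (simp add: peval_0)
  qed
  ultimately obtain m q where q: "q \<in> mpolys_in ?S" "q \<noteq> 0" and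
    h: "\<And>Z. (\<And>i. polynomial_fun (\<lambda>t. Z t i)) \<Longrightarrow>
      \<exists>h. polynomial_fun h \<and> (\<forall>t. peval (\<lambda>i. t * Z t i) r' = t ^ m * h t) \<and> h 0 = peval (Z 0) q"
    using lowest_form by metis
  obtain z where z: "peval z q \<noteq> 0" using exists_nonzero_value[of UNIV q] q(2) by (auto simp: mpolys_in_UNIV)
  have "cubic_of z \<in> tangent_space" using tangent_space_cubics cubic_of_in by blast
  then obtain w s where w: "cubic_of z =
      (\<Sum>k<7. (linear_form (g k))\<^sup>2 * linear_form (w k)) + Poly_Mapping.single (cubic_monomial_of 0 1 2) s"
    unfolding tangent_space_def g_def by blast
  \<comment> \<open>The derivative of the cube supplies a factor \<open>3\<close>.\<close>
  define v where "v k = inverse 3 *s w k" for k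
  define R1 where "R1 = (\<Sum>k<7. linear_form (g k) * (linear_form (v k))\<^sup>2)"
  define R2 where "R2 = (\<Sum>k<7. linear_form (v k) ^ 3)"
  define T where "T = (\<Sum>k<7. (linear_form (g k))\<^sup>2 * linear_form (w k))"
  define Z where "Z t i = cubic_coords T i + (3 * t * cubic_coords R1 i + t\<^sup>2 * cubic_coords R2 i)" for t i
  have curve: "cubic_coords (cubes (\<lambda>k. g k + t *s v k)) i = c i + t * Z t i" for t i
  proof -
    have "linear_form (g k + t *s v k) ^ 3 = linear_form (g k) ^ 3 + (const t * ((linear_form (g k))\<^sup>2 * linear_form (w k)) +
        (const (3 * t\<^sup>2) * (linear_form (g k) * (linear_form (v k))\<^sup>2) + const (t ^ 3) * linear_form (v k) ^ 3))" for k
    proof -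
      interpret C: ring_morphism "const :: 'a \<Rightarrow> (5, 'a) mpolynomial" by (rule ring_morphism_const)
      have "w k = 3 *s v k" by (simp add: v_def vec_eq_iff)
      then have "linear_form (w k) = 3 * linear_form (v k)" by (simp add: linear_form_scale single_numeral)
      moreover have "const (3 * t\<^sup>2) = (3 * (const t)\<^sup>2 :: (5, 'a) mpolynomial)"
        "const (t ^ 3) = (const t ^ 3 :: (5, 'a) mpolynomial)"
        by (simp_all add: C.mult C.power single_numeral)
      ultimately show ?thesis
        by (simp only: linear_form_add linear_form_scale) (simp add: power3_eq_cube power2_eq_square algebra_simps)
    qed
    then have "cubes (\<lambda>k. g k + t *s v k) = cubes g + (const t * T + (const (3 * t\<^sup>2) * R1 + const (t ^ 3) * R2))"
      by (simp only: cubes_def T_def R1_def R2_def sum.distrib sum_distrib_left)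
    then have "cubic_coords (cubes (\<lambda>k. g k + t *s v k)) i = c i + (t * cubic_coords T i +
        (3 * t\<^sup>2 * cubic_coords R1 i + t ^ 3 * cubic_coords R2 i))"
      by (simp only: c_def cubic_coords_add cubic_coords_scale)
    then show ?thesis by (simp add: Z_def power2_eq_square power3_eq_cube algebra_simps)
  qed
  have "polynomial_fun (\<lambda>t. Z t i)" for i unfolding Z_def by (intro polynomial_intros)
  then obtain h where h: "polynomial_fun h" "\<And>t. peval (\<lambda>i. t * Z t i) r' = t ^ m * h t" "h 0 = peval (Z 0) q"
    using h by blast
  have "t ^ m * h t = 0" for t
    using vanish[of "\<lambda>k. g k + t *s v k"] h(2)[of t] by (simp add: r'_eval curve[abs_def] add.commute)
  then have "h t = 0" if "t \<noteq> 0" for t using that by (metis mult_eq_0_iff power_eq_0_iff)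
  then have "h 0 = 0"
    using polynomial_fun_eq_at_0[OF h(1) polynomial_fun_const[of 0]] by simp
  moreover have "peval (Z 0) q = peval z q"
  proof (rule peval_cong_mpolys_in[OF q(1)])
    fix i assume i: "i \<in> ?S"
    have "z i = cubic_coords (cubic_of z) i" by simp
    also have "\<dots> = cubic_coords T i + cubic_coords (Poly_Mapping.single (cubic_monomial_of 0 1 2) s) i"
      unfolding w T_def by (simp add: cubic_coords_add)
    also have "cubic_coords (Poly_Mapping.single (cubic_monomial_of 0 1 2) s) i = 0"
      using i Rep_cmon[of 0 1 2] by (auto simp: cubic_coords_def lookup_single when_def) (metis Rep_cubic_monomial_inject)
    finally show "Z 0 i = z i" by (simp add: Z_def)
  qed
  ultimately show False using h(3) z by simp
qed

section \<open>The ideal of the secant variety\<close>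

definition secant_ideal :: "(cubic_monomial, 'a::comm_ring_1) mpolynomial set" where
  "secant_ideal = {F. \<forall>u. peval (cubic_coords (cubes u)) F = 0}"

lemma polynomial_fun_cubes:
  "polynomial_fun (\<lambda>t. cubic_coords (cubes (\<lambda>k. u k + t *s v k)) m)"
  unfolding cubes_def cubic_coords_sum power3_eq_cube cubic_coords_product vector_add_component vector_smult_component
  by (intro polynomial_intros)

text \<open>
  Two points at which \<open>a\<close> and \<open>b\<close> are nonzero are joined by a line in the space of the seven vectors, and on
  it the product is a nonzero polynomial.
\<close>

lemma secant_ideal_prime:
  fixes a b :: "(cubic_monomial, 'a::field_char_0) mpolynomial"
  assumes "a * b \<in> secant_ideal"
  shows "a \<in> secant_ideal \<or> b \<in> secant_ideal"
proof (rule ccontr)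
  assume "\<not> ?thesis"
  then obtain u v where uv: "peval (cubic_coords (cubes u)) a \<noteq> 0" "peval (cubic_coords (cubes v)) b \<noteq> 0"
    by (auto simp: secant_ideal_def)
  define c where "c t = cubic_coords (cubes (\<lambda>k. u k + t *s (v k - u k)))" for t
  have c: "c 0 = cubic_coords (cubes u)" "c 1 = cubic_coords (cubes v)" by (simp_all add: c_def)
  have "polynomial_fun (\<lambda>t. c t m)" for m unfolding c_def by (rule polynomial_fun_cubes)
  then have "polynomial_fun (\<lambda>t. peval (c t) F)" for F by (intro polynomial_intros)
  then obtain t where "peval (c t) a * peval (c t) b \<noteq> 0"
    using polynomial_fun_nonzero_mult[of "\<lambda>t. peval (c t) a" "\<lambda>t. peval (c t) b" 0 1] uv c by auto
  then show False using assms by (simp add: secant_ideal_def c_def flip: peval_mult)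
qed

lemma secant_ideal_no_unit: "u dvd 1 \<Longrightarrow> u \<notin> secant_ideal"
  by (auto simp: secant_ideal_def elim!: dvdE) (metis mult_zero_left peval_1 peval_mult zero_neq_one)

lemma secant_ideal_mult: "a \<in> secant_ideal \<Longrightarrow> a * b \<in> secant_ideal" "a \<in> secant_ideal \<Longrightarrow> b * a \<in> secant_ideal"
  by (simp_all add: secant_ideal_def peval_mult)

lemma secant_ideal_add: "a \<in> secant_ideal \<Longrightarrow> b \<in> secant_ideal \<Longrightarrow> a + b \<in> secant_ideal"
  by (simp add: secant_ideal_def peval_add)

lemma secant_ideal_no_elimination:
  "r \<in> secant_ideal \<Longrightarrow> r \<in> mpolys_in (- {cmon 0 1 2}) \<Longrightarrow> r = (0 :: (cubic_monomial, 'a::field_char_0) mpolynomial)"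
  using secant_elimination[of r] by (auto simp: secant_ideal_def)

text \<open>
  If \<open>P\<close> did not divide \<open>F\<close>, the two would combine to a nonzero element of the ideal that does not involve
  the coordinate at \<open>x\<^sub>0x\<^sub>1x\<^sub>2\<close>.
\<close>

lemma secant_ideal_generator:
  fixes P F :: "(cubic_monomial, 'a::field_char_0) mpolynomial"
  assumes P: "irreducible P" "P \<in> secant_ideal" and F: "F \<in> secant_ideal"
  shows "P dvd F"
proof (rule ccontr)
  assume "\<not> P dvd F"
  moreover have "P \<noteq> 0" using P(1) by auto
  then have "P \<notin> mpolys_in (- {cmon 0 1 2})" using secant_ideal_no_elimination P(2) by blast
  ultimately obtain u v r where "u * P + v * F = r" "r \<in> mpolys_in (- {cmon 0 1 2})" "r \<noteq> 0"
    using elimination_mpoly[OF P(1)] by metis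
  then show False
    using secant_ideal_no_elimination[of r] P(2) F secant_ideal_mult secant_ideal_add by metis
qed

section \<open>Semi-invariance of the generator\<close>

text \<open>
  The maps \<open>y \<mapsto> (\<lambda>m. peval y (h m))\<close> and \<open>y \<mapsto> (\<lambda>m. peval y (h' m))\<close> preserve the sums of seven cubes. So
  both transforms of \<open>P\<close> are in the ideal and are multiples \<open>P * w\<close> and \<open>P * w'\<close>. As the second map
  undoes the first, \<open>w\<close> has no zero, hence is a constant.
\<close>

lemma generator_semi_invariant:
  fixes P :: "(cubic_monomial, 'a::{alg_closed_field, field_char_0}) mpolynomial"
  assumes P: "irreducible P" "P \<in> secant_ideal"
    and inv: "\<And>y. (\<lambda>m. peval (\<lambda>m. peval y (h m)) (h' m)) = y"
    and h: "\<And>u. \<exists>v. (\<lambda>m. peval (cubic_coords (cubes u)) (h m)) = cubic_coords (cubes v)"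
    and h': "\<And>u. \<exists>v. (\<lambda>m. peval (cubic_coords (cubes u)) (h' m)) = cubic_coords (cubes v)"
  shows "\<exists>c. c \<noteq> 0 \<and> (\<forall>y. peval (\<lambda>m. peval y (h m)) P = c * peval y P)"
proof -
  have *: "\<exists>w. mpoly_subst const k P = P * w"
    if k: "\<And>u. \<exists>v. (\<lambda>m. peval (cubic_coords (cubes u)) (k m)) = cubic_coords (cubes v)" for k
  proof -
    have "mpoly_subst const k P \<in> secant_ideal"
      unfolding secant_ideal_def
    proof (intro CollectI allI)
      fix u
      obtain v where "(\<lambda>m. peval (cubic_coords (cubes u)) (k m)) = cubic_coords (cubes v)" using k by blast
      then show "peval (cubic_coords (cubes u)) (mpoly_subst const k P) = 0"
        using P(2) by (simp add: peval_subst secant_ideal_def)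
    qed
    then show ?thesis using secant_ideal_generator[OF P] by (auto simp: dvd_def)
  qed
  obtain w where w: "mpoly_subst const h P = P * w" using *[OF h] by blast
  obtain w' where w': "mpoly_subst const h' P = P * w'" using *[OF h'] by blast
  have e: "peval (\<lambda>m. peval y (h m)) P = peval y P * peval y w" for y
    using arg_cong[OF w, of "peval y"] by (simp add: peval_subst peval_mult)
  have e': "peval (\<lambda>m. peval y (h' m)) P = peval y P * peval y w'" for y
    using arg_cong[OF w', of "peval y"] by (simp add: peval_subst peval_mult)
  have "P * 1 = P * (w * mpoly_subst const h w')"
  proof (rule mpoly_eqI)
    fix y
    show "peval y (P * 1) = peval y (P * (w * mpoly_subst const h w'))"
      using e'[of "\<lambda>m. peval y (h m)"] inv[of y] by (simp add: e peval_mult peval_subst mult.assoc)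
  qed
  then have "w * mpoly_subst const h w' = 1" using P(1) by (metis irreducible_def mult_left_cancel)
  then have "peval y w * peval y (mpoly_subst const h w') = 1" for y by (metis peval_1 peval_mult)
  then have nz: "peval y w \<noteq> 0" for y by (metis mult_zero_left zero_neq_one)
  then have "peval y w = peval (\<lambda>_. 0) w" for y by (rule nonvanishing_constant)
  then show ?thesis using nz e by (metis mult.commute)
qed

lemma lookup_cubic_monomial_of:
  "Poly_Mapping.lookup (cubic_monomial_of a b c) i =
    (if a = i then 1 else 0) + (if b = i then 1 else 0) + (if c = i then 1 else 0)"
  by (simp add: cubic_monomial_of_def lookup_add lookup_single when_def)

definition exponent :: "cubic_monomial \<Rightarrow> 5 \<Rightarrow> nat" where
  "exponent m i = Poly_Mapping.lookup (Rep_cubic_monomial m) i"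

lemma exponent_cmon: "exponent (cmon a b c) i = (if a = i then 1 else 0) + (if b = i then 1 else 0) + (if c = i then 1 else 0)"
  by (simp add: exponent_def Rep_cmon lookup_cubic_monomial_of)

lemma exponent_inject: "(\<And>i. exponent m i = exponent m' i) \<Longrightarrow> m = m'"
  by (metis Rep_cubic_monomial_inject exponent_def poly_mapping_eqI)

lemma sum_exponent: "(\<Sum>i\<in>UNIV. exponent m i) = 3"
  using Rep_cubic_monomial[of m] by (simp add: exponent_def flip: monomial_degree_UNIV)

lemma cubes_torus:
  fixes u :: "nat \<Rightarrow> 'a::comm_ring_1 ^ 5"
  shows "s ^ exponent m i * cubic_coords (cubes u) m =
    cubic_coords (cubes (\<lambda>k. \<chi> j. if j = i then s * u k $ j else u k $ j)) m"
  unfolding cubes_def cubic_coords_sum power3_eq_cube cubic_coords_product sum_distrib_left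
  by (intro sum.cong refl) (auto simp: exponent_cmon)

lemma cubes_permutation:
  fixes u :: "nat \<Rightarrow> 'a::comm_ring_1 ^ 5"
  assumes p: "\<And>a. p (p a) = a" and \<sigma>: "\<And>a b c. \<sigma> (cmon a b c) = cmon (p a) (p b) (p c)"
  shows "cubic_coords (cubes u) (\<sigma> m) = cubic_coords (cubes (\<lambda>k. \<chi> a. u k $ p a)) m"
proof -
  have bij: "bij_betw p UNIV UNIV" by (rule bij_betw_byWitness[of _ p]) (auto simp: p)
  have \<sigma>\<sigma>: "\<sigma> (\<sigma> m) = m" for m by (rule cmon_surj[of m]) (simp add: \<sigma> p)
  have iff: "cmon (p a) (p b) (p c) = \<sigma> m \<longleftrightarrow> cmon a b c = m" for a b c
    using \<sigma>\<sigma> \<sigma> by metis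
  have re: "(\<Sum>a\<in>UNIV. F a) = (\<Sum>a\<in>UNIV. F (p a))" for F :: "5 \<Rightarrow> 'a"
    using sum.reindex_bij_betw[OF bij, of F] by simp
  show ?thesis
    unfolding cubes_def cubic_coords_sum power3_eq_cube cubic_coords_product vec_lambda_beta
  proof (rule sum.cong[OF refl])
    fix k
    show "(\<Sum>a\<in>UNIV. \<Sum>b\<in>UNIV. \<Sum>c\<in>UNIV. if cmon a b c = \<sigma> m then u k $ a * u k $ b * u k $ c else 0) =
      (\<Sum>a\<in>UNIV. \<Sum>b\<in>UNIV. \<Sum>c\<in>UNIV. if cmon a b c = m then
        u k $ p a * u k $ p b * u k $ p c else 0)"
      by (subst re, subst (2) re, subst (3) re) (simp only: iff)
  qed
qed

definition weight :: "5 \<Rightarrow> (cubic_monomial \<Rightarrow>\<^sub>0 nat) \<Rightarrow> nat" where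
  "weight i \<mu> = (\<Sum>m\<in>UNIV. Poly_Mapping.lookup \<mu> m * exponent m i)"

lemma monomial_value_weight: "monomial_value (\<lambda>m. s ^ exponent m i) \<mu> = s ^ weight i \<mu>"
  by (simp add: monomial_value_superset[of UNIV] weight_def power_sum mult.commute flip: power_mult)

lemma sum_weight: "(\<Sum>i\<in>UNIV. weight i \<mu>) = 3 * monomial_degree \<mu>"
  unfolding weight_def
  by (subst sum.swap)
    (simp only: sum_distrib_left[symmetric] sum_exponent sum_distrib_right[symmetric] monomial_degree_UNIV mult.commute)

lemma monomial_value_mult: "monomial_value (\<lambda>m. s m * y m) \<mu> = monomial_value s \<mu> * monomial_value y \<mu>"
  by (simp add: monomial_value_def power_mult_distrib prod.distrib)

lemma eigenvalue_on_monomials: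
  fixes p :: "('i::finite, 'a::field_char_0) mpolynomial"
  assumes "\<And>y. peval (\<lambda>m. s m * y m) p = c * peval y p" "\<mu> \<in> Poly_Mapping.keys p"
  shows "monomial_value s \<mu> = c"
proof -
  define q where "q = (\<Sum>\<mu>\<in>Poly_Mapping.keys p. Poly_Mapping.single \<mu> (Poly_Mapping.lookup p \<mu> * monomial_value s \<mu>))"
  have "peval y q = peval (\<lambda>m. s m * y m) p" for y
    by (simp add: q_def peval_sum peval_single peval_monomials[of "\<lambda>m. s m * y m"] monomial_value_mult mult.assoc)
  then have "q = const c * p" by (intro mpoly_eqI) (simp add: assms(1) peval_mult peval_const)
  then have "Poly_Mapping.lookup q \<mu> = c * Poly_Mapping.lookup p \<mu>" by (simp add: lookup_const_mult)
  moreover have "Poly_Mapping.lookup q \<mu> = Poly_Mapping.lookup p \<mu> * monomial_value s \<mu>"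
    using assms(2) by (simp add: q_def lookup_sum lookup_single when_def)
  ultimately show ?thesis using assms(2) by (simp add: in_keys_iff)
qed

text \<open>
  Doubling the variable \<open>x\<^sub>i\<close> multiplies \<open>P\<close> by a constant \<open>c i\<close>, so \<open>2 ^ weight i \<mu> = c i\<close> for all
  monomials \<open>\<mu>\<close> of \<open>P\<close>. Exchanging \<open>x\<^sub>i\<close> and \<open>x\<^sub>j\<close> multiplies \<open>P\<close> by a constant as well and
  conjugates one doubling into the other, which gives \<open>c i = c j\<close>.
\<close>

theorem generator_weights:
  fixes P :: "(cubic_monomial, 'a::{alg_closed_field, field_char_0}) mpolynomial"
  assumes P: "irreducible P" "P \<in> secant_ideal"
  obtains w where "\<And>\<mu> i. \<mu> \<in> Poly_Mapping.keys P \<Longrightarrow> weight i \<mu> = w"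
proof -
  have "\<exists>c. c \<noteq> 0 \<and> (\<forall>y. peval (\<lambda>m. 2 ^ exponent m i * y m) P = c * peval y P)" for i
  proof -
    have torus: "peval y (const (s ^ exponent m i) * mvar m) = s ^ exponent m i * y m" for y m and s :: 'a
      by (simp add: peval_mult peval_const peval_mvar)
    have "\<exists>c. c \<noteq> 0 \<and> (\<forall>y. peval (\<lambda>m. peval y (const (2 ^ exponent m i) * mvar m)) P = c * peval y P)"
    proof (rule generator_semi_invariant[OF P, where h' = "\<lambda>m. const (inverse 2 ^ exponent m i) * mvar m"])
      show "(\<lambda>m. peval (\<lambda>m. peval y (const (2 ^ exponent m i) * mvar m)) (const (inverse 2 ^ exponent m i) * mvar m)) = y"
        for y :: "cubic_monomial \<Rightarrow> 'a"
        unfolding torus by (simp add: fun_eq_iff flip: mult.assoc power_mult_distrib)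
      show "\<exists>v. (\<lambda>m. peval (cubic_coords (cubes u)) (const (2 ^ exponent m i) * mvar m)) = cubic_coords (cubes v)"
        for u :: "nat \<Rightarrow> 'a ^ 5"
        unfolding torus cubes_torus by blast
      show "\<exists>v. (\<lambda>m. peval (cubic_coords (cubes u)) (const (inverse 2 ^ exponent m i) * mvar m)) = cubic_coords (cubes v)"
        for u :: "nat \<Rightarrow> 'a ^ 5"
        unfolding torus cubes_torus by blast
    qed
    then show ?thesis unfolding torus .
  qed
  then obtain c where c: "\<And>i. c i \<noteq> 0" "\<And>i y. peval (\<lambda>m. 2 ^ exponent m i * y m) P = c i * peval y P" by metis
  have cw: "2 ^ weight i \<mu> = c i" if "\<mu> \<in> Poly_Mapping.keys P" for i \<mu>
    using eigenvalue_on_monomials[OF c(2) that] by (simp add: monomial_value_weight)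
  have "P \<noteq> 0" using P(1) by auto
  then obtain y where y: "peval y P \<noteq> 0" using exists_nonzero_value[of UNIV P] by (auto simp: mpolys_in_UNIV)
  have "c i = c j" for i j
  proof -
    define p where "p = Transposition.transpose i j"
    \<comment> \<open>The permutation of the cubic monomials induced by \<open>p\<close>.\<close>
    define \<sigma> where "\<sigma> m = (SOME m'. \<forall>a. exponent m' a = exponent m (p a))" for m
    have pp: "p (p a) = a" for a by (simp add: p_def)
    have iff: "p x = a \<longleftrightarrow> x = p a" for x a using pp by metis
    have ex: "\<exists>m'. \<forall>a. exponent m' a = exponent m (p a)" for m
    proof (rule cmon_surj[of m])
      fix x y z assume m: "m = cmon x y z"
      show ?thesis
        by (rule exI[of _ "cmon (p x) (p y) (p z)"]) (simp only: m exponent_cmon iff simp_thms)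
    qed
    have \<sigma>e: "exponent (\<sigma> m) a = exponent m (p a)" for m a
      using someI_ex[OF ex[of m]] unfolding \<sigma>_def by blast
    have \<sigma>: "\<sigma> (cmon x y z) = cmon (p x) (p y) (p z)" for x y z
    proof (rule exponent_inject)
      show "exponent (\<sigma> (cmon x y z)) a = exponent (cmon (p x) (p y) (p z)) a" for a
        by (simp only: \<sigma>e exponent_cmon iff)
    qed
    have \<sigma>\<sigma>: "\<sigma> (\<sigma> m) = m" for m by (rule exponent_inject) (simp add: \<sigma>e pp)
    have "\<exists>d. d \<noteq> 0 \<and> (\<forall>y. peval (\<lambda>m. peval y (mvar (\<sigma> m))) P = d * peval y P)"
    proof (rule generator_semi_invariant[OF P, where h' = "\<lambda>m. mvar (\<sigma> m)"])
      have "\<exists>v. (\<lambda>m. peval (cubic_coords (cubes u)) (mvar (\<sigma> m))) = cubic_coords (cubes v)" for u :: "nat \<Rightarrow> 'a ^ 5"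
        unfolding peval_mvar cubes_permutation[OF pp \<sigma>] by blast
      then show "\<exists>v. (\<lambda>m. peval (cubic_coords (cubes u)) (mvar (\<sigma> m))) = cubic_coords (cubes v)"
        "\<exists>v. (\<lambda>m. peval (cubic_coords (cubes u)) (mvar (\<sigma> m))) = cubic_coords (cubes v)" for u :: "nat \<Rightarrow> 'a ^ 5"
        by blast+
    qed (simp add: peval_mvar \<sigma>\<sigma>)
    then obtain d where d: "d \<noteq> 0" "\<And>y. peval (\<lambda>m. y (\<sigma> m)) P = d * peval y P" by (auto simp: peval_mvar)
    have "p j = i" by (simp add: p_def)
    then have "c i * (d * peval y P) = d * (c j * peval y P)"
      using c(2)[of i "\<lambda>m. y (\<sigma> m)"] d(2)[of "\<lambda>m. 2 ^ exponent m j * y m"] c(2)[of j y] d(2)[of y]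
      by (simp add: \<sigma>e)
    then show ?thesis using d(1) y by simp
  qed
  moreover obtain \<nu> where "\<nu> \<in> Poly_Mapping.keys P" using \<open>P \<noteq> 0\<close> by (meson all_not_in_conv keys_eq_empty)
  ultimately have pow: "(2::'a) ^ weight i \<mu> = 2 ^ weight 0 \<nu>" if "\<mu> \<in> Poly_Mapping.keys P" for i \<mu>
    using cw that by metis
  have "weight i \<mu> = weight 0 \<nu>" if "\<mu> \<in> Poly_Mapping.keys P" for i \<mu>
  proof -
    have "of_nat (2 ^ weight i \<mu>) = (of_nat (2 ^ weight 0 \<nu>) :: 'a)" using pow[OF that] by simp
    then have "2 ^ weight i \<mu> = (2 ^ weight 0 \<nu> :: nat)" by (rule of_nat_eq_iff[THEN iffD1])
    then show ?thesis by simp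
  qed
  then show thesis using that by blast
qed

section \<open>The equation of the secant variety\<close>

lemma cmon_inject:
  assumes "cmon i j k = cmon a b c" "i \<le> j" "j \<le> k" "a \<le> b" "b \<le> c"
  shows "i = a \<and> j = b \<and> k = c"
  using assms cubic_monomial_of_inject[of i j k a b c] by (metis Rep_cmon)

lemma cubic_coords_test_cubic_nonzero:
  assumes "cubic_coords (test_cubic :: (5, 'a::comm_ring_1) mpolynomial) m \<noteq> 0"
  shows "m \<in> {cmon 4 4 4, cmon 3 3 3, cmon 1 2 4, cmon 0 2 3, cmon 0 1 1}"
proof -
  have "cubic_monomial_of i j k = Rep_cubic_monomial m \<longleftrightarrow> m = cmon i j k" for i j k
    by (metis Rep_cmon Rep_cubic_monomial_inject)
  then show ?thesis using assms
    by (auto simp: test_cubic_def cubic_coords_def lookup_add lookup_single when_def split: if_splits)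
qed

text \<open>
  The equations express the exponents of the five monomials as \<open>2\<close>, \<open>1\<close>, \<open>3\<close>, \<open>6\<close> and \<open>3\<close> times the
  exponent of \<open>x\<^sub>3\<^sup>3\<close>, whose sum is \<open>15\<close>.
\<close>

lemma test_monomial_degree:
  assumes \<mu>: "Poly_Mapping.keys \<mu> \<subseteq> {cmon 4 4 4, cmon 3 3 3, cmon 1 2 4, cmon 0 2 3, cmon 0 1 1}"
    and w: "\<And>i. weight i \<mu> = w" and pos: "monomial_degree \<mu> > 0"
  shows "monomial_degree \<mu> \<ge> 15"
proof -
  let ?M = "{cmon 4 4 4, cmon 3 3 3, cmon 1 2 4, cmon 0 2 3, cmon 0 1 1}"
  have le: "(1::5) \<le> 2" "(2::5) \<le> 4" "(0::5) \<le> 2" "(2::5) \<le> 3" "(0::5) \<le> 1"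
    using less_5 by (auto intro: less_imp_le)
  have ne: "cmon 4 4 4 \<noteq> cmon 3 3 3" "cmon 4 4 4 \<noteq> cmon 1 2 4" "cmon 4 4 4 \<noteq> cmon 0 2 3" "cmon 4 4 4 \<noteq> cmon 0 1 1"
    "cmon 3 3 3 \<noteq> cmon 1 2 4" "cmon 3 3 3 \<noteq> cmon 0 2 3" "cmon 3 3 3 \<noteq> cmon 0 1 1"
    "cmon 1 2 4 \<noteq> cmon 0 2 3" "cmon 1 2 4 \<noteq> cmon 0 1 1" "cmon 0 2 3 \<noteq> cmon 0 1 1"
    using le by (auto dest!: cmon_inject)
  define b where "b m = Poly_Mapping.lookup \<mu> m" for m
  have sum: "(\<Sum>m\<in>UNIV. b m * f m) = b (cmon 4 4 4) * f (cmon 4 4 4) + b (cmon 3 3 3) * f (cmon 3 3 3) +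
     b (cmon 1 2 4) * f (cmon 1 2 4) + b (cmon 0 2 3) * f (cmon 0 2 3) + b (cmon 0 1 1) * f (cmon 0 1 1)" for f
  proof -
    have "(\<Sum>m\<in>UNIV. b m * f m) = (\<Sum>m\<in>?M. b m * f m)"
      using \<mu> by (intro sum.mono_neutral_right) (auto simp: b_def in_keys_iff)
    then show ?thesis using ne by (simp add: add.assoc)
  qed
  have "monomial_degree \<mu> = (\<Sum>m\<in>UNIV. b m * 1)" by (simp add: monomial_degree_UNIV b_def)
  then have d: "monomial_degree \<mu> = b (cmon 4 4 4) + b (cmon 3 3 3) + b (cmon 1 2 4) + b (cmon 0 2 3) + b (cmon 0 1 1)"
    unfolding sum by simp
  have "weight i \<mu> = (\<Sum>m\<in>UNIV. b m * exponent m i)" for i by (simp add: weight_def b_def)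
  then have e: "w = (\<Sum>m\<in>UNIV. b m * exponent m i)" for i using w by simp
  have "w = b (cmon 0 2 3) + b (cmon 0 1 1)" "w = b (cmon 1 2 4) + b (cmon 0 1 1) * 2"
    "w = b (cmon 1 2 4) + b (cmon 0 2 3)" "w = b (cmon 3 3 3) * 3 + b (cmon 0 2 3)" "w = b (cmon 4 4 4) * 3 + b (cmon 1 2 4)"
    using e[of 0] e[of 1] e[of 2] e[of 3] e[of 4] unfolding sum exponent_cmon by simp_all
  then have "monomial_degree \<mu> = 15 * b (cmon 3 3 3)" using d by linarith
  then show ?thesis using pos by simp
qed

lemma peval_homogeneous:
  assumes "homogeneous d p"
  shows "peval (\<lambda>m. t * y m) p = t ^ d * peval y (p :: ('i, 'a::comm_ring_1) mpolynomial)"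
  unfolding peval_monomials monomial_value_scale sum_distrib_left using assms
  by (intro sum.cong refl) (auto simp: homogeneous_def ac_simps)

text \<open>
  View \<open>P\<close> as a polynomial \<open>p\<close> in the coordinate \<open>?o\<close>. Its derivative has smaller degree in \<open>?o\<close> and is
  nonzero, so it is not a multiple of \<open>P\<close> and not in the ideal; nor is \<open>R\<close>. At a sum of seven cubes where
  neither of them vanishes, \<open>P\<close> has a simple zero along the line in direction \<open>?o\<close>, so that \<open>D\<close> has
  a zero of order exactly \<open>k\<close>.
\<close>

lemma multiplicity_at_least:
  fixes P D R :: "(cubic_monomial, 'a::{alg_closed_field, field_char_0}) mpolynomial"
  assumes P: "irreducible P" "P \<in> secant_ideal" and D: "D = P ^ k * R" "\<not> P dvd R"
    and order: "\<And>u z. \<exists>g. polynomial_fun g \<and>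
      (\<forall>s. peval (\<lambda>m. cubic_coords (cubes u) m + s * z m) D = s ^ r * g s)"
  shows "r \<le> k"
proof (rule ccontr)
  assume "\<not> r \<le> k"
  let ?o = "cmon 0 1 2"
  have R: "R \<notin> secant_ideal" using secant_ideal_generator[OF P] D(2) by blast
  obtain p where p: "p \<in> coeffs_in (- {?o})" "P = at_var ?o p" by (rule at_var_surj)
  obtain q where q: "q \<in> coeffs_in (- {?o})" "R = at_var ?o q" by (rule at_var_surj)
  interpret h: ring_morphism "at_var ?o :: (cubic_monomial, 'a) mpolynomial poly \<Rightarrow> _"
    by (rule ring_morphism_at_var)
  define P' where "P' = at_var ?o (pderiv p)"
  have dp: "pderiv p \<in> coeffs_in (- {?o})"
  proof -
    have "of_nat n = (const (of_nat n) :: (cubic_monomial, 'a) mpolynomial)" for n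
      using ring_morphism.of_nat[OF ring_morphism_const] by metis
    then have "of_nat n \<in> (mpolys_in (- {?o}) :: (cubic_monomial, 'a) mpolynomial set)" for n
      using mpolys_in_const by metis
    then show ?thesis using p(1) by (simp add: coeffs_in_def coeff_pderiv mpolys_in_mult del: of_nat_Suc)
  qed
  have deg: "degree p > 0"
  proof (rule ccontr)
    assume "\<not> ?thesis"
    then obtain c where "p = [:c:]" by (auto elim: degree_eq_zeroE)
    then have "P = c" "c \<in> mpolys_in (- {?o})" using p by (auto simp: at_var_def coeffs_in_def dest: spec[of _ 0])
    then show False using secant_ideal_no_elimination[of P] P by auto
  qed
  have "P' \<notin> secant_ideal"
  proof
    assume "P' \<in> secant_ideal"
    then obtain c where c: "P' = P * c" using secant_ideal_generator[OF P] by (auto simp: dvd_def)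
    obtain c' where c': "c' \<in> coeffs_in (- {?o})" "c = at_var ?o c'" by (rule at_var_surj)
    have "p * c' \<in> coeffs_in (- {?o})"
      using p(1) c'(1) by (auto simp: coeffs_in_def coeff_mult intro!: mpolys_in_sum mpolys_in_mult)
    moreover have "at_var ?o (pderiv p) = at_var ?o (p * c')"
      using c unfolding P'_def c'(2) p(2) h.mult .
    ultimately have eq: "pderiv p = p * c'" using inj_on_at_var[of ?o "- {?o}"] dp by (auto dest: inj_onD)
    have "pderiv p \<noteq> 0" using deg by (simp add: pderiv_eq_0_iff)
    then have "c' \<noteq> 0" "p \<noteq> 0" using eq by auto
    then have "degree p \<le> degree (pderiv p)" unfolding eq by (simp add: degree_mult_eq)
    then show False using deg by (simp add: degree_pderiv)
  qed
  then have "P' * R \<notin> secant_ideal" using secant_ideal_prime R by blast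
  then obtain u where u: "peval (cubic_coords (cubes u)) P' \<noteq> 0" "peval (cubic_coords (cubes u)) R \<noteq> 0"
    by (auto simp: secant_ideal_def peval_mult)
  define a where "a = cubic_coords (cubes u)"
  define f where "f = map_poly (peval a) p"
  define g where "g = map_poly (peval a) q"
  have ev: "peval (a(?o := s)) (at_var ?o x) = poly (map_poly (peval a) x) s" if "x \<in> coeffs_in (- {?o})" for x s
    using that by (rule peval_at_var) simp
  have f0: "poly f (a ?o) = 0" using ev[OF p(1), of "a ?o"] P(2) by (simp add: f_def p(2)[symmetric] a_def secant_ideal_def)
  then obtain f' where f': "f = [:- a ?o, 1:] * f'" by (auto simp: poly_eq_0_iff_dvd dvd_def)
  have "map_poly (peval a) (pderiv p) = pderiv f"
    by (rule poly_eqI) (simp add: f_def coeff_map_poly coeff_pderiv peval_0 peval_mult peval_of_nat del: of_nat_Suc)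
  then have "poly (pderiv f) (a ?o) \<noteq> 0" using ev[OF dp, of "a ?o"] u(1) by (simp add: P'_def a_def)
  moreover have "pderiv f = [:- a ?o, 1:] * pderiv f' + f' * pderiv [:- a ?o, 1:]" unfolding f' by (rule pderiv_mult)
  ultimately have f'0: "poly f' (a ?o) \<noteq> 0" by (simp add: pderiv_pCons)
  have g0: "poly g (a ?o) \<noteq> 0" using ev[OF q(1), of "a ?o"] u(2) by (simp add: g_def q(2)[symmetric] a_def)
  define z where "z m = (if m = ?o then 1 else 0 :: 'a)" for m
  obtain G where G: "polynomial_fun G" "\<And>s. peval (\<lambda>m. a m + s * z m) D = s ^ r * G s"
    using order[of u z] unfolding a_def by blast
  have line: "(\<lambda>m. a m + s * z m) = a(?o := a ?o + s)" for s by (auto simp: z_def)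
  have eq: "s ^ k * (poly f' (a ?o + s) ^ k * poly g (a ?o + s)) = s ^ r * G s" for s
  proof -
    have "s ^ r * G s = poly f (a ?o + s) ^ k * poly g (a ?o + s)"
      using G(2)[of s] ev[OF p(1)] ev[OF q(1)]
      by (simp add: line D(1) peval_mult peval_power f_def g_def p(2)[symmetric] q(2)[symmetric])
    also have "poly f (a ?o + s) = s * poly f' (a ?o + s)" by (simp add: f' algebra_simps)
    finally show ?thesis by (simp add: power_mult_distrib mult.assoc)
  qed
  have pf: "polynomial_fun (\<lambda>s. poly x (c + s))" for x and c :: 'a
    unfolding poly_altdef by (intro polynomial_intros)
  have "poly f' (a ?o + 0) ^ k * poly g (a ?o + 0) = 0 ^ (r - k) * G 0"
  proof (rule polynomial_fun_eq_at_0[of "\<lambda>s. poly f' (a ?o + s) ^ k * poly g (a ?o + s)" "\<lambda>s. s ^ (r - k) * G s"])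
    show "polynomial_fun (\<lambda>s. poly f' (a ?o + s) ^ k * poly g (a ?o + s))" by (intro polynomial_intros pf)
    show "polynomial_fun (\<lambda>s. s ^ (r - k) * G s)" by (intro polynomial_intros G)
    fix s :: 'a assume "s \<noteq> 0"
    moreover have "s ^ r = s ^ k * s ^ (r - k)" using \<open>\<not> r \<le> k\<close> by (simp flip: power_add)
    ultimately show "poly f' (a ?o + s) ^ k * poly g (a ?o + s) = s ^ (r - k) * G s"
      using eq[of s] by (simp add: mult.assoc)
  qed
  then show False using f'0 g0 \<open>\<not> r \<le> k\<close> by (simp add: power_0_left)
qed

text \<open>
  The three hypotheses say that \<open>D\<close> is homogeneous of degree \<open>45\<close>, is nonzero at \<open>test_cubic\<close>, and vanishes
  to order \<open>3\<close> at the sums of seven cubes. Write \<open>D = P\<^sup>k R\<close> with a generator \<open>P\<close> of the ideal that does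
  not divide \<open>R\<close>, and let \<open>d\<close> be the degree of \<open>P\<close>. Then \<open>k \<ge> 3\<close>, \<open>d \<ge> 15\<close>, and comparing the powers of \<open>t\<close> in
  \<open>D (t \<phi>)\<close> gives \<open>d k \<le> 45\<close>. So \<open>R\<close> is constant wherever \<open>P\<close> is nonzero.
\<close>

theorem secant_equation:
  fixes D :: "(cubic_monomial, 'a::{alg_closed_field, field_char_0}) mpolynomial"
  assumes hom: "\<And>t y. peval (\<lambda>m. t * y m) D = t ^ 45 * peval y D"
    and test: "peval (cubic_coords test_cubic) D \<noteq> 0"
    and order: "\<And>u z. \<exists>g. polynomial_fun g \<and>
      (\<forall>s. peval (\<lambda>m. cubic_coords (cubes u) m + s * z m) D = s ^ 3 * g s)"
  obtains P where "irreducible P" "homogeneous 15 P" "\<And>y. 2 * peval y P ^ 3 = peval y D"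
    "\<And>F. F \<in> secant_ideal \<longleftrightarrow> P dvd F"
proof -
  have D0: "D \<noteq> 0" using test by (auto simp: peval_0)
  have "peval (cubic_coords (cubes u)) D = 0" for u
  proof -
    obtain g where "\<And>s. peval (\<lambda>m. cubic_coords (cubes u) m + s * 0) D = s ^ 3 * g s"
      using order[of u "\<lambda>_. 0"] by blast
    from this[of 0] show ?thesis by simp
  qed
  then have D: "D \<in> secant_ideal" by (simp add: secant_ideal_def)
  obtain P :: "(cubic_monomial, 'a) mpolynomial" where P: "irreducible P" "P \<in> secant_ideal"
    by (rule irreducible_in_prime_ideal[OF secant_ideal_prime secant_ideal_no_unit D D0])
  obtain k R where R: "D = P ^ k * R" "\<not> P dvd R" by (rule multiplicity_of_irreducible[OF P(1) D0])
  have k: "3 \<le> k" using P R by (rule multiplicity_at_least) (rule order)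
  obtain w where w: "\<And>\<mu> i. \<mu> \<in> Poly_Mapping.keys P \<Longrightarrow> weight i \<mu> = w"
    by (rule generator_weights[OF P]) (rule that, blast)
  have deg: "3 * monomial_degree \<mu> = 5 * w" if "\<mu> \<in> Poly_Mapping.keys P" for \<mu>
    using sum_weight[of \<mu>] w[OF that] by simp
  let ?y = "cubic_coords (test_cubic :: (5, 'a) mpolynomial)"
  have test': "peval ?y P \<noteq> 0" using test k by (auto simp: R peval_mult peval_power)
  then have "\<exists>\<nu>\<in>Poly_Mapping.keys P. Poly_Mapping.lookup P \<nu> * monomial_value ?y \<nu> \<noteq> 0"
    unfolding peval_monomials by (meson sum.neutral)
  then obtain \<nu> where \<nu>: "\<nu> \<in> Poly_Mapping.keys P" "monomial_value ?y \<nu> \<noteq> 0" by auto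
  define d where "d = monomial_degree \<nu>"
  have hP: "homogeneous d P"
    unfolding homogeneous_def d_def using deg[OF \<nu>(1)] deg by (metis mult_left_cancel zero_neq_numeral)
  have "?y m \<noteq> 0" if "m \<in> Poly_Mapping.keys \<nu>" for m
    using \<nu>(2) that by (auto simp: monomial_value_def in_keys_iff)
  then have supp: "Poly_Mapping.keys \<nu> \<subseteq> {cmon 4 4 4, cmon 3 3 3, cmon 1 2 4, cmon 0 2 3, cmon 0 1 1}"
    using cubic_coords_test_cubic_nonzero by blast
  have "d > 0"
  proof (rule ccontr)
    assume "\<not> d > 0"
    then have zero: "\<mu> = 0" if "\<mu> \<in> Poly_Mapping.keys P" for \<mu>
      using hP that monomial_degree_eq_0 by (auto simp: homogeneous_def)
    have "P \<in> mpolys_in (- {cmon 0 1 2})" by (auto simp: mpolys_in_def dest!: zero)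
    then show False using secant_ideal_no_elimination[of P] P by auto
  qed
  then have d15: "15 \<le> d" using test_monomial_degree[OF supp] w[OF \<nu>(1)] by (simp add: d_def)
  have scale: "t ^ 45 * peval y D = t ^ (d * k) * peval y P ^ k * peval (\<lambda>m. t * y m) R" for t y
  proof -
    have "t ^ 45 * peval y D = peval (\<lambda>m. t * y m) D" by (rule hom[symmetric])
    also have "\<dots> = peval (\<lambda>m. t * y m) P ^ k * peval (\<lambda>m. t * y m) R"
      unfolding R(1) peval_mult peval_power ..
    also have "peval (\<lambda>m. t * y m) P = t ^ d * peval y P" by (rule peval_homogeneous[OF hP])
    finally show ?thesis by (simp only: power_mult_distrib power_mult)
  qed
  have pR: "polynomial_fun (\<lambda>t. peval (\<lambda>m. t * y m) R)" for y by (intro polynomial_intros)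
  have "d * k \<le> 45"
  proof (rule ccontr)
    assume gt: "\<not> d * k \<le> 45"
    then have split: "t ^ (d * k) = t ^ 45 * t ^ (d * k - 45)" for t :: 'a by (simp flip: power_add)
    have "peval ?y D = 0 ^ (d * k - 45) * (peval ?y P ^ k * peval (\<lambda>m. 0 * ?y m) R)"
    proof (rule polynomial_fun_eq_at_0[of "\<lambda>t. peval ?y D" "\<lambda>t. t ^ (d * k - 45) * (peval ?y P ^ k * peval (\<lambda>m. t * ?y m) R)"])
      show "peval ?y D = t ^ (d * k - 45) * (peval ?y P ^ k * peval (\<lambda>m. t * ?y m) R)" if "t \<noteq> 0" for t
        using scale[of t ?y] that by (simp add: split mult.assoc)
    qed (intro polynomial_intros pR)+
    then show False using test gt by (simp add: power_0_left)
  qed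
  moreover have "d * 3 \<le> d * k" "15 * k \<le> d * k" using d15 k by simp_all
  ultimately have dk: "d = 15" "k = 3" using d15 k by linarith+
  define c where "c = peval (\<lambda>_. 0) R"
  have DP: "peval y D = c * peval y P ^ 3" for y
  proof (cases "peval y P = 0")
    case True
    then show ?thesis by (simp add: R dk peval_mult peval_power)
  next
    case False
    have "peval (\<lambda>m. t * y m) R = peval y R" if "t \<noteq> 0" for t
      using scale[of t y] that False by (simp add: R(1) dk peval_mult peval_power mult.assoc)
    then have "peval (\<lambda>m. 0 * y m) R = peval y R"
      by (rule polynomial_fun_eq_at_0[OF pR polynomial_fun_const])
    then show ?thesis by (simp add: R(1) dk peval_mult peval_power c_def)
  qed
  have "c \<noteq> 0" using test DP by auto
  obtain e where e: "e ^ 3 = c / 2" using nth_root_exists[of 3 "c / 2"] by auto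
  then have e0: "e \<noteq> 0" using \<open>c \<noteq> 0\<close> by auto
  \<comment> \<open>Rescaling by \<open>e\<close> turns the constant \<open>c\<close> into \<open>2\<close>.\<close>
  define Q where "Q = const e * P"
  have inv: "const (inverse e) * const e = (1 :: (cubic_monomial, 'a) mpolynomial)"
    using e0 by (simp add: mult_single)
  have PQ: "P = const (inverse e) * Q" unfolding Q_def by (metis inv mult.assoc mult_1)
  show thesis
  proof (rule that[of Q])
    show "irreducible Q"
    proof (rule irreducibleI)
      show "Q \<noteq> 0" using P(1) PQ by auto
      show "\<not> Q dvd 1"
      proof
        assume "Q dvd 1"
        then have "P dvd 1" unfolding Q_def by (rule dvd_mult_right)
        then show False using P(1) irreducible_not_unit by blast
      qed
      fix x y assume "Q = x * y"
      then have "P = (const (inverse e) * x) * y" using PQ by (simp add: mult.assoc)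
      then have "const (inverse e) * x dvd 1 \<or> y dvd 1" by (rule irreducibleD[OF P(1)])
      then show "x dvd 1 \<or> y dvd 1" by (meson dvd_mult_right)
    qed
    show "homogeneous 15 Q"
      using hP unfolding Q_def homogeneous_def by (auto simp: in_keys_iff lookup_const_mult dk)
    show "2 * peval y Q ^ 3 = peval y D" for y
      by (simp add: Q_def peval_mult peval_const power_mult_distrib e DP)
    show "F \<in> secant_ideal \<longleftrightarrow> Q dvd F" for F
    proof
      assume "F \<in> secant_ideal"
      then obtain x where "F = P * x" using secant_ideal_generator[OF P] by (auto simp: dvd_def)
      then have "F = Q * (const (inverse e) * x)" using PQ by (simp add: ac_simps)
      then show "Q dvd F" by simp
    next
      assume "Q dvd F"
      then show "F \<in> secant_ideal"
        using P(2) secant_ideal_mult unfolding Q_def by (auto simp: mult.assoc elim!: dvdE)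
    qed
  qed
qed

section \<open>The determinant of the contraction operator\<close>

lemma tensor_lift_linear:
  "tensor_lift f (s + t) = tensor_lift f s + tensor_lift f t" "tensor_lift f (c *s t) = c *s tensor_lift f t"
  by (simp_all add: tensor_lift_def vec_eq_iff sum.distrib sum_distrib_left algebra_simps)

lemma B_product_linear:
  "B_product u (s + t) = B_product u s + B_product u t" "B_product u (c *s t) = c *s B_product u t"
  unfolding B_product_def by (rule tensor_lift_linear)+

lemma B_prime_linear:
  "B_prime \<phi> (s + t) = B_prime \<phi> s + B_prime \<phi> t" "B_prime \<phi> (c *s t) = c *s B_prime \<phi> t"
  unfolding B_prime_def B_product_linear case_prod_beta
  by (simp_all add: vec_eq_iff sum.distrib sum_distrib_left distrib_left mult.left_commute mult.assoc)

lemma B_prime_sum_right: "B_prime \<phi> (\<Sum>x\<in>X. f x) = (\<Sum>x\<in>X. B_prime \<phi> (f x))"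
proof (induction X rule: infinite_finite_induct)
  case (insert x F)
  then show ?case by (simp add: B_prime_linear)
qed (use B_prime_linear(2)[of \<phi> 0 0] in simp_all)

lemma B_prime_const_mult: "B_prime (const c * \<phi>) t = c *s B_prime \<phi> t"
  for t :: "'a::comm_ring_1 ^ (5 set \<times> 5 set)"
  by (simp add: B_prime_def lookup_const_mult vec_eq_iff sum_distrib_left case_prod_beta mult.assoc)

lemma B_prime_cubic_of:
  "B_prime (cubic_of y) t = (\<Sum>m\<in>UNIV. y m *s B_prime (Poly_Mapping.single (Rep_cubic_monomial m) 1) t)"
  for t :: "'a::comm_ring_1 ^ (5 set \<times> 5 set)"
proof -
  have "Poly_Mapping.single (Rep_cubic_monomial m) (y m) = const (y m) * Poly_Mapping.single (Rep_cubic_monomial m) 1" for m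
    by (simp add: mult_single)
  then show ?thesis unfolding cubic_of_def by (simp only: B_prime_sum B_prime_const_mult)
qed

context
  fixes b :: "45 \<Rightarrow> 'a::field_char_0 ^ (5 set \<times> 5 set)" and b' :: "45 \<Rightarrow> 'a ^ (5 set \<times> 5)"
  assumes b: "is_basis (*s) b Gamma_2211" and b': "is_basis (*s) b' Gamma_211"
begin

lemma b_inj: "inj b" and b_ind: "vec.independent (range b)" and b_span: "vec.span (range b) = Gamma_2211"
  using b by (auto simp: is_basis_def)

lemma b'_inj: "inj b'" and b'_ind: "vec.independent (range b')" and b'_span: "vec.span (range b') = Gamma_211"
  using b' by (auto simp: is_basis_def)

lemma B_prime_basis_in: "B_prime \<phi> (b j) \<in> vec.span (range b')"
proof -
  have "b j \<in> vec.span (range b)" by (rule vec.span_base) simp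
  then have "b j \<in> Gamma_2211" by (simp only: b_span)
  then show ?thesis unfolding b'_span by (intro B_prime_in_Gamma_211) (auto simp: Gamma_2211_def)
qed

definition of_coords :: "'a ^ 45 \<Rightarrow> 'a ^ (5 set \<times> 5 set)" where
  "of_coords x = (\<Sum>j\<in>UNIV. x $ j *s b j)"

lemma of_coords_linear: "of_coords (x + y) = of_coords x + of_coords y" "of_coords (c *s x) = c *s of_coords x"
  by (simp_all add: of_coords_def vec_eq_iff sum.distrib sum_distrib_left algebra_simps)

lemma of_coords_in: "of_coords x \<in> Gamma_2211"
  unfolding of_coords_def b_span[symmetric] by (intro vec.span_sum vec.span_scale vec.span_base) auto

lemma independent_sum_eq_0:
  fixes c :: "45 \<Rightarrow> 'a ^ 'n"
  assumes "inj c" "vec.independent (range c)" "(\<Sum>j\<in>UNIV. x $ j *s c j) = 0"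
  shows "x = 0"
proof -
  have "(\<Sum>v\<in>range c. x $ (inv c v) *s v) = (\<Sum>j\<in>UNIV. x $ j *s c j)"
    using assms(1) by (simp add: sum.reindex)
  then have "x $ (inv c (c j)) = 0" for j
    using vec.independentD[OF assms(2) _ subset_refl, of "\<lambda>v. x $ (inv c v)" "c j"] assms(3) by auto
  then show ?thesis using assms(1) by (simp add: vec_eq_iff)
qed

lemma B_prime_of_coords: "B_prime \<phi> (of_coords x) = (\<Sum>i\<in>UNIV. (B_matrix b b' \<phi> *v x) $ i *s b' i)"
proof -
  have col: "B_prime \<phi> (b j) = (\<Sum>i\<in>UNIV. B_matrix b b' \<phi> $ i $ j *s b' i)" for j
    using vec.sum_representation_eq[OF b'_ind B_prime_basis_in[of \<phi> j] _ subset_refl] b'_inj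
    by (simp add: sum.reindex B_matrix_def)
  have "B_prime \<phi> (of_coords x) = (\<Sum>j\<in>UNIV. \<Sum>i\<in>UNIV. (x $ j * B_matrix b b' \<phi> $ i $ j) *s b' i)"
    unfolding of_coords_def B_prime_sum_right B_prime_linear col
    by (simp add: vec_eq_iff sum_distrib_left mult.assoc)
  also have "\<dots> = (\<Sum>i\<in>UNIV. \<Sum>j\<in>UNIV. (x $ j * B_matrix b b' \<phi> $ i $ j) *s b' i)" by (rule sum.swap)
  also have "\<dots> = (\<Sum>i\<in>UNIV. (B_matrix b b' \<phi> *v x) $ i *s b' i)"
    by (simp add: matrix_vector_mult_def vec_eq_iff sum_distrib_left sum_distrib_right ac_simps)
  finally show ?thesis .
qed

lemma B_matrix_mult_eq_0_iff: "B_matrix b b' \<phi> *v x = 0 \<longleftrightarrow> B_prime \<phi> (of_coords x) = 0"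
  using independent_sum_eq_0[OF b'_inj b'_ind, of "B_matrix b b' \<phi> *v x"] unfolding B_prime_of_coords by auto

lemma B_matrix_nth_cubic_of:
  "B_matrix b b' (cubic_of y) $ i $ j =
    (\<Sum>m\<in>UNIV. y m * B_matrix b b' (Poly_Mapping.single (Rep_cubic_monomial m) 1) $ i $ j)"
proof -
  have "vec.representation (range b') (\<Sum>m\<in>UNIV. y m *s B_prime (Poly_Mapping.single (Rep_cubic_monomial m) 1) (b j)) =
    (\<lambda>v. \<Sum>m\<in>UNIV. vec.representation (range b') (y m *s B_prime (Poly_Mapping.single (Rep_cubic_monomial m) 1) (b j)) v)"
    by (rule vec.representation_sum[OF b'_ind]) (intro vec.span_scale B_prime_basis_in)
  then show ?thesis
    by (simp add: B_matrix_def B_prime_cubic_of vec.representation_scale[OF b'_ind B_prime_basis_in])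
qed

definition B_det :: "(cubic_monomial, 'a) mpolynomial" where
  "B_det = det (\<chi> i j. \<Sum>m\<in>UNIV. mvar m * const (B_matrix b b' (Poly_Mapping.single (Rep_cubic_monomial m) 1) $ i $ j))"

lemma peval_B_det: "peval y B_det = det (B_matrix b b' (cubic_of y))"
proof -
  have "B_matrix b b' (cubic_of y) = (\<chi> i j. \<Sum>m\<in>UNIV. y m * B_matrix b b' (Poly_Mapping.single (Rep_cubic_monomial m) 1) $ i $ j)"
    by (simp add: vec_eq_iff B_matrix_nth_cubic_of)
  then show ?thesis by (simp add: B_det_def peval_det peval_sum peval_mult peval_mvar peval_const)
qed

lemma B_det_homogeneous: "peval (\<lambda>m. t * y m) B_det = t ^ 45 * peval y B_det"
proof -
  have "B_matrix b b' (cubic_of (\<lambda>m. t * y m)) = (\<chi> i. t *s B_matrix b b' (cubic_of y) $ i)"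
    by (simp add: vec_eq_iff B_matrix_nth_cubic_of sum_distrib_left mult.assoc)
  then show ?thesis by (simp add: peval_B_det det_rows_mul)
qed

lemma B_det_test_cubic: "peval (cubic_coords test_cubic) B_det \<noteq> 0"
proof -
  have tc: "test_cubic \<in> (cubics :: (5, 'a) mpolynomial set)"
  proof -
    have "monomial_degree m = 3" if "m \<in> Poly_Mapping.keys (test_cubic :: (5, 'a) mpolynomial)" for m
      using that unfolding test_cubic_def
      by (auto dest!: subsetD[OF keys_add] split: if_splits simp: cubic_monomial_of_degree)
    then show ?thesis by (simp add: cubics_def homogeneous_def)
  qed
  have "x = y" if eq: "B_matrix b b' test_cubic *v x = B_matrix b b' test_cubic *v y" for x y
  proof -
    have "B_matrix b b' test_cubic *v (x - y) = 0"
      using eq by (simp add: matrix_vector_mult_diff_distrib)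
    then have "of_coords (x - y) = 0"
      using B_matrix_mult_eq_0_iff[of test_cubic "x - y"] B_prime_test_cubic_injective[OF of_coords_in] by simp
    then have "x - y = 0" unfolding of_coords_def by (rule independent_sum_eq_0[OF b_inj b_ind])
    then show ?thesis by simp
  qed
  then have "\<exists>C. C ** B_matrix b b' test_cubic = mat 1"
    by (simp add: matrix_left_invertible_injective inj_on_def)
  then have "det (B_matrix b b' test_cubic) \<noteq> 0" by (metis invertible_det_nz invertible_left_inverse)
  then show ?thesis using tc by (simp add: peval_B_det cubic_of_coords)
qed

text \<open>
  At a sum of seven cubes the kernel is cut out by \<open>42\<close> linear conditions in a space of dimension \<open>45\<close>.
\<close>

lemma B_det_order:
  "\<exists>g. polynomial_fun g \<and> (\<forall>s. peval (\<lambda>m. cubic_coords (cubes u) m + s * z m) B_det = s ^ 3 * g s)"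
proof (rule B_prime_sum_of_cubes_rank[where u = u and n = 7])
  fix L and f :: "nat \<times> 5 set \<Rightarrow> 'a ^ (5 set \<times> 5 set) \<Rightarrow> 'a"
  assume L: "finite L" "card L = 6 * 7"
    and f: "\<And>l s t. f l (s + t) = f l s + f l t" "\<And>l c t. f l (c *s t) = c * f l t"
    and ker: "\<And>t. t \<in> Gamma_2211 \<Longrightarrow> (\<And>l. l \<in> L \<Longrightarrow> f l t = 0) \<Longrightarrow>
      B_prime (\<Sum>k<7. linear_form (u k) ^ 3) t = 0"
  obtain g where g: "polynomial_fun g"
    "\<And>s. det (\<chi> i j. B_matrix b b' (cubes u) $ i $ j + s * B_matrix b b' (cubic_of z) $ i $ j) = s ^ 3 * g s"
  proof (rule det_pencil_small_rank[of L 3 "\<lambda>l x. f l (of_coords x)" "B_matrix b b' (cubes u)" "B_matrix b b' (cubic_of z)"])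
    show "B_matrix b b' (cubes u) *v x = 0" if "\<And>l. l \<in> L \<Longrightarrow> f l (of_coords x) = 0" for x
      unfolding B_matrix_mult_eq_0_iff cubes_def by (rule ker[OF of_coords_in that])
  qed (use L in \<open>simp_all add: f of_coords_linear\<close>)
  have "B_matrix b b' (cubic_of (\<lambda>m. cubic_coords (cubes u) m + s * z m)) =
      (\<chi> i j. B_matrix b b' (cubes u) $ i $ j + s * B_matrix b b' (cubic_of z) $ i $ j)" for s
  proof -
    have "B_matrix b b' (cubes u) = B_matrix b b' (cubic_of (cubic_coords (cubes u)))"
      by (simp add: cubic_of_coords cubes_in_cubics)
    then show ?thesis
      by (simp add: vec_eq_iff B_matrix_nth_cubic_of sum.distrib sum_distrib_left algebra_simps)
  qed
  then show ?thesis using g by (auto simp: peval_B_det)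
qed

end

lemma coords_surj:
  fixes smul :: "'a::field \<Rightarrow> 'v::ab_group_add \<Rightarrow> 'v"
  assumes "vector_space smul" "is_basis smul e UNIV"
  shows "\<exists>v. coords smul e v = w"
proof -
  interpret V: vector_space smul by fact
  have e: "inj e" "V.independent (range e)" using assms(2) by (auto simp: is_basis_def)
  have "V.representation (range e) (\<Sum>j\<in>UNIV. smul (w $ j) (e j)) (e i) = w $ i" for i
  proof -
    have "V.representation (range e) (\<Sum>j\<in>UNIV. smul (w $ j) (e j)) (e i) =
        (\<Sum>j\<in>UNIV. V.representation (range e) (smul (w $ j) (e j)) (e i))"
      using V.representation_sum[OF e(2), of UNIV "\<lambda>j. smul (w $ j) (e j)"]
      by (simp add: V.span_base V.span_scale)
    also have "\<dots> = (\<Sum>j\<in>UNIV. w $ j * V.representation (range e) (e j) (e i))"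
      by (simp add: V.representation_scale[OF e(2)] V.span_base)
    also have "\<dots> = (\<Sum>j\<in>UNIV. if j = i then w $ j else 0)"
      using e by (intro sum.cong refl) (auto simp: V.representation_basis inj_eq)
    finally show ?thesis by simp
  qed
  then show ?thesis by (intro exI[of _ "\<Sum>j\<in>UNIV. smul (w $ j) (e j)"]) (simp add: coords_def vec_eq_iff)
qed

lemma sums_of_cubes:
  assumes "vector_space smul" "is_basis smul e UNIV"
  shows "range (sum_of_cubes smul e 7) = range cubes"
proof -
  have eq: "sum_of_cubes smul e 7 g = cubes (\<lambda>k. coords smul e (g k))" for g
    by (simp add: sum_of_cubes_def cubes_def)
  moreover have "cubes u \<in> range (sum_of_cubes smul e 7)" for u
  proof -
    have "\<forall>k. \<exists>v. coords smul e v = u k" using coords_surj[OF assms] by blast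
    then obtain g where "\<And>k. coords smul e (g k) = u k" by metis
    then have "sum_of_cubes smul e 7 g = cubes u" using eq[of g] by simp
    then show ?thesis by (metis rangeI)
  qed
  ultimately show ?thesis by auto
qed

text \<open>
  The zeros of \<open>P\<close> form a closed set containing the classes of the sums of cubes. Conversely, the equations
  \<open>F\<close> of any closed set containing these classes are homogeneous, hence vanish on all sums of seven cubes and
  are multiples of \<open>P\<close>.
\<close>

lemma secant_variety_hypersurface:
  fixes P :: "(cubic_monomial, 'a::field_char_0) mpolynomial"
  assumes e: "vector_space smul" "is_basis smul e UNIV"
    and P: "homogeneous d P" "\<And>F. F \<in> secant_ideal \<longleftrightarrow> P dvd F"
  shows "secant_variety smul e 7 = proj_zeros {P}"
proof -
  define X where "X = proj_point ` {cubes u |u. cubes u \<noteq> (0 :: (5, 'a) mpolynomial)}"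
  have nonzero: "{f g |g. f g \<noteq> 0} = range f - {0}" for f :: "'y \<Rightarrow> (5, 'a) mpolynomial" by auto
  have X: "proj_point ` {sum_of_cubes smul e 7 g |g. sum_of_cubes smul e 7 g \<noteq> 0} = X"
    unfolding X_def nonzero sums_of_cubes[OF e] ..
  have "zariski_closed (proj_zeros {P})" unfolding zariski_closed_def using P(1) by blast
  moreover have "X \<subseteq> proj_zeros {P}"
  proof -
    have "P \<in> secant_ideal" using P(2) by simp
    then show ?thesis
      unfolding X_def proj_zeros_def by (auto simp: secant_ideal_def eval_cubic_eq cubes_in_cubics)
  qed
  moreover have "proj_zeros {P} \<subseteq> Z" if Z: "zariski_closed Z" "X \<subseteq> Z" for Z
  proof -
    obtain Fs where Fs: "\<And>F. F \<in> Fs \<Longrightarrow> \<exists>d. homogeneous d F" "Z = proj_zeros Fs"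
      using Z(1) unfolding zariski_closed_def by blast
    have "F \<in> secant_ideal" if F: "F \<in> Fs" for F
    proof -
      obtain n where n: "homogeneous n F" using Fs(1)[OF F] by blast
      have nonzero: "peval (cubic_coords (cubes u)) F = 0" if u: "cubes u \<noteq> 0" for u
      proof -
        have "proj_point (cubes u) \<in> proj_zeros Fs" using u Z(2) Fs(2) unfolding X_def by blast
        then obtain \<psi> where \<psi>: "proj_point (cubes u) = proj_point \<psi>" "eval_cubic F \<psi> = 0"
          using F unfolding proj_zeros_def by auto
        have "cubes u \<in> proj_point (cubes u)" unfolding proj_point_def by (auto intro: exI[of _ 1])
        then have "cubes u \<in> proj_point \<psi>" by (simp only: \<psi>(1))
        then obtain c where c: "cubes u = const c * \<psi>" unfolding proj_point_def by blast
        then have "cubic_coords (cubes u) = (\<lambda>m. c * cubic_coords \<psi> m)" by (simp add: fun_eq_iff cubic_coords_scale)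
        then show ?thesis using \<psi>(2) by (simp add: peval_homogeneous[OF n] eval_cubic_eq)
      qed
      \<comment> \<open>The zero cubic has no class in projective space. There \<open>F\<close> vanishes because it vanishes on the line of a nonzero sum.\<close>
      obtain u0 where "peval (cubic_coords (cubes u0)) (mvar (cmon 0 0 0)) \<noteq> (0 :: 'a)"
      proof -
        have "mvar (cmon 0 0 0) \<in> (mpolys_in (- {cmon 0 1 2}) :: (cubic_monomial, 'a) mpolynomial set)"
          using less_5 by (intro mpolys_in_mvar) (auto dest!: cmon_inject intro: less_imp_le)
        moreover have "peval (\<lambda>_. 1 :: 'a) (mvar (cmon 0 0 0)) \<noteq> 0" by (simp add: peval_mvar)
        then have "mvar (cmon 0 0 0) \<noteq> (0 :: (cubic_monomial, 'a) mpolynomial)" by (auto simp: peval_0)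
        ultimately show thesis using secant_elimination that by blast
      qed
      then have "cubes u0 \<noteq> (0 :: (5, 'a) mpolynomial)" by (auto simp: peval_mvar cubic_coords_def)
      then have "peval (cubic_coords (cubes u0)) F = 0" by (rule nonzero)
      then have "peval (\<lambda>m. 0 * cubic_coords (cubes u0) m) F = 0" by (simp only: peval_homogeneous[OF n] mult_zero_right)
      then have zero: "peval (\<lambda>_. 0) F = 0" by simp
      have "peval (cubic_coords (cubes u)) F = 0" for u
      proof (cases "cubes u = (0 :: (5, 'a) mpolynomial)")
        case True
        then show ?thesis using zero by (simp add: cubic_coords_def[abs_def])
      qed (rule nonzero)
      then show ?thesis by (simp add: secant_ideal_def)
    qed
    then have "eval_cubic F \<phi> = 0" if "F \<in> Fs" "eval_cubic P \<phi> = 0" for F \<phi>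
    proof -
      obtain G where "F = P * G" using P(2) \<open>\<And>F. F \<in> Fs \<Longrightarrow> F \<in> secant_ideal\<close> \<open>F \<in> Fs\<close> by (auto simp: dvd_def)
      then show ?thesis using \<open>eval_cubic P \<phi> = 0\<close> by (simp add: eval_cubic_eq peval_mult)
    qed
    then show ?thesis unfolding Fs(2) proj_zeros_def by auto
  qed
  ultimately show ?thesis unfolding secant_variety_def zariski_closure_def X by blast
qed

theorem theorem1p1:
  fixes smul :: "'a::{alg_closed_field, field_char_0} \<Rightarrow> 'v::ab_group_add \<Rightarrow> 'v"
    and e :: "5 \<Rightarrow> 'v"
    and b :: "45 \<Rightarrow> 'a ^ (5 set \<times> 5 set)"
    and b' :: "45 \<Rightarrow> 'a ^ (5 set \<times> 5)"
  assumes "vector_space smul"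
    and "is_basis smul e UNIV"
    and "is_basis (*s) b Gamma_2211"
    and "is_basis (*s) b' Gamma_211"
  shows "\<exists>P :: (cubic_monomial, 'a) mpolynomial.
    irreducible P \<and> homogeneous 15 P \<and>
    (\<forall>\<phi>\<in>cubics. 2 * eval_cubic P \<phi> ^ 3 = det (B_matrix b b' \<phi>)) \<and>
    secant_variety smul e 7 = proj_zeros {P}"
proof -
  note basis = assms(3,4)
  obtain P where P: "irreducible P" "homogeneous 15 P" "\<And>y. 2 * peval y P ^ 3 = peval y (B_det b b')"
    "\<And>F. F \<in> secant_ideal \<longleftrightarrow> P dvd F"
    using secant_equation[OF B_det_homogeneous[OF basis] B_det_test_cubic[OF basis] B_det_order[OF basis]] by metis
  have "2 * eval_cubic P \<phi> ^ 3 = det (B_matrix b b' \<phi>)" if "\<phi> \<in> cubics" for \<phi>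
    using P(3)[of "cubic_coords \<phi>"] cubic_of_coords[OF that] by (simp add: eval_cubic_eq peval_B_det[OF basis])
  moreover have "secant_variety smul e 7 = proj_zeros {P}"
    by (rule secant_variety_hypersurface[OF assms(1,2) P(2,4)])
  ultimately show ?thesis using P(1,2) by blast
qed

end
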